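(* There is an algorithm that, given a string $S$ of length $n$, a positive integer $k$, a $k$-repeating subsequence $X$ of $S$, and a character $\sigma$ occurring in $X$, returns a maximal $k$-repeating subsequence $Y$ of $S$ such that $X$ is a subsequence of $Y$, in $O\!\left(\binom{R+k}{k}\cdot k\, n\log n\right)$ time, where $R=|S|_\sigma-k\cdot|X|_\sigma$.
   Context: $|W|_\sigma$ denotes the number of occurrences of $\sigma$ in the string $W$. A subsequence $X$ of $S$ is a $k$-repeating subsequence of $S$ if $X^k$ (the concatenation of $k$ copies of $X$) is a subsequence of $S$. A $k$-repeating subsequence $X$ of $S$ is maximal if no string properly containing $X$ as a subsequence is a $k$-repeating subsequence of $S$. *)

theory Defs
  imports Complex_Main "HOL-Library.Sublist"
begin

section \<open>Repeating subsequences\<close>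

definition k_repeating :: "nat \<Rightarrow> 'a list \<Rightarrow> 'a list \<Rightarrow> bool" where
  "k_repeating k X S \<longleftrightarrow> subseq (concat (replicate k X)) S"

definition maximal_k_repeating :: "nat \<Rightarrow> 'a list \<Rightarrow> 'a list \<Rightarrow> bool" where
  "maximal_k_repeating k X S \<longleftrightarrow>
     k_repeating k X S \<and> \<not> (\<exists>Z. strict_subseq X Z \<and> k_repeating k Z S)"


section \<open>A word RAM\<close>

text \<open>
  Algorithms are programs of a word RAM with word size \<open>w\<close>: every register and every memory cell
  holds a natural number below \<open>2 ^ w\<close>. The memory is presented as a collection of named arrays
  with \<open>2 ^ w\<close> cells each; since a program mentions only finitely many names, this amounts to one
  memory divided into a constant number of segments. A program is a fixed syntactic object that
  does not depend on \<open>w\<close> or on the input.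
\<close>

datatype aexp =
    Const nat
  | Reg string
  | Read string aexp
  | Add aexp aexp
  | Sub aexp aexp
  | Mul aexp aexp
  | Div aexp aexp

datatype bexp =
    Less aexp aexp
  | Equal aexp aexp
  | Not bexp
  | And bexp bexp

datatype com =
    Assign string aexp
  | Store string aexp aexp
  | Seq com com
  | If bexp com com
  | While bexp com

record state =
  reg :: "string \<Rightarrow> nat"
  arr :: "string \<Rightarrow> nat \<Rightarrow> nat"

text \<open>
  Addition and multiplication wrap around modulo \<open>2 ^ w\<close>, subtraction is cut off at \<open>0\<close>, and
  division by \<open>0\<close> yields \<open>0\<close>.
\<close>

fun aval :: "nat \<Rightarrow> aexp \<Rightarrow> state \<Rightarrow> nat" where
  "aval w (Const c) s = c mod 2 ^ w"
| "aval w (Reg x) s = reg s x"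
| "aval w (Read a e) s = arr s a (aval w e s)"
| "aval w (Add e f) s = (aval w e s + aval w f s) mod 2 ^ w"
| "aval w (Sub e f) s = aval w e s - aval w f s"
| "aval w (Mul e f) s = (aval w e s * aval w f s) mod 2 ^ w"
| "aval w (Div e f) s = aval w e s div aval w f s"

fun bval :: "nat \<Rightarrow> bexp \<Rightarrow> state \<Rightarrow> bool" where
  "bval w (Less e f) s \<longleftrightarrow> aval w e s < aval w f s"
| "bval w (Equal e f) s \<longleftrightarrow> aval w e s = aval w f s"
| "bval w (Not b) s \<longleftrightarrow> \<not> bval w b s"
| "bval w (And b c) s \<longleftrightarrow> bval w b s \<and> bval w c s"

text \<open>Every node of an expression costs one time unit, and so does every executed command.\<close>

fun acost :: "aexp \<Rightarrow> nat" where
  "acost (Const c) = 1"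
| "acost (Reg x) = 1"
| "acost (Read a e) = acost e + 1"
| "acost (Add e f) = acost e + acost f + 1"
| "acost (Sub e f) = acost e + acost f + 1"
| "acost (Mul e f) = acost e + acost f + 1"
| "acost (Div e f) = acost e + acost f + 1"

fun bcost :: "bexp \<Rightarrow> nat" where
  "bcost (Less e f) = acost e + acost f + 1"
| "bcost (Equal e f) = acost e + acost f + 1"
| "bcost (Not b) = bcost b + 1"
| "bcost (And b c) = bcost b + bcost c + 1"

text \<open>
  \<open>exec w P s t s'\<close>: with word size \<open>w\<close>, program \<open>P\<close> started in state \<open>s\<close> halts after exactly
  \<open>t\<close> time units in state \<open>s'\<close>.
\<close>

inductive exec :: "nat \<Rightarrow> com \<Rightarrow> state \<Rightarrow> nat \<Rightarrow> state \<Rightarrow> bool" for w where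
  Assign: "exec w (Assign x e) s (acost e + 1) (s\<lparr>reg := (reg s)(x := aval w e s)\<rparr>)"
| Store: "exec w (Store a e f) s (acost e + acost f + 1)
    (s\<lparr>arr := (arr s)(a := (arr s a)(aval w e s := aval w f s))\<rparr>)"
| Seq: "exec w P s t1 s1 \<Longrightarrow> exec w Q s1 t2 s2 \<Longrightarrow> exec w (Seq P Q) s (t1 + t2 + 1) s2"
| IfTrue: "bval w b s \<Longrightarrow> exec w P s t s1 \<Longrightarrow> exec w (If b P Q) s (bcost b + t + 1) s1"
| IfFalse: "\<not> bval w b s \<Longrightarrow> exec w Q s t s1 \<Longrightarrow> exec w (If b P Q) s (bcost b + t + 1) s1"
| WhileFalse: "\<not> bval w b s \<Longrightarrow> exec w (While b P) s (bcost b + 1) s"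
| WhileTrue: "bval w b s \<Longrightarrow> exec w P s t1 s1 \<Longrightarrow> exec w (While b P) s1 t2 s2 \<Longrightarrow>
    exec w (While b P) s (bcost b + t1 + t2 + 1) s2"

lemma exec_deterministic:
  "exec w P s t s1 \<Longrightarrow> exec w P s t' s2 \<Longrightarrow> t' = t \<and> s2 = s1"
proof (induction arbitrary: t' s2 rule: exec.induct)
  case (Seq P s t1 s1 Q t2 s2')
  from Seq.prems show ?case by cases (use Seq.IH in blast)
next
  case (WhileTrue b s P t1 s1 t2 s2')
  from WhileTrue.prems show ?case
    by cases (use WhileTrue.hyps WhileTrue.IH in blast)+
qed (blast elim: exec.cases)+


section \<open>Input and output\<close>

text \<open>
  A character is a number that fits into one word. A string is stored as an array together with a
  register holding its length; registers and cells not occupied by the input are \<open>0\<close>.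
\<close>

definition cells :: "nat list \<Rightarrow> nat \<Rightarrow> nat" where
  "cells L i = (if i < length L then L ! i else 0)"

definition input_state :: "nat list \<Rightarrow> nat \<Rightarrow> nat list \<Rightarrow> nat \<Rightarrow> state" where
  "input_state S k X \<sigma> =
     \<lparr>reg = (\<lambda>_. 0)(''len_S'' := length S, ''k'' := k, ''len_X'' := length X, ''sigma'' := \<sigma>),
      arr = (\<lambda>_ _. 0)(''S'' := cells S, ''X'' := cells X)\<rparr>"

definition output_string :: "state \<Rightarrow> nat list" where
  "output_string s = map (arr s ''Y'') [0..<reg s ''len_Y'']"

end

(*
  Mark the first sigma of X, so that X = U sigma V. An embedding of X^k into S places the k marked
  characters on positions p_0 < ... < p_(k-1) of S, the pins. Between consecutive pins there is room for
  V U, hence the number of occurrences of sigma before p_i is i * |X|_sigma + r_i with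
  0 <= r_0 <= ... <= r_(k-1) <= R, which leaves (R + k choose k) choices. For each choice that still
  admits the current U and V, these are extended as far as possible; a choice that admits no proper
  extension never admits one later. After all choices U sigma V is maximal.

  For fixed pins, V is extended to a maximal common subsequence of k disjoint windows of S, bounded on
  the right by the rightmost embedding of U, and then U is extended in the same way to the right of the
  leftmost embedding of V. Such an extension proceeds from left to right and closes one gap after
  the other: the characters in the narrowest window of the gap are tested for occurrence in all
  windows, and a common character is inserted at the right end of the gap. A failed test is never
  repeated within a gap. When the gap is closed, the character to its right does not fit into the gap,
  so passing it skips the whole gap in some window; this pays for the tests, of which there are O(n).
  A test takes k binary searches.
*)
theory Submission
  imports Defs
begin

section \<open>Weakest preconditions with running time\<close>

text \<open>The ranks of the pins refer to \<open>m\<close>, the number of sigmas in the input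
  \<open>X\<close>, although \<open>U\<close> and \<open>V\<close> may gain further sigmas. This is
  sound because extensions keep at least \<open>m - 1\<close> sigmas in \<open>V\<close>, so their
  pins belong to the same enumeration; the marked character need not remain the first sigma. Once
  one of \<open>U\<close>, \<open>V\<close> is packed to its extreme position, the condition on the
  other splits into \<open>k\<close> separate windows. These are disjoint, so their total length is
  at most \<open>n\<close> instead of \<open>k n\<close>. The obstacle is the amortization within a
  gap: the narrowest window may change after every insertion, so scanned characters can lie in
  several windows. An inserted character has passed the test that all characters scanned before it
  failed. Hence none of those equals the character now to the right of the gap, and passing the next
  occurrence of the latter skips them in every window. Only characters scanned since the last
  insertion (or since the gap was opened) can escape this argument. They lie in the current
  narrowest window, whose width is covered by the window that loses its whole gap.\<close>

definition wp :: "nat \<Rightarrow> com \<Rightarrow> (nat \<Rightarrow> state \<Rightarrow> bool) \<Rightarrow> state \<Rightarrow> bool" where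
  "wp w P Q s \<longleftrightarrow> (\<exists>t s'. exec w P s t s' \<and> Q t s')"

lemma wp_mono: "wp w P Q s \<Longrightarrow> (\<And>t s'. Q t s' \<Longrightarrow> Q' t s') \<Longrightarrow> wp w P Q' s"
  by (auto simp: wp_def)

lemma wp_Assign [simp]:
  "wp w (Assign x e) Q s \<longleftrightarrow> Q (acost e + 1) (s\<lparr>reg := (reg s)(x := aval w e s)\<rparr>)"
  unfolding wp_def by (blast intro: exec.Assign elim: exec.cases[of w "Assign x e"])

lemma wp_Store [simp]:
  "wp w (Store a e f) Q s \<longleftrightarrow> Q (acost e + acost f + 1)
     (s\<lparr>arr := (arr s)(a := (arr s a)(aval w e s := aval w f s))\<rparr>)"
  unfolding wp_def by (blast intro: exec.Store elim: exec.cases[of w "Store a e f"])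

lemma wp_Seq [simp]:
  "wp w (Seq P1 P2) Q s \<longleftrightarrow> wp w P1 (\<lambda>t1. wp w P2 (\<lambda>t2. Q (t1 + t2 + 1))) s"
  unfolding wp_def by (blast intro: exec.Seq elim: exec.cases[of w "Seq P1 P2"])

lemma wp_If [simp]:
  "wp w (If b P1 P2) Q s \<longleftrightarrow>
     (if bval w b s then wp w P1 (\<lambda>t. Q (bcost b + t + 1)) s
      else wp w P2 (\<lambda>t. Q (bcost b + t + 1)) s)"
proof (cases "bval w b s")
  case True
  then show ?thesis unfolding wp_def if_P[OF True]
    by (blast intro: exec.IfTrue elim: exec.cases[of w "If b P1 P2"])
next
  case False
  then show ?thesis unfolding wp_def if_not_P[OF False]
    by (blast intro: exec.IfFalse elim: exec.cases[of w "If b P1 P2"])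
qed

text \<open>\<open>\<phi>\<close> is an amortized time bound: an iteration costs at least one unit,
  so the descent of \<open>\<phi>\<close> gives termination and the running time at once. The extra
  \<open>bcost b + 1\<close> at the exit is the last, failing test of the guard.\<close>

lemma wp_While:
  fixes \<phi> :: "state \<Rightarrow> nat"
  assumes inv: "I s"
    and step: "\<And>s. I s \<Longrightarrow> bval w b s \<Longrightarrow>
      wp w P (\<lambda>t s'. I s' \<and> bcost b + 1 + t + \<phi> s' \<le> \<phi> s) s"
    and exit: "\<And>t s'. I s' \<Longrightarrow> \<not> bval w b s' \<Longrightarrow> t + \<phi> s' \<le> \<phi> s + bcost b + 1 \<Longrightarrow> Q t s'"
  shows "wp w (While b P) Q s"
proof -
  have "wp w (While b P) (\<lambda>t s'. I s' \<and> \<not> bval w b s' \<and> t + \<phi> s' \<le> \<phi> s + bcost b + 1) s"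
    using inv
  proof (induction "\<phi> s" arbitrary: s rule: less_induct)
    case less
    show ?case
    proof (cases "bval w b s")
      case False
      then have "exec w (While b P) s (bcost b + 1) s" by (rule WhileFalse)
      then show ?thesis unfolding wp_def using False less.prems by fastforce
    next
      case True
      from step[OF less.prems True] obtain t1 s1 where 1: "exec w P s t1 s1" "I s1"
        "bcost b + 1 + t1 + \<phi> s1 \<le> \<phi> s" unfolding wp_def by blast
      then have "\<phi> s1 < \<phi> s" by linarith
      from less.hyps[OF this 1(2)] obtain t2 s2 where 2: "exec w (While b P) s1 t2 s2" "I s2"
        "\<not> bval w b s2" "t2 + \<phi> s2 \<le> \<phi> s1 + bcost b + 1" unfolding wp_def by blast
      from WhileTrue[OF True 1(1) 2(1)] 1 2 show ?thesis unfolding wp_def by fastforce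
    qed
  qed
  then show ?thesis by (rule wp_mono) (use exit in blast)
qed

fun rmods :: "com \<Rightarrow> string set" where
  "rmods (Assign x e) = {x}"
| "rmods (Store a e f) = {}"
| "rmods (Seq P Q) = rmods P \<union> rmods Q"
| "rmods (If b P Q) = rmods P \<union> rmods Q"
| "rmods (While b P) = rmods P"

fun amods :: "com \<Rightarrow> string set" where
  "amods (Assign x e) = {}"
| "amods (Store a e f) = {a}"
| "amods (Seq P Q) = amods P \<union> amods Q"
| "amods (If b P Q) = amods P \<union> amods Q"
| "amods (While b P) = amods P"

definition frame :: "string set \<Rightarrow> string set \<Rightarrow> state \<Rightarrow> state \<Rightarrow> bool" where
  "frame X A s s' \<longleftrightarrow> (\<forall>x. x \<notin> X \<longrightarrow> reg s' x = reg s x) \<and> (\<forall>a. a \<notin> A \<longrightarrow> arr s' a = arr s a)"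

lemma exec_frame: "exec w P s t s' \<Longrightarrow> frame (rmods P) (amods P) s s'"
  by (induction rule: exec.induct) (auto simp: frame_def)

lemma frame_reg: "frame X A s s' \<Longrightarrow> x \<notin> X \<Longrightarrow> reg s' x = reg s x"
  and frame_arr: "frame X A s s' \<Longrightarrow> a \<notin> A \<Longrightarrow> arr s' a = arr s a"
  by (auto simp: frame_def)

lemmas frameD = frame_reg frame_arr

text \<open>Adds to a postcondition what the program text alone guarantees, so that specifications
  need not list everything that stays unchanged.\<close>

lemma wp_frame:
  assumes "wp w P Q s"
    and "\<And>t s'. Q t s' \<Longrightarrow> frame (rmods P) (amods P) s s' \<Longrightarrow> Q' t s'"
  shows "wp w P Q' s"
  using assms exec_frame unfolding wp_def by blast

text \<open>Bounds the number of iterations of a bisection; \<open>lg d = \<lfloor>log 2 d\<rfloor> + 1\<close> for \<open>d > 0\<close>.\<close>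

fun lg :: "nat \<Rightarrow> nat" where
  "lg d = (if d = 0 then 0 else Suc (lg (d div 2)))"

declare lg.simps [simp del]

lemma lg_0 [simp]: "lg 0 = 0"
  by (simp add: lg.simps)

lemma lg_mono: "a \<le> b \<Longrightarrow> lg a \<le> lg b"
proof (induction b arbitrary: a rule: lg.induct)
  case (1 b)
  show ?case
  proof (cases "a = 0")
    case False
    then have "lg (a div 2) \<le> lg (b div 2)" using 1 by (auto intro: div_le_mono)
    then show ?thesis using False 1 by (simp add: lg.simps[of a] lg.simps[of b])
  qed simp
qed

lemma lg_half: "0 < d \<Longrightarrow> e \<le> d div 2 \<Longrightarrow> lg e < lg d"
  using lg_mono[of e "d div 2"] by (simp add: lg.simps[of d])

lemma lg_log: "0 < d \<Longrightarrow> real (lg d) \<le> log 2 (real d) + 1"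
proof (induction d rule: lg.induct)
  case (1 d)
  show ?case
  proof (cases "d div 2 = 0")
    case True
    then show ?thesis using 1 by (simp add: lg.simps[of d])
  next
    case False
    then have "real (lg d) \<le> log 2 (real (d div 2)) + 2"
      using 1 by (simp add: lg.simps[of d])
    also have "\<dots> = log 2 (2 * real (d div 2)) + 1"
      using False by (simp add: log_mult)
    also have "\<dots> \<le> log 2 (real d) + 1"
    proof -
      have "2 * real (d div 2) = real (2 * (d div 2))" by simp
      also have "\<dots> \<le> real d" by (subst of_nat_le_iff) simp
      finally have "2 * real (d div 2) \<le> real d" .
      then show ?thesis using False by simp
    qed
    finally show ?thesis .
  qed
qed


section \<open>Embeddings into windows of a string\<close>

text \<open>\<open>emb S a b W\<close>: \<open>W\<close> is a subsequence of the factor of \<open>S\<close> on the positions from \<open>a\<close> to \<open>b - 1\<close>.\<close>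

primrec emb :: "'a list \<Rightarrow> nat \<Rightarrow> nat \<Rightarrow> 'a list \<Rightarrow> bool" where
  "emb S a b [] \<longleftrightarrow> a \<le> b \<and> b \<le> length S"
| "emb S a b (c # W) \<longleftrightarrow> (\<exists>p\<ge>a. p < b \<and> S ! p = c \<and> emb S (Suc p) b W)"

lemma emb_le: "emb S a b W \<Longrightarrow> a \<le> b \<and> b \<le> length S"
  by (induction W arbitrary: a) force+

lemma emb_antimono: "emb S a b W \<Longrightarrow> a' \<le> a \<Longrightarrow> emb S a' b W"
  by (cases W) (auto intro: order.trans)

lemma emb_mono: "emb S a b W \<Longrightarrow> b \<le> b' \<Longrightarrow> b' \<le> length S \<Longrightarrow> emb S a b' W"
  by (induction W arbitrary: a) force+

lemma emb_append: "emb S a b (V @ W) \<longleftrightarrow> (\<exists>m. emb S a m V \<and> emb S m b W)"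
proof (induction V arbitrary: a)
  case Nil
  show ?case using emb_le[of S a b W] by (auto intro: emb_antimono)
next
  case (Cons c V)
  show ?case
  proof
    assume "emb S a b ((c # V) @ W)"
    then obtain p m where "a \<le> p" "p < b" "S ! p = c" "emb S (Suc p) m V" "emb S m b W"
      using Cons by auto
    then show "\<exists>m. emb S a m (c # V) \<and> emb S m b W"
      using emb_le[of S "Suc p" m V] by (intro exI[of _ m]) auto
  next
    assume "\<exists>m. emb S a m (c # V) \<and> emb S m b W"
    then obtain m p where "a \<le> p" "p < m" "S ! p = c" "emb S (Suc p) m V" "emb S m b W"
      by auto
    moreover from this have "p < b" using emb_le by fastforce
    ultimately show "emb S a b ((c # V) @ W)" using Cons by auto
  qed
qed

lemma emb_subseq: "emb S a b W \<Longrightarrow> subseq V W \<Longrightarrow> emb S a b V"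
proof (induction W arbitrary: a V)
  case Nil
  then show ?case using list_emb_Nil2 by fastforce
next
  case (Cons c W)
  from Cons.prems(1) obtain p where p: "a \<le> p" "p < b" "S ! p = c" "emb S (Suc p) b W" by auto
  show ?case
  proof (cases "subseq V W")
    case True
    then show ?thesis using Cons.IH[OF p(4)] p(1) by (meson emb_antimono le_SucI)
  next
    case False
    with Cons.prems(2) obtain V' where "V = c # V'" "subseq V' W"
      by (cases V) (auto split: if_splits)
    then show ?thesis using Cons.IH[OF p(4)] p by auto
  qed
qed

lemma emb_length: "emb S a b W \<Longrightarrow> length W \<le> b - a"
  by (induction W arbitrary: a) force+

lemma emb_count: "emb S a b W \<Longrightarrow> count_list (take a S) c + count_list W c \<le> count_list (take b S) c"
proof (induction W arbitrary: a)
  case Nil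
  then have "take b S = take a S @ take (b - a) (drop a S)"
    by (simp flip: take_add)
  then show ?case by simp
next
  case (Cons x W)
  then obtain p where p: "a \<le> p" "p < b" "S ! p = x" "emb S (Suc p) b W" by auto
  have "p < length S" using p emb_le by fastforce
  then have "take (Suc p) S = take a S @ take (p - a) (drop a S) @ [x]"
    using p by (simp add: take_Suc_conv_app_nth flip: take_add)
  then have "count_list (take a S) c + (if x = c then 1 else 0) \<le> count_list (take (Suc p) S) c"
    by simp
  with Cons.IH[OF p(4)] show ?case by auto
qed

lemma emb_Suc_left: "emb (x # S) (Suc a) (Suc b) W \<longleftrightarrow> emb S a b W"
proof (induction W arbitrary: a)
  case (Cons c W)
  show ?case
  proof
    assume "emb (x # S) (Suc a) (Suc b) (c # W)"
    then obtain p where "p \<ge> Suc a" "p < Suc b" "(x # S) ! p = c" "emb (x # S) (Suc p) (Suc b) W"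
      by auto
    moreover then obtain p' where "p = Suc p'" by (cases p) auto
    ultimately show "emb S a b (c # W)" using Cons by auto
  next
    assume "emb S a b (c # W)"
    then obtain p where "p \<ge> a" "p < b" "S ! p = c" "emb S (Suc p) b W"
      by auto
    then show "emb (x # S) (Suc a) (Suc b) (c # W)" using Cons by (auto intro!: exI[of _ "Suc p"])
  qed
qed simp

lemma subseq_iff_emb: "subseq W S \<longleftrightarrow> emb S 0 (length S) W"
proof (induction S arbitrary: W)
  case Nil
  show ?case by (cases W) auto
next
  case (Cons x S)
  show ?case
  proof (cases W)
    case (Cons c V)
    have "emb (x # S) 0 (Suc (length S)) (c # V) \<longleftrightarrow>
       x = c \<and> emb (x # S) 1 (Suc (length S)) V \<or> emb (x # S) 1 (Suc (length S)) (c # V)"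
      (is "?L \<longleftrightarrow> ?R")
    proof
      assume ?L
      then obtain p where p: "p < Suc (length S)" "(x # S) ! p = c" "emb (x # S) (Suc p) (Suc (length S)) V"
        by auto
      then show ?R by (cases p) auto
    next
      assume ?R
      then show ?L by (auto intro: exI[of _ 0])
    qed
    moreover have "emb S 0 (length S) (c # V) \<Longrightarrow> x = c \<Longrightarrow> emb S 0 (length S) V"
      by (auto intro: emb_antimono)
    ultimately show ?thesis
      using Cons.IH[of V] Cons.IH[of W] Cons by (auto simp: emb_Suc_left simp del: emb.simps)
  qed simp
qed

text \<open>Makes maximality a local matter: it is enough to close every gap of the string against
  single characters.\<close>

lemma insertion_of_strict_subseq:
  assumes "strict_subseq V W"
  shows "\<exists>V1 V2 c. V = V1 @ V2 \<and> subseq (V1 @ c # V2) W"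
  using assms
proof (induction W arbitrary: V)
  case Nil
  then show ?case by (auto simp: strict_subseq_def)
next
  case (Cons x W)
  show ?case
  proof (cases V)
    case Nil
    then show ?thesis by (intro exI[of _ "[]"]) (auto intro!: exI[of _ x])
  next
    case (Cons y V')
    consider "y = x" "strict_subseq V' W" | "subseq V W"
      using Cons.prems \<open>V = y # V'\<close> by (auto simp: strict_subseq_def split: if_splits)
    then show ?thesis
    proof cases
      case 1
      from Cons.IH[OF 1(2)] obtain V1 V2 c where "V' = V1 @ V2" "subseq (V1 @ c # V2) W" by blast
      then show ?thesis using 1 \<open>V = y # V'\<close>
        by (intro exI[of _ "x # V1"] exI[of _ V2] exI[of _ c]) auto
    next
      case 2
      then show ?thesis by (intro exI[of _ "[]"] exI[of _ V] exI[of _ x]) auto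
    qed
  qed
qed

section \<open>Greedy embeddings and closed gaps\<close>

text \<open>A threshold instead of an embedding: \<open>h\<close> is the largest start from which
  \<open>W\<close> still fits before \<open>b\<close>. It is therefore unique, and it exists only if
  \<open>W\<close> fits at all.\<close>

definition rightmost :: "'a list \<Rightarrow> nat \<Rightarrow> 'a list \<Rightarrow> nat \<Rightarrow> bool" where
  "rightmost S b W h \<longleftrightarrow> (\<forall>a. emb S a b W \<longleftrightarrow> a \<le> h)"

definition leftmost :: "'a list \<Rightarrow> nat \<Rightarrow> 'a list \<Rightarrow> nat \<Rightarrow> bool" where
  "leftmost S a W l \<longleftrightarrow> (\<forall>b. emb S a b W \<longleftrightarrow> l \<le> b \<and> b \<le> length S)"

lemma rightmost_Nil: "b \<le> length S \<Longrightarrow> rightmost S b [] b"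
  by (simp add: rightmost_def)

lemma rightmost_le: "rightmost S b W h \<Longrightarrow> h \<le> b \<and> b \<le> length S"
  unfolding rightmost_def using emb_le by blast

lemma rightmost_length: "rightmost S b W h \<Longrightarrow> length W \<le> b - h"
  unfolding rightmost_def using emb_length by blast

text \<open>The basis of the test made by the program: only an occurrence of \<open>c\<close>
  between \<open>a\<close> and \<open>h\<close> matters, so looking at the last occurrence before
  \<open>h\<close> decides.\<close>

lemma emb_Cons_rightmost:
  assumes "rightmost S b W h"
  shows "emb S a b (c # W) \<longleftrightarrow> (\<exists>p\<ge>a. p < h \<and> S ! p = c)"
proof -
  have "emb S a b (c # W) \<longleftrightarrow> (\<exists>p\<ge>a. p < b \<and> S ! p = c \<and> Suc p \<le> h)"
    using assms by (simp add: rightmost_def)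
  then show ?thesis using rightmost_le[OF assms] by (metis Suc_le_eq less_le_trans)
qed

lemma rightmost_Cons:
  assumes "rightmost S b W h" "p < h" "S ! p = c" "\<And>q. p < q \<Longrightarrow> q < h \<Longrightarrow> S ! q \<noteq> c"
  shows "rightmost S b (c # W) p"
  unfolding rightmost_def emb_Cons_rightmost[OF assms(1)]
proof
  fix a
  show "(\<exists>q\<ge>a. q < h \<and> S ! q = c) \<longleftrightarrow> a \<le> p"
  proof
    assume "\<exists>q\<ge>a. q < h \<and> S ! q = c"
    then obtain q where "a \<le> q" "q < h" "S ! q = c" by blast
    then show "a \<le> p" using assms(4)[of q] by force
  qed (use assms(2,3) in blast)
qed

lemma leftmost_Nil: "leftmost S a [] a"
  by (simp add: leftmost_def)

lemma leftmost_snoc: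
  assumes "leftmost S a W l" "l \<le> p" "p < length S" "S ! p = c"
    and "\<And>q. l \<le> q \<Longrightarrow> q < p \<Longrightarrow> S ! q \<noteq> c"
  shows "leftmost S a (W @ [c]) (Suc p)"
  unfolding leftmost_def
proof
  fix b
  have "emb S a b (W @ [c]) \<longleftrightarrow> (\<exists>q\<ge>l. q < b \<and> b \<le> length S \<and> S ! q = c)"
  proof
    assume "emb S a b (W @ [c])"
    then obtain m q where *: "emb S a m W" "m \<le> q" "q < b" "b \<le> length S" "S ! q = c"
      by (auto simp: emb_append)
    then have "l \<le> m" using assms(1) unfolding leftmost_def by blast
    then show "\<exists>q\<ge>l. q < b \<and> b \<le> length S \<and> S ! q = c"
      using * le_trans by blast
  next
    assume "\<exists>q\<ge>l. q < b \<and> b \<le> length S \<and> S ! q = c"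
    then obtain q where q: "l \<le> q" "q < b" "b \<le> length S" "S ! q = c" by blast
    then have "emb S a q W" using assms(1) by (simp add: leftmost_def)
    moreover have "emb S q b [c]" using q by auto
    ultimately show "emb S a b (W @ [c])" unfolding emb_append by blast
  qed
  also have "\<dots> \<longleftrightarrow> Suc p \<le> b \<and> b \<le> length S"
  proof
    assume "\<exists>q\<ge>l. q < b \<and> b \<le> length S \<and> S ! q = c"
    then obtain q where q: "l \<le> q" "q < b" "b \<le> length S" "S ! q = c" by blast
    then show "Suc p \<le> b \<and> b \<le> length S" using assms(5)[of q] by force
  qed (use assms(2,4) in auto)
  finally show "emb S a b (W @ [c]) \<longleftrightarrow> Suc p \<le> b \<and> b \<le> length S" .
qed

lemma emb_append_leftmost:
  assumes "leftmost S a V l"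
  shows "emb S a b (V @ W) \<longleftrightarrow> emb S l b W"
proof
  assume "emb S a b (V @ W)"
  then show "emb S l b W"
    using assms unfolding emb_append leftmost_def by (auto intro: emb_antimono)
next
  assume "emb S l b W"
  moreover from emb_le[OF this] have "emb S a l V" using assms by (simp add: leftmost_def)
  ultimately show "emb S a b (V @ W)" unfolding emb_append by blast
qed

lemma emb_append_rightmost:
  assumes "rightmost S b W h"
  shows "emb S a b (V @ W) \<longleftrightarrow> emb S a h V"
proof
  assume "emb S a b (V @ W)"
  then show "emb S a h V"
    using assms rightmost_le[OF assms] unfolding emb_append rightmost_def by (auto intro: emb_mono)
next
  assume "emb S a h V"
  then show "emb S a b (V @ W)" using assms unfolding emb_append rightmost_def by blast
qed

definition no_insertion ::
    "'a list \<Rightarrow> nat \<Rightarrow> (nat \<Rightarrow> nat) \<Rightarrow> (nat \<Rightarrow> nat) \<Rightarrow> 'a list \<Rightarrow> 'a list \<Rightarrow> bool" where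
  "no_insertion S k lo hi V W \<longleftrightarrow> (\<forall>c. \<exists>i<k. \<not> emb S (lo i) (hi i) (V @ c # W))"

lemma no_insertion_mono:
  assumes "no_insertion S k lo hi V W" "subseq W W'"
  shows "no_insertion S k lo hi V W'"
  unfolding no_insertion_def
proof
  fix c
  have "subseq (V @ c # W) (V @ c # W')" by (intro list_emb_append_mono) (use assms(2) in auto)
  with assms(1) show "\<exists>i<k. \<not> emb S (lo i) (hi i) (V @ c # W')"
    unfolding no_insertion_def by (metis emb_subseq)
qed

lemma no_insertion_maximal:
  assumes "\<And>V1 V2. V = V1 @ V2 \<Longrightarrow> no_insertion S k lo hi V1 V2"
    and "subseq V W" "\<forall>i<k. emb S (lo i) (hi i) W"
  shows "W = V"
proof (rule ccontr)
  assume "W \<noteq> V"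
  then have "strict_subseq V W" using assms(2) by (auto simp: strict_subseq_def)
  then obtain V1 V2 c where "V = V1 @ V2" "subseq (V1 @ c # V2) W"
    using insertion_of_strict_subseq by blast
  moreover obtain i where "i < k" "\<not> emb S (lo i) (hi i) (V1 @ c # V2)"
    using assms(1)[OF calculation(1)] unfolding no_insertion_def by blast
  ultimately show False using assms(3) emb_subseq by blast
qed


section \<open>Pinning one occurrence of the marked character in every copy\<close>

definition fits :: "'a list \<Rightarrow> nat \<Rightarrow> (nat \<Rightarrow> nat) \<Rightarrow> 'a list \<Rightarrow> 'a list \<Rightarrow> bool" where
  "fits S k p U V \<longleftrightarrow> emb S 0 (p 0) U \<and>
     (\<forall>i. Suc i < k \<longrightarrow> emb S (Suc (p i)) (p (Suc i)) (V @ U)) \<and>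
     emb S (Suc (p (k - 1))) (length S) V"

lemma fits_subseq:
  "fits S k p U V \<Longrightarrow> subseq U' U \<Longrightarrow> subseq V' V \<Longrightarrow> fits S k p U' V'"
  unfolding fits_def by (meson emb_subseq list_emb_append_mono)

text \<open>The induction peels off the first copy. The remaining copies start where its
  \<open>V\<close> ends, so \<open>a\<close> has to be general; \<open>case_nat p p'\<close> puts
  the pin of the first copy in front of the others.\<close>

lemma emb_power_iff:
  "emb S a (length S) (concat (replicate (Suc k) (U @ x # V))) \<longleftrightarrow>
   (\<exists>p. emb S a (p 0) U \<and> (\<forall>i\<le>k. p i < length S \<and> S ! p i = x) \<and>
      (\<forall>i<k. emb S (Suc (p i)) (p (Suc i)) (V @ U)) \<and> emb S (Suc (p k)) (length S) V)"
proof (induction k arbitrary: a)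
  case 0
  show ?case
  proof
    assume "emb S a (length S) (concat (replicate (Suc 0) (U @ x # V)))"
    then obtain m p where "emb S a m U" "p \<ge> m" "p < length S" "S ! p = x"
      "emb S (Suc p) (length S) V"
      by (auto simp: emb_append)
    moreover from this have "emb S a p U" by (auto intro: emb_mono)
    ultimately show "\<exists>p. emb S a (p 0) U \<and> (\<forall>i\<le>0. p i < length S \<and> S ! p i = x) \<and>
      (\<forall>i<0. emb S (Suc (p i)) (p (Suc i)) (V @ U)) \<and> emb S (Suc (p 0)) (length S) V"
      by (intro exI[of _ "\<lambda>_. p"]) auto
  qed (auto simp: emb_append)
next
  case (Suc k)
  let ?X = "concat (replicate (Suc k) (U @ x # V))"
  let ?Q = "\<lambda>a p. emb S a (p 0) U \<and> (\<forall>i\<le>k. p i < length S \<and> S ! p i = x) \<and>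
      (\<forall>i<k. emb S (Suc (p i)) (p (Suc i)) (V @ U)) \<and> emb S (Suc (p k)) (length S) V"
  have *: "concat (replicate (Suc (Suc k)) (U @ x # V)) = U @ x # V @ ?X" by simp
  show ?case unfolding *
  proof
    assume "emb S a (length S) (U @ x # V @ ?X)"
    then obtain m p m' where 1: "emb S a m U" "p \<ge> m" "p < length S" "S ! p = x"
      "emb S (Suc p) m' V" "emb S m' (length S) ?X"
      by (auto simp: emb_append simp del: replicate_Suc)
    then obtain p' where p': "?Q m' p'" using Suc.IH by blast
    let ?p = "case_nat p p'"
    have "emb S a p U" using 1 by (auto intro: emb_mono)
    moreover have "emb S m' (p' 0) U" using p' by blast
    then have "emb S (Suc p) (p' 0) (V @ U)" using 1(5) unfolding emb_append by blast
    ultimately show "\<exists>p. emb S a (p 0) U \<and> (\<forall>i\<le>Suc k. p i < length S \<and> S ! p i = x) \<and>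
      (\<forall>i<Suc k. emb S (Suc (p i)) (p (Suc i)) (V @ U)) \<and> emb S (Suc (p (Suc k))) (length S) V"
    proof (intro exI[of _ ?p] conjI allI impI)
      fix i assume "i < Suc k"
      then show "emb S (Suc (?p i)) (?p (Suc i)) (V @ U)"
        using \<open>emb S (Suc p) (p' 0) (V @ U)\<close> p' by (cases i) auto
    next
      fix i assume "i \<le> Suc k"
      then show "?p i < length S" "S ! ?p i = x" using 1 p' by (cases i; auto)+
    qed (use p' in auto)
  next
    assume "\<exists>p. emb S a (p 0) U \<and> (\<forall>i\<le>Suc k. p i < length S \<and> S ! p i = x) \<and>
      (\<forall>i<Suc k. emb S (Suc (p i)) (p (Suc i)) (V @ U)) \<and> emb S (Suc (p (Suc k))) (length S) V"
    then obtain p where p: "emb S a (p 0) U" "\<forall>i\<le>Suc k. p i < length S \<and> S ! p i = x"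
      "\<forall>i<Suc k. emb S (Suc (p i)) (p (Suc i)) (V @ U)" "emb S (Suc (p (Suc k))) (length S) V"
      by blast
    from p(3) have "emb S (Suc (p 0)) (p 1) (V @ U)" by force
    then obtain m where m: "emb S (Suc (p 0)) m V" "emb S m (p 1) U" by (auto simp: emb_append)
    have "?Q m (\<lambda>i. p (Suc i))" using p m(2) by auto
    then have "emb S m (length S) ?X" unfolding Suc.IH
      by (rule exI[where P = "?Q m" and x = "\<lambda>i. p (Suc i)"])
    then have "emb S (Suc (p 0)) (length S) (V @ ?X)" using m(1) unfolding emb_append by blast
    then have "emb S (p 0) (length S) (x # V @ ?X)" using p(2)
      by (auto simp del: replicate_Suc intro!: exI[of _ "p 0"])
    with p(1) show "emb S a (length S) (U @ x # V @ ?X)"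
      unfolding emb_append[of S a _ U] by blast
  qed
qed

lemma k_repeating_iff_fits:
  assumes "0 < k"
  shows "k_repeating k (U @ x # V) S \<longleftrightarrow>
    (\<exists>p. (\<forall>i<k. p i < length S \<and> S ! p i = x) \<and> fits S k p U V)"
proof -
  obtain k' where k: "k = Suc k'" using assms by (cases k) auto
  show ?thesis unfolding k_repeating_def subseq_iff_emb k emb_power_iff fits_def less_Suc_eq_le
    by auto
qed

lemma k_repeating_length: "k_repeating k X S \<Longrightarrow> k * length X \<le> length S"
  unfolding k_repeating_def using list_emb_length
  by (fastforce simp: length_concat sum_list_replicate)

lemma k_repeating_count:
  assumes "k_repeating k X S" shows "k * count_list X x \<le> count_list S x"
proof -
  have "count_list (concat (replicate k X)) x = k * count_list X x"
    by (induction k) auto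
  moreover have "count_list (take 0 S) x + count_list (concat (replicate k X)) x \<le>
      count_list (take (length S) S) x"
    using assms unfolding k_repeating_def subseq_iff_emb by (rule emb_count)
  ultimately show ?thesis by simp
qed

lemma count_take_Suc:
  "p < length S \<Longrightarrow> count_list (take (Suc p) S) x = count_list (take p S) x + (if S ! p = x then 1 else 0)"
  by (simp add: take_Suc_conv_app_nth)

lemma count_take_mono: "p \<le> q \<Longrightarrow> count_list (take p S) x \<le> count_list (take q S) x"
proof -
  assume "p \<le> q"
  then have "take q S = take p S @ take (q - p) (drop p S)" by (simp flip: take_add)
  then show ?thesis by simp
qed

lemma count_take_less_iff:
  assumes "p < length S" "S ! p = x"
  shows "count_list (take p S) x < count_list (take q S) x \<longleftrightarrow> p < q"
proof
  assume "p < q"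
  then show "count_list (take p S) x < count_list (take q S) x"
    using count_take_mono[of "Suc p" q S x] count_take_Suc[OF assms(1), of x] assms(2) by simp
next
  assume "count_list (take p S) x < count_list (take q S) x"
  then show "p < q" using count_take_mono[of q p S x] by (meson not_less)
qed

lemma ex_occurrence:
  "r < count_list (take h S) x \<Longrightarrow>
   \<exists>p. p < h \<and> p < length S \<and> S ! p = x \<and> count_list (take p S) x = r"
proof (induction h)
  case (Suc h)
  show ?case
  proof (cases "h < length S \<and> \<not> r < count_list (take h S) x")
    case True
    then have "S ! h = x \<and> count_list (take h S) x = r"
      using Suc.prems by (auto simp: count_take_Suc split: if_splits)
    then show ?thesis using True by blast
  next
    case False
    then have "r < count_list (take h S) x" using Suc.prems by auto
    then show ?thesis using Suc.IH by (meson less_SucI)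
  qed
qed simp

lemma count_list_mono: "subseq V W \<Longrightarrow> count_list V x \<le> count_list W x"
  by (induction rule: list_emb.induct) auto

definition nondecr :: "nat \<Rightarrow> nat \<Rightarrow> (nat \<Rightarrow> nat) \<Rightarrow> bool" where
  "nondecr k R r \<longleftrightarrow> (\<forall>i j. i \<le> j \<longrightarrow> j < k \<longrightarrow> r i \<le> r j) \<and> (\<forall>i<k. r i \<le> R)"

text \<open>A pin is addressed by its rank among the occurrences of \<open>x\<close>. Of this rank
  \<open>i * m\<close> is forced by the copies to the left; only the surplus \<open>r i\<close> is
  enumerated.\<close>

definition pins :: "'a list \<Rightarrow> 'a \<Rightarrow> nat \<Rightarrow> nat \<Rightarrow> (nat \<Rightarrow> nat) \<Rightarrow> (nat \<Rightarrow> nat) \<Rightarrow> bool" where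
  "pins S x m k r p \<longleftrightarrow> (\<forall>i<k. p i < length S \<and> S ! p i = x \<and>
     count_list (take (p i) S) x = i * m + r i)"

lemma pins_unique:
  assumes "pins S x m k r p" "pins S x m k r p'" "i < k"
  shows "p' i = p i"
proof -
  have "p i < length S" "S ! p i = x" "p' i < length S" "S ! p' i = x"
    "count_list (take (p i) S) x = count_list (take (p' i) S) x"
    using assms unfolding pins_def by auto
  then show ?thesis
    by (metis count_take_less_iff less_irrefl linorder_neqE_nat)
qed

lemma fits_cong:
  assumes "\<And>i. i < k \<Longrightarrow> p i = p' i" "0 < k"
  shows "fits S k p U V \<longleftrightarrow> fits S k p' U V"
  unfolding fits_def using assms by (metis Suc_lessD diff_less less_one)

lemma nondecr_step:
  assumes "\<And>i. Suc i < k \<Longrightarrow> r i \<le> r (Suc i)" "0 < k" "r (k - 1) \<le> R"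
  shows "nondecr k R r"
proof -
  have *: "i \<le> j \<Longrightarrow> j < k \<Longrightarrow> r i \<le> r j" for i j
    by (induction j rule: dec_induct) (auto dest: assms(1) Suc_lessD intro: order.trans)
  show ?thesis unfolding nondecr_def
    using * assms(2,3) by (metis Suc_pred' less_Suc_eq_le order.trans lessI)
qed

text \<open>
  Between consecutive pins lie at least \<open>m - 1\<close> further occurrences of the marked character,
  so the surplus \<open>r\<close> in the ranks of the pins is nondecreasing.
\<close>

lemma ex_pins:
  assumes "0 < k" "k_repeating k (U @ x # V) S" "m \<le> Suc (count_list V x)" "0 < m"
  shows "\<exists>r p. nondecr k (count_list S x - k * m) r \<and> pins S x m k r p \<and> fits S k p U V"
proof -
  obtain p where p: "\<And>i. i < k \<Longrightarrow> p i < length S \<and> S ! p i = x" and fits: "fits S k p U V"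
    using assms(2) unfolding k_repeating_iff_fits[OF assms(1)] by metis
  define a where "a i = count_list (take (p i) S) x" for i
  have Suc_p: "count_list (take (Suc (p i)) S) x = Suc (a i)" if "i < k" for i
    using p[OF that] by (simp add: count_take_Suc a_def)
  have step: "a i + m \<le> a (Suc i)" if "Suc i < k" for i
  proof -
    have "emb S (Suc (p i)) (p (Suc i)) (V @ U)" using fits that by (simp add: fits_def)
    from emb_count[OF this, of x] Suc_p[of i] that assms(3) show ?thesis by (simp add: a_def)
  qed
  have last: "a (k - 1) + m \<le> count_list S x"
  proof -
    have "emb S (Suc (p (k - 1))) (length S) V" using fits by (simp add: fits_def)
    from emb_count[OF this, of x] Suc_p[of "k - 1"] assms(1,3) show ?thesis by simp
  qed
  have ge: "i < k \<Longrightarrow> i * m \<le> a i" for i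
  proof (induction i)
    case (Suc i)
    then show ?case using step[of i] by simp
  qed simp
  define r where "r i = a i - i * m" for i
  have "r i \<le> r (Suc i)" if "Suc i < k" for i
    using step[OF that] ge[of i] that by (simp add: r_def)
  moreover have "r (k - 1) \<le> count_list S x - k * m"
    using last assms(1) by (cases k) (auto simp: r_def)
  ultimately have "nondecr k (count_list S x - k * m) r"
    using assms(1) by (intro nondecr_step)
  moreover have "pins S x m k r p" unfolding pins_def using p ge by (auto simp: r_def a_def)
  ultimately show ?thesis using fits by blast
qed

text \<open>The largest rank that can be asked for is
  \<open>(k - 1) * m + R = count_list S x - m\<close>, which is an actual rank because
  \<open>m\<close> is positive.\<close>

lemma pins_ex:
  assumes "nondecr k (count_list S x - k * m) r" "k * m \<le> count_list S x" "0 < m"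
  shows "\<exists>p. pins S x m k r p"
proof -
  have "\<exists>q. q < length S \<and> S ! q = x \<and> count_list (take q S) x = i * m + r i" if "i < k" for i
  proof -
    have "r i \<le> count_list S x - k * m" using assms(1) that by (simp add: nondecr_def)
    moreover have "i * m + m \<le> k * m" using mult_le_mono1[of "Suc i" k m] that by simp
    ultimately have "i * m + r i < count_list (take (length S) S) x" using assms by simp
    from ex_occurrence[OF this] show ?thesis by blast
  qed
  then show ?thesis unfolding pins_def by metis
qed


section \<open>Nondecreasing sequences in lexicographic order\<close>

definition nondecr_lists :: "nat \<Rightarrow> nat \<Rightarrow> nat list set" where
  "nondecr_lists k R = {l. length l = k \<and> sorted l \<and> set l \<subseteq> {..R}}"

lemma nondecr_lists_iff: "l \<in> nondecr_lists k R \<longleftrightarrow> length l = k \<and> nondecr k R ((!) l)"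
  unfolding nondecr_lists_def nondecr_def
  by (auto simp: sorted_iff_nth_mono in_set_conv_nth subset_iff)

text \<open>Pascal's rule: either the last entry of the sorted list is \<open>R\<close>, or all its
  entries are at most \<open>R - 1\<close>.\<close>

lemma card_nondecr_lists: "finite (nondecr_lists k R) \<and> card (nondecr_lists k R) = (R + k) choose k"
proof (induction "R + k" arbitrary: R k rule: less_induct)
  case less
  consider "k = 0" | k' where "k = Suc k'" "R = 0" | k' R' where "k = Suc k'" "R = Suc R'"
    by (cases k; cases R) auto
  then show ?case
  proof cases
    case 1
    then have "nondecr_lists k R = {[]}" by (auto simp: nondecr_lists_def)
    then show ?thesis using 1 by simp
  next
    case 2
    then have "nondecr_lists k R = {replicate k 0}"
      by (auto simp: nondecr_lists_def subset_iff simp del: replicate_Suc intro: replicate_eqI)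
    then show ?thesis using 2 by simp
  next
    case 3
    let ?A = "(\<lambda>l. l @ [R]) ` nondecr_lists k' R" and ?B = "nondecr_lists k R'"
    have split: "nondecr_lists k R = ?A \<union> ?B"
    proof
      show "nondecr_lists k R \<subseteq> ?A \<union> ?B"
      proof
        fix l assume l: "l \<in> nondecr_lists k R"
        then obtain l' y where "l = l' @ [y]" using 3 by (cases l rule: rev_cases) (auto simp: nondecr_lists_def)
        then show "l \<in> ?A \<union> ?B" using l 3
          by (cases "y = R") (fastforce simp: nondecr_lists_def sorted_append le_Suc_eq)+
      qed
      show "?A \<union> ?B \<subseteq> nondecr_lists k R"
        using 3 by (fastforce simp: nondecr_lists_def sorted_append)
    qed
    have disj: "?A \<inter> ?B = {}" using 3 by (auto simp: nondecr_lists_def)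
    have fin: "finite (nondecr_lists k' R)" "finite ?B" and
      card: "card (nondecr_lists k' R) = (R + k') choose k'" "card ?B = (R' + k) choose k"
      using less.hyps[of R k'] less.hyps[of R' k] 3 by auto
    have "card ?A = (R + k') choose k'" using card by (simp add: card_image inj_on_def)
    then have "card (nondecr_lists k R) = ((R + k') choose k') + ((R' + k) choose k)"
      unfolding split using card fin disj by (simp add: card_Un_disjoint)
    then show ?thesis unfolding split using fin 3 by simp
  qed
qed

definition lex_less :: "nat \<Rightarrow> (nat \<Rightarrow> nat) \<Rightarrow> (nat \<Rightarrow> nat) \<Rightarrow> bool" where
  "lex_less k f g \<longleftrightarrow> (\<exists>j<k. (\<forall>i<j. f i = g i) \<and> f j < g j)"

lemma lex_less_trans: "lex_less k f g \<Longrightarrow> lex_less k g h \<Longrightarrow> lex_less k f h"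
  unfolding lex_less_def
proof clarify
  fix i j assume "i < k" "\<forall>l<i. f l = g l" "f i < g i" "j < k" "\<forall>l<j. g l = h l" "g j < h j"
  then show "\<exists>j<k. (\<forall>i<j. f i = h i) \<and> f j < h j"
    by (intro exI[of _ "min i j"]) (cases i j rule: linorder_cases; auto simp: min_def)
qed

lemma lex_less_linear: "lex_less k f g \<or> (\<forall>i<k. f i = g i) \<or> lex_less k g f"
proof (cases "\<forall>i<k. f i = g i")
  case False
  define i where "i = (LEAST i. i < k \<and> f i \<noteq> g i)"
  have i: "i < k" "f i \<noteq> g i" using LeastI_ex[of "\<lambda>i. i < k \<and> f i \<noteq> g i"] False
    by (auto simp: i_def)
  have "f l = g l" if "l < i" for l
    using not_less_Least[OF that[unfolded i_def]] that i(1) by auto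
  then show ?thesis using i unfolding lex_less_def by (metis linorder_neqE_nat)
qed simp

text \<open>The number of choices from \<open>r\<close> on, including \<open>r\<close> itself, that
  is, the number of rounds left to the main loop.\<close>

definition lex_rest :: "nat \<Rightarrow> nat \<Rightarrow> (nat \<Rightarrow> nat) \<Rightarrow> nat" where
  "lex_rest k R r = card {l \<in> nondecr_lists k R. \<not> lex_less k ((!) l) r}"

lemma lex_rest_le: "lex_rest k R r \<le> (R + k) choose k"
proof -
  have "lex_rest k R r \<le> card (nondecr_lists k R)"
    unfolding lex_rest_def using card_nondecr_lists by (intro card_mono) auto
  then show ?thesis using card_nondecr_lists by simp
qed

lemma nondecr_map: "nondecr k R r \<Longrightarrow> map r [0..<k] \<in> nondecr_lists k R"
  unfolding nondecr_lists_iff by (auto simp: nondecr_def)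

lemma lex_rest_pos:
  assumes "nondecr k R r" shows "0 < lex_rest k R r"
proof -
  have "\<not> lex_less k ((!) (map r [0..<k])) r" by (auto simp: lex_less_def)
  then have "map r [0..<k] \<in> {l \<in> nondecr_lists k R. \<not> lex_less k ((!) l) r}"
    using nondecr_map[OF assms] by simp
  then show ?thesis unfolding lex_rest_def using card_nondecr_lists by (auto simp: card_gt_0_iff)
qed

lemma lex_rest_less:
  assumes "nondecr k R r" "lex_less k r r'"
  shows "lex_rest k R r' < lex_rest k R r"
  unfolding lex_rest_def
proof (rule psubset_card_mono)
  show "finite {l \<in> nondecr_lists k R. \<not> lex_less k ((!) l) r}" using card_nondecr_lists by simp
  let ?l = "map r [0..<k]"
  have "lex_less k ((!) ?l) r'" "\<not> lex_less k ((!) ?l) r"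
    using assms(2) by (auto simp: lex_less_def)
  then show "{l \<in> nondecr_lists k R. \<not> lex_less k ((!) l) r'}
      \<subset> {l \<in> nondecr_lists k R. \<not> lex_less k ((!) l) r}"
    using nondecr_map[OF assms(1)] lex_less_trans[OF _ assms(2)] by blast
qed

text \<open>\<open>p\<close> is the last place where \<open>r\<close> can grow. The last claim says
  that the enumeration skips nothing: a sequence above \<open>r\<close> and below \<open>r'\<close>
  would agree with \<open>r\<close> before \<open>p\<close>, have the value \<open>Suc (r p)\<close>
  at \<open>p\<close>, and fall below that value later, which contradicts monotonicity.\<close>

lemma nondecr_next:
  assumes r: "nondecr k R r" and p: "p < k" "r p < R" "\<And>i. p < i \<Longrightarrow> i < k \<Longrightarrow> r i = R"
    and r': "\<And>i. i < k \<Longrightarrow> r' i = (if i < p then r i else Suc (r p))"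
  shows "nondecr k R r'" "lex_less k r r'"
    "\<And>f. nondecr k R f \<Longrightarrow> lex_less k f r' \<Longrightarrow> lex_less k f r \<or> (\<forall>i<k. f i = r i)"
proof -
  show "nondecr k R r'" using r p r' unfolding nondecr_def
    by (auto intro!: le_SucI)
  show "lex_less k r r'" using p r' by (auto simp: lex_less_def)
  fix f assume f: "nondecr k R f" "lex_less k f r'"
  then obtain j where j: "j < k" "\<And>l. l < j \<Longrightarrow> f l = r' l" "f j < r' j" by (auto simp: lex_less_def)
  have "\<not> lex_less k r f"
  proof
    assume "lex_less k r f"
    then obtain i where i: "i < k" "\<And>l. l < i \<Longrightarrow> r l = f l" "r i < f i" by (auto simp: lex_less_def)
    have "f i \<le> R" using f(1) i(1) by (simp add: nondecr_def)
    then have ip: "i \<le> p" using p(3)[of i] i(1,3) by force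
    have "i < j" using j(3) i(2)[of j] i(3) ip r'[OF j(1)] by (cases i j rule: linorder_cases) (auto split: if_splits)
    then have "f i = r' i" using j(2) by simp
    then have "i = p" using i(1,3) ip r'[of i] by (auto split: if_splits)
    then have "f j < f i" using j(1,3) r'[of j] r'[of i] \<open>f i = r' i\<close> \<open>i < j\<close> i(1) by simp
    moreover have "f i \<le> f j" using f(1) \<open>i < j\<close> j(1) by (simp add: nondecr_def)
    ultimately show False by simp
  qed
  then show "lex_less k f r \<or> (\<forall>i<k. f i = r i)" using lex_less_linear by blast
qed

lemma nondecr_last:
  assumes "\<And>i. i < k \<Longrightarrow> r i = R" "nondecr k R f"
  shows "lex_less k f r \<or> (\<forall>i<k. f i = r i)"
proof -
  have "\<not> lex_less k r f" using assms by (auto simp: lex_less_def nondecr_def not_less)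
  then show ?thesis using lex_less_linear by blast
qed


section \<open>The program\<close>

notation Assign (infix "::=" 62) and Seq (infixr ";;" 60)

text \<open>
  The positions of a character \<open>c\<close> are stored in increasing order from cell \<open>f[c] * n\<close> of \<open>occ\<close> on,
  where \<open>f[c]\<close> is the first of them. The program stores in \<open>p\<close> the last position of \<open>c\<close> before \<open>h\<close>;
  if there is none, the truncated subtraction makes it the first position of \<open>c\<close> instead.
\<close>

definition bsearch :: com where
  "bsearch =
    ''a'' ::= Const 0;;
    ''b'' ::= Read ''cnt'' (Reg ''c'');;
    While (Less (Reg ''a'') (Reg ''b'')) (
      ''m'' ::= Div (Add (Reg ''a'') (Reg ''b'')) (Const 2);;
      If (Less (Read ''occ'' (Add (Mul (Read ''f'' (Reg ''c'')) (Reg ''len_S'')) (Reg ''m''))) (Reg ''h''))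
        (''a'' ::= Add (Reg ''m'') (Const 1))
        (''b'' ::= Reg ''m''));;
    ''p'' ::= Read ''occ'' (Add (Mul (Read ''f'' (Reg ''c'')) (Reg ''len_S'')) (Sub (Reg ''a'') (Const 1)))"

text \<open>Row \<open>d + 1\<close> of \<open>HI\<close> is filled before the outcome is known, and
  \<open>c\<close> is stored in \<open>St\<close> in any case. Both places lie above the top of the
  stack and count only if \<open>ok\<close> raises \<open>d\<close>.\<close>

definition try_push :: com where
  "try_push =
    ''ok'' ::= Const 1;;
    ''i'' ::= Const 0;;
    While (Less (Reg ''i'') (Reg ''k'')) (
      ''h'' ::= Read ''HI'' (Add (Mul (Reg ''d'') (Reg ''k'')) (Reg ''i''));;
      bsearch;;
      If (And (Less (Reg ''p'') (Reg ''h'')) (Not (Less (Reg ''p'') (Read ''Lo'' (Reg ''i'')))))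
        (Store ''HI'' (Add (Add (Mul (Reg ''d'') (Reg ''k'')) (Reg ''k'')) (Reg ''i'')) (Reg ''p''))
        (''ok'' ::= Const 0);;
      ''i'' ::= Add (Reg ''i'') (Const 1));;
    Store ''St'' (Reg ''d'') (Reg ''c'');;
    ''d'' ::= Add (Reg ''d'') (Reg ''ok'')"

lemma bsearch_mods [simp]: "rmods bsearch = {''a'', ''b'', ''m'', ''p''}" "amods bsearch = {}"
  by (auto simp: bsearch_def)

lemma try_push_mods [simp]:
  "rmods try_push = {''ok'', ''i'', ''h'', ''a'', ''b'', ''m'', ''p'', ''d''}"
  "amods try_push = {''HI'', ''St''}"
  by (auto simp: try_push_def)

section \<open>Word size, the table of occurrences, and the test of one character\<close>

locale machine =
  fixes S :: "nat list" and k w :: nat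
  assumes k_pos: "0 < k"
    and k_le: "k \<le> length S"
    and w: "(length S + 2) ^ 4 \<le> 2 ^ w"
begin

abbreviation "n \<equiv> length S"
abbreviation "lgn \<equiv> Suc (lg n)"

text \<open>The largest computed indices, those into \<open>occ\<close> and \<open>HI\<close>, are
  quadratic in \<open>n\<close>. The fourth power in the word size leaves room for the constants,
  since \<open>(n + 2) * (n + 2)\<close> is at least 9.\<close>

lemma word: "n * n + 5 * n + 9 < 2 ^ w"
proof -
  define x where "x = (n + 2) * (n + 2)"
  have "9 \<le> x" using k_pos k_le mult_le_mono[of 3 "n + 2" 3 "n + 2"] by (simp add: x_def)
  then have "9 * x \<le> x * x" by simp
  also have "y * y * (y * y) = y ^ 4" for y :: nat by (simp add: power4_eq_xxxx mult.assoc)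
  then have "x * x = (n + 2) ^ 4" by (simp only: x_def)
  finally have "9 * x \<le> 2 ^ w" using w by simp
  then show ?thesis by (simp add: x_def algebra_simps)
qed

lemma word_lin: "n + 9 < 2 ^ w"
  using word by linarith

lemma w_pos [simp]: "0 < w"
  using word_lin by (cases w) auto

lemma two_mod [simp]: "2 mod 2 ^ w = (2::nat)"
  using word_lin by simp

lemma row_word: "d \<le> n \<Longrightarrow> i \<le> 3 * n \<Longrightarrow> d * k + i < 2 ^ w"
  using mult_le_mono[of d n k n] k_le word by linarith

text \<open>The rows of \<open>occ\<close> are numbered by positions \<open>f[c] < n\<close> and not
  by the characters themselves: a character may be almost \<open>2 ^ w\<close>, and multiplying it
  by \<open>n\<close> would overflow.\<close>

definition base :: "state \<Rightarrow> bool" where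
  "base s \<longleftrightarrow> reg s ''len_S'' = n \<and> reg s ''k'' = k \<and> arr s ''S'' = cells S \<and>
     (\<forall>c. arr s ''cnt'' c = count_list S c) \<and>
     (\<forall>c\<in>set S. arr s ''f'' c < n) \<and>
     (\<forall>q<n. arr s ''occ'' (arr s ''f'' (S ! q) * n + count_list (take q S) (S ! q)) = q)"

lemma base_cong:
  assumes "reg s' ''len_S'' = reg s ''len_S''" "reg s' ''k'' = reg s ''k''"
    "arr s' ''S'' = arr s ''S''" "arr s' ''cnt'' = arr s ''cnt''"
    "arr s' ''f'' = arr s ''f''" "arr s' ''occ'' = arr s ''occ''"
  shows "base s' \<longleftrightarrow> base s"
  using assms by (simp add: base_def)

lemma base_reg [simp]:
  "x \<noteq> ''len_S'' \<Longrightarrow> x \<noteq> ''k'' \<Longrightarrow> base (s\<lparr>reg := g(x := v)\<rparr>) \<longleftrightarrow> base (s\<lparr>reg := g\<rparr>)"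
  "base (s\<lparr>reg := reg s\<rparr>) \<longleftrightarrow> base s"
  by (simp_all add: base_def)

lemma base_arr [simp]:
  "a \<notin> {''S'', ''cnt'', ''f'', ''occ''} \<Longrightarrow> base (s\<lparr>arr := g(a := v)\<rparr>) \<longleftrightarrow> base (s\<lparr>arr := g\<rparr>)"
  "base (s\<lparr>arr := arr s\<rparr>) \<longleftrightarrow> base s"
  by (rule base_cong; auto)+

lemma base_frame:
  assumes "base s" "frame X A s s'" "''len_S'' \<notin> X" "''k'' \<notin> X" "{''S'', ''cnt'', ''f'', ''occ''} \<inter> A = {}"
  shows "base s'"
  using assms frameD[OF assms(2)] by (simp add: base_def)

lemma baseD:
  assumes "base s"
  shows "reg s ''len_S'' = n" "reg s ''k'' = k" "arr s ''cnt'' c = count_list S c"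
    "q < n \<Longrightarrow> arr s ''S'' q = S ! q"
  using assms by (auto simp: base_def cells_def)

lemma occ_read:
  assumes "base s" "r < count_list S c"
  obtains q where "arr s ''occ'' (arr s ''f'' c * n + r) = q" "q < n" "S ! q = c"
    "count_list (take q S) c = r"
proof -
  have "r < count_list (take n S) c" using assms(2) by simp
  from ex_occurrence[OF this]
  obtain q where q: "q < n" "S ! q = c" "count_list (take q S) c = r" by blast
  moreover have "arr s ''occ'' (arr s ''f'' (S ! q) * n + count_list (take q S) (S ! q)) = q"
    using assms(1) q(1) by (simp add: base_def)
  ultimately show ?thesis using that by simp
qed

lemma occ_index:
  assumes "base s" "c \<in> set S" "r \<le> n"
  shows "(arr s ''f'' c * n mod 2 ^ w + r) mod 2 ^ w = arr s ''f'' c * n + r"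
proof -
  have "arr s ''f'' c * n + r \<le> n * n + n"
    using assms by (intro add_mono mult_le_mono) (auto simp: base_def intro: less_imp_le)
  then have "arr s ''f'' c * n + r < 2 ^ w" using word by linarith
  then show ?thesis by simp
qed

text \<open>The bisection determines \<open>T\<close>, the number of occurrences of \<open>c\<close>
  before \<open>h\<close>: the occurrence with rank \<open>m\<close> lies before \<open>h\<close>
  iff \<open>m < T\<close>.\<close>

lemma bsearch:
  assumes s: "base s" and c: "reg s ''c'' = c" "c \<in> set S" and h: "reg s ''h'' = h"
  shows "wp w bsearch (\<lambda>t s'. t \<le> 40 * lgn \<and> reg s' ''p'' < n \<and> S ! reg s' ''p'' = c \<and>
      (if reg s' ''p'' < h then \<forall>q<h. reg s' ''p'' < q \<longrightarrow> q < n \<longrightarrow> S ! q \<noteq> c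
       else \<forall>q<h. q < n \<longrightarrow> S ! q \<noteq> c)) s"
proof -
  define T where "T = count_list (take h S) c"
  have T: "T \<le> count_list S c" using count_take_mono[of h "max h n" S c] by (simp add: T_def)
  have cnt: "count_list S c \<le> n" by (rule count_le_length)
  have pos: "0 < count_list S c" using c by (simp add: count_list_0_iff neq0_conv[symmetric])
  note [simp] = baseD[OF s]
  have ix: "(arr s ''f'' c * n mod 2 ^ w + r) mod 2 ^ w = arr s ''f'' c * n + r" if "r \<le> n" for r
    using occ_index[OF s c(2) that] .
  show ?thesis
    unfolding bsearch_def wp_Seq wp_Assign
  apply (rule wp_While[where I = "\<lambda>s'. frame {''a'', ''b'', ''m''} {} s s' \<and>
    reg s' ''a'' \<le> T \<and> T \<le> reg s' ''b'' \<and> reg s' ''b'' \<le> count_list S c" and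
    \<phi> = "\<lambda>s'. 26 * lg (reg s' ''b'' - reg s' ''a'')"])
  subgoal using c T by (simp add: frame_def)
  subgoal premises prems for s'
  proof -
    let ?a = "reg s' ''a''" and ?b = "reg s' ''b''"
    define m where "m = (?a + ?b) div 2"
    note [simp] = frameD[OF prems(1)[THEN conjunct1]]
    have ab: "?a < ?b" "?b \<le> n" "?a \<le> T" "T \<le> ?b" "?b \<le> count_list S c" using prems cnt by auto
    then have sum: "(?a + ?b) mod 2 ^ w = ?a + ?b" using word by simp
    have m: "?a \<le> m" "m < ?b" using ab by (auto simp: m_def)
    then have m1: "Suc m mod 2 ^ w = Suc m" using ab word_lin by simp
    obtain q where q: "arr s ''occ'' (arr s ''f'' c * n + m) = q" "q < n" "S ! q = c"
      "count_list (take q S) c = m"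
      using occ_read[OF s, of m c] m ab by auto
    have iff: "q < h \<longleftrightarrow> m < T" using count_take_less_iff[OF q(2,3), of h] q(4) by (simp add: T_def)
    have "lg (?b - Suc m) < lg (?b - ?a)" "lg (m - ?a) < lg (?b - ?a)"
      using ab by (auto intro!: lg_half simp: m_def)
    then show ?thesis
      using prems(1) ab m ix[of m] iff
      by (auto simp: c h sum q m1 m_def[symmetric] frame_def)
  qed
  subgoal premises prems for t s'
  proof -
    let ?a = "reg s' ''a''"
    note [simp] = frameD[OF prems(1)[THEN conjunct1]]
    have a: "?a = T" "reg s' ''b'' = T" using prems by auto
    have "lg (count_list S c) \<le> lg n" by (intro lg_mono cnt)
    then have t: "t \<le> 26 * lg n + 4" using prems(3) c by simp
    have "T - 1 < count_list S c" using T pos by simp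
    then obtain q where q: "arr s ''occ'' (arr s ''f'' c * n + (T - 1)) = q" "q < n" "S ! q = c"
      "count_list (take q S) c = T - 1"
      using occ_read[OF s] by metis
    have none: "q' < h \<Longrightarrow> q' < n \<Longrightarrow> S ! q' = c \<Longrightarrow> count_list (take q' S) c < T" for q'
      using count_take_less_iff[of q' S c h] by (simp add: T_def)
    \<comment> \<open>For \<open>T = 0\<close> the truncated index 0 yields the first occurrence,
      which is not before \<open>h\<close>; so the value of \<open>p\<close> alone reveals the
      failure.\<close>
    have iff: "q < h \<longleftrightarrow> T - 1 < T" using count_take_less_iff[OF q(2,3), of h] q(4) by (simp add: T_def)
    have later: "\<not> q < q'" if "q < h" "q' < h" "q' < n" "S ! q' = c" for q'
      using none[OF that(2-4)] count_take_less_iff[OF q(2,3), of q'] q(4) by auto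
    have val: "arr s ''occ'' ((arr s ''f'' c * n mod 2 ^ w + (T - Suc 0)) mod 2 ^ w) = q"
      using ix[of "T - 1"] T cnt q(1) by simp
    have "if q < h then \<forall>q'<h. q < q' \<longrightarrow> q' < n \<longrightarrow> S ! q' \<noteq> c else \<forall>q'<h. q' < n \<longrightarrow> S ! q' \<noteq> c"
    proof (cases "q < h")
      case False
      then have "T = 0" using iff by simp
      then show ?thesis using none False by force
    qed (use later in auto)
    moreover have "t \<le> 26 * lg n + 15" using t by simp
    ultimately show ?thesis using q(2,3)
      by (simp add: a c h val)
  qed
  done
qed

text \<open>
  Row \<open>j\<close> of \<open>HI\<close> describes the rightmost embedding of the \<open>j\<close> bottom characters of the stack
  into the windows; as a list the stack is given from bottom to top.
\<close>

definition stack :: "(nat \<Rightarrow> nat) \<Rightarrow> nat list \<Rightarrow> state \<Rightarrow> bool" where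
  "stack hi z s \<longleftrightarrow> reg s ''d'' = length z \<and> (\<forall>j<length z. arr s ''St'' j = z ! j) \<and>
     (\<forall>j\<le>length z. \<forall>i<k. rightmost S (hi i) (rev (take j z)) (arr s ''HI'' (j * k + i)))"

lemma stack_length:
  assumes "stack hi z s" shows "length z \<le> n"
proof -
  have r: "rightmost S (hi 0) (rev z) (arr s ''HI'' (length z * k + 0))"
    using assms k_pos unfolding stack_def by fastforce
  show ?thesis using rightmost_length[OF r] rightmost_le[OF r]
    by (metis diff_le_self le_trans length_rev)
qed

lemma try_push:
  assumes s: "base s" and c: "reg s ''c'' = c" "c \<in> set S" and st: "stack hi z s"
  shows "wp w try_push (\<lambda>t s'. t \<le> 80 * k * lgn + 20 \<and>
     (if \<forall>i<k. emb S (arr s ''Lo'' i) (hi i) (c # rev z)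
      then reg s' ''ok'' = 1 \<and> stack hi (z @ [c]) s'
      else reg s' ''ok'' = 0 \<and> stack hi z s')) s"
proof -
  define d where "d = length z"
  define H where "H i = arr s ''HI'' (d * k + i)" for i
  define Lo where "Lo = arr s ''Lo''"
  have d: "reg s ''d'' = d" using st by (simp add: stack_def d_def)
  have dn: "d \<le> n" using stack_length[OF st] by (simp add: d_def)
  have H: "rightmost S (hi i) (rev z) (H i)" if "i < k" for i
    using st that by (auto simp: stack_def H_def d_def)
  have Hn: "H i \<le> n" if "i < k" for i using rightmost_le[OF H[OF that]] by simp
  note [simp] = baseD[OF s]
  let ?last = "\<lambda>i p. p < H i \<and> S ! p = c \<and> (\<forall>q<H i. p < q \<longrightarrow> S ! q \<noteq> c)"
  let ?ex = "\<lambda>i. \<exists>p\<ge>Lo i. p < H i \<and> S ! p = c"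
  have words: "d * k < 2 ^ w" "i < k \<Longrightarrow> d * k + i < 2 ^ w" "i < k \<Longrightarrow> d * k + k + i < 2 ^ w"
    "d * k + k < 2 ^ w" for i
    using row_word[OF dn, of 0] row_word[OF dn, of i] row_word[OF dn, of "k + i"]
      row_word[OF dn, of k] k_le by (auto simp: add.assoc)
  show ?thesis
    unfolding try_push_def wp_Seq wp_Assign
  apply (rule wp_While[where I = "\<lambda>s'. frame {''ok'', ''i'', ''h'', ''a'', ''b'', ''m'', ''p''} {''HI''} s s' \<and>
      reg s' ''i'' \<le> k \<and> (\<forall>j<d * k + k. arr s' ''HI'' j = arr s ''HI'' j) \<and>
      (if \<forall>i<reg s' ''i''. ?ex i then reg s' ''ok'' = 1 \<and>
         (\<forall>i<reg s' ''i''. ?last i (arr s' ''HI'' (d * k + k + i))) else reg s' ''ok'' = 0)" and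
      \<phi> = "\<lambda>s'. (80 * lgn) * (k - reg s' ''i'')"])
  subgoal by (simp add: frame_def)
  subgoal premises prems for s'
  proof -
    define i where "i = reg s' ''i''"
    note fr = prems(1)[THEN conjunct1]
    note [simp] = frameD[OF fr]
    have s': "base s'" using base_frame[OF s fr] by simp
    have i: "i < k" using prems by (simp add: i_def)
    have Suc_i: "Suc i mod 2 ^ w = Suc i" using i k_le word_lin by simp
    have hi': "arr s' ''HI'' (d * k + i) = H i" using prems i by (simp add: H_def)
    have ki: "k - i = Suc (k - Suc i)" using i by simp
    show ?thesis
      unfolding wp_Seq wp_Assign
    apply (rule wp_frame[OF bsearch[where c = c and h = "H i"]])
    subgoal using s' by simp
    subgoal using c by simp
    subgoal using c by simp
    subgoal using words i hi' by (simp add: i_def[symmetric] d)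
    subgoal premises prems' for t s''
    proof -
      note fr' = prems'(2)
      note [simp] = frameD[OF fr']
      define p where "p = reg s'' ''p''"
      have p: "p < n" "S ! p = c" "t \<le> 40 * lgn"
        "if p < H i then \<forall>q<H i. p < q \<longrightarrow> q < n \<longrightarrow> S ! q \<noteq> c else \<forall>q<H i. q < n \<longrightarrow> S ! q \<noteq> c"
        using prems'(1) by (auto simp: p_def)
      have ex: "?ex i \<longleftrightarrow> Lo i \<le> p \<and> p < H i"
      proof
        assume "?ex i"
        then obtain q where q: "Lo i \<le> q" "q < H i" "S ! q = c" by blast
        then have "q < n" using Hn[OF i] by simp
        then show "Lo i \<le> p \<and> p < H i" using p(4) q by (auto split: if_splits)
      qed (use p in blast)
      have last: "?last i p" if "p < H i" using p that Hn[OF i] by auto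
      have h: "reg s'' ''h'' = H i" using words i hi' by (simp add: i_def[symmetric] d)
      have I: "reg s'' ''i'' = i" by (simp add: i_def)
      have fr3: "frame {''ok'', ''i'', ''h'', ''a'', ''b'', ''m'', ''p''} {''HI''} s s''"
        using fr fr' by (auto simp: frame_def)
      have all: "(\<forall>i'<Suc i. P i') \<longleftrightarrow> (\<forall>i'<i. P i') \<and> P i" for P
        by (auto simp: less_Suc_eq)
      show ?thesis
        using prems(1) i p(3) fr3 last
        by (auto simp: I h p_def[symmetric] d words Suc_i ki i_def[symmetric] all ex Lo_def
            simp flip: Lo_def split: if_splits simp: frame_def)
    qed
    done
  qed
  subgoal premises prems for t s'
  proof -
    note fr = prems(1)[THEN conjunct1]
    note [simp] = frameD[OF fr]
    have i: "reg s' ''i'' = k" using prems by simp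
    have eq: "(\<forall>i<k. emb S (arr s ''Lo'' i) (hi i) (c # rev z)) \<longleftrightarrow> (\<forall>i<k. ?ex i)"
      using emb_Cons_rightmost[OF H] by (simp add: Lo_def)
    have t: "t \<le> 80 * k * lgn + 4" using prems(3) by (simp add: algebra_simps)
    have d1: "Suc d mod 2 ^ w = Suc d" "d mod 2 ^ w = d" using dn word_lin by simp_all
    \<comment> \<open>All rows in use end before cell \<open>d * k + k\<close>, where the tentative
      row begins.\<close>
    have row: "j * k + i < d * k + k" if "i < k" "j \<le> d" for i j
      using mult_le_mono1[OF that(2), of k] that(1) by linarith
    show ?thesis
    proof (cases "\<forall>i<k. ?ex i")
      case True
      then have ok: "reg s' ''ok'' = 1" and last: "?last i (arr s' ''HI'' (d * k + k + i))" if "i < k" for i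
        using prems(1) i that by auto
      have new: "rightmost S (hi i) (c # rev z) (arr s' ''HI'' (d * k + k + i))" if "i < k" for i
        using last[OF that] rightmost_Cons[OF H[OF that]] by blast
      have "rightmost S (hi i) (rev (take j (z @ [c]))) (arr s' ''HI'' (j * k + i))"
        if "i < k" "j \<le> Suc d" for i j
      proof (cases "j \<le> d")
        case True
        then show ?thesis using st that row[OF that(1) True] prems(1)
          by (auto simp: stack_def d_def)
      next
        case False
        then have "j = Suc d" using that by simp
        then show ?thesis using new[OF that(1)] by (simp add: d_def add.commute)
      qed
      then show ?thesis using True t ok[OF k_pos] st d1 unfolding eq
        by (auto simp: d stack_def d_def nth_append c(1) less_Suc_eq)
    next
      case False
      then have ok: "reg s' ''ok'' = 0"
        using prems(1) i by auto
      have "rightmost S (hi i) (rev (take j z)) (arr s' ''HI'' (j * k + i))"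
        if "i < k" "j \<le> d" for i j
        using st that row[OF that] prems(1) by (auto simp: stack_def d_def)
      then show ?thesis using False t ok st d1 unfolding eq
        by (auto simp: d stack_def d_def c(1))
    qed
  qed
  done
qed

end

section \<open>Maximal common extensions: the invariant\<close>

text \<open>Ties go to the smallest index: the minimizer has to be unique, so that only one window
  is exempt in the last clause of \<open>gap_inv\<close>.\<close>

definition first_min :: "nat \<Rightarrow> (nat \<Rightarrow> nat) \<Rightarrow> nat \<Rightarrow> bool" where
  "first_min k g m \<longleftrightarrow> m < k \<and> (\<forall>i<k. g m \<le> g i) \<and> (\<forall>i<m. g m < g i)"

lemma first_min_unique: "first_min k g m \<Longrightarrow> first_min k g m' \<Longrightarrow> m = m'"
  unfolding first_min_def by (metis linorder_neqE_nat not_le)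

text \<open>
  \<open>Y\<close> is the final part of the common subsequence, \<open>rev z\<close> the part still to be treated, and the
  characters between \<open>Lo i\<close> and \<open>q i\<close> are known not to fit into the gap between them.
  The last clause is the reason why the scanned characters can be paid for when the top of the
  stack is consumed: this moves \<open>Lo i\<close> beyond \<open>q i\<close>, except possibly in the narrowest window, whose
  width is a lower bound for the progress in some other window.
\<close>

definition gap_inv ::
    "'a list \<Rightarrow> nat \<Rightarrow> (nat \<Rightarrow> nat) \<Rightarrow> (nat \<Rightarrow> nat) \<Rightarrow> 'a list \<Rightarrow> 'a list \<Rightarrow> 'a list \<Rightarrow>
     (nat \<Rightarrow> nat) \<Rightarrow> (nat \<Rightarrow> nat) \<Rightarrow> (nat \<Rightarrow> nat) \<Rightarrow> bool" where
  "gap_inv S k lo hi W Y z H Lo q \<longleftrightarrow>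
     (\<forall>i<k. leftmost S (lo i) Y (Lo i)) \<and>
     (\<forall>i<k. rightmost S (hi i) (rev z) (H i)) \<and>
     (\<forall>i<k. Lo i \<le> H i) \<and>
     subseq W (Y @ rev z) \<and>
     (\<forall>Y1 Y2. Y = Y1 @ Y2 \<longrightarrow> Y2 \<noteq> [] \<longrightarrow> no_insertion S k lo hi Y1 (Y2 @ rev z)) \<and>
     (\<forall>i<k. Lo i \<le> q i \<and> q i \<le> hi i) \<and>
     (\<forall>i<k. \<forall>p. Lo i \<le> p \<longrightarrow> p < q i \<longrightarrow> (\<exists>i'<k. \<not> emb S (Lo i') (hi i') (S ! p # rev z))) \<and>
     (z \<noteq> [] \<longrightarrow> (\<forall>i<k. (\<forall>p. Lo i \<le> p \<longrightarrow> p < q i \<longrightarrow> S ! p \<noteq> last z) \<or>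
        q i \<le> H i \<and> first_min k (\<lambda>i. H i - Lo i) i))"

text \<open>A failed test raises some \<open>q i\<close> and an insertion raises the height
  \<open>d\<close>, so both lower the value. The factor 4 is spent when the bounds
  \<open>Lo i\<close> move by \<open>\<delta> i\<close>: in total, two shares make up for the
  scanned characters that are forgotten, one for the lower stack, and one pays for the move.\<close>

definition potential :: "nat \<Rightarrow> (nat \<Rightarrow> nat) \<Rightarrow> (nat \<Rightarrow> nat) \<Rightarrow> (nat \<Rightarrow> nat) \<Rightarrow> nat \<Rightarrow> nat" where
  "potential k hi Lo q d = (\<Sum>i<k. 4 * (hi i - Lo i) - (q i - Lo i) - d)"

lemma gap_invD:
  assumes "gap_inv S k lo hi W Y z H Lo q"
  shows "i < k \<Longrightarrow> leftmost S (lo i) Y (Lo i)" "i < k \<Longrightarrow> rightmost S (hi i) (rev z) (H i)"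
    "i < k \<Longrightarrow> Lo i \<le> H i" "subseq W (Y @ rev z)"
    "\<forall>Y1 Y2. Y = Y1 @ Y2 \<longrightarrow> Y2 \<noteq> [] \<longrightarrow> no_insertion S k lo hi Y1 (Y2 @ rev z)"
    "i < k \<Longrightarrow> Lo i \<le> q i" "i < k \<Longrightarrow> q i \<le> hi i"
    "i < k \<Longrightarrow> Lo i \<le> p \<Longrightarrow> p < q i \<Longrightarrow> \<exists>i'<k. \<not> emb S (Lo i') (hi i') (S ! p # rev z)"
    "z \<noteq> [] \<Longrightarrow> i < k \<Longrightarrow> (\<forall>p. Lo i \<le> p \<longrightarrow> p < q i \<longrightarrow> S ! p \<noteq> last z) \<or>
        q i \<le> H i \<and> first_min k (\<lambda>i. H i - Lo i) i"
  using assms by (simp_all add: gap_inv_def)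

text \<open>These inequalities ensure that no subtraction in \<open>potential\<close> is
  truncated.\<close>

lemma gap_inv_height:
  assumes "gap_inv S k lo hi W Y z H Lo q" "i < k"
  shows "Lo i + length z \<le> hi i" "Lo i \<le> q i" "q i \<le> hi i" "hi i \<le> length S"
proof -
  have r: "rightmost S (hi i) (rev z) (H i)" and "Lo i \<le> H i" "Lo i \<le> q i" "q i \<le> hi i"
    using assms by (auto simp: gap_inv_def)
  then show "Lo i + length z \<le> hi i" "Lo i \<le> q i" "q i \<le> hi i" "hi i \<le> length S"
    using rightmost_length[OF r] rightmost_le[OF r] by auto
qed

lemma gap_inv_emb:
  assumes "gap_inv S k lo hi W Y z H Lo q" "i < k"
  shows "emb S (Lo i) (hi i) (rev z)" "emb S (lo i) (hi i) (Y @ rev z)"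
proof -
  have r: "rightmost S (hi i) (rev z) (H i)" and l: "leftmost S (lo i) Y (Lo i)" and "Lo i \<le> H i"
    using assms by (auto simp: gap_inv_def)
  then show "emb S (Lo i) (hi i) (rev z)" by (simp add: rightmost_def)
  then show "emb S (lo i) (hi i) (Y @ rev z)" using emb_append_leftmost[OF l] by blast
qed

lemma gap_inv_init:
  assumes "\<forall>i<k. rightmost S (hi i) (rev z) (H i)" "\<forall>i<k. emb S (lo i) (hi i) (rev z)"
    "\<forall>i<k. q i = lo i"
  shows "gap_inv S k lo hi (rev z) [] z H lo q"
proof -
  have "lo i \<le> hi i" if "i < k" for i using assms(2) that emb_le by blast
  then show ?thesis using assms by (auto simp: gap_inv_def leftmost_Nil rightmost_def)
qed

text \<open>\<open>H\<close> and \<open>Lo\<close> stay fixed while scanning, so \<open>m\<close>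
  remains the narrowest window, and \<open>q m < H m\<close> keeps its exemption in the last clause
  valid.\<close>

lemma gap_inv_fail:
  assumes inv: "gap_inv S k lo hi W Y z H Lo q" and m: "first_min k (\<lambda>i. H i - Lo i) m" "q m < H m"
    and fail: "\<not> (\<forall>i<k. emb S (Lo i) (hi i) (S ! q m # rev z))"
  shows "gap_inv S k lo hi W Y z H Lo (q(m := Suc (q m)))"
    and "potential k hi Lo (q(m := Suc (q m))) (length z) + 1 \<le> potential k hi Lo q (length z)"
proof -
  have mk: "m < k" using m(1) by (simp add: first_min_def)
  have "rightmost S (hi m) (rev z) (H m)" using inv mk by (simp add: gap_inv_def)
  then have qm: "q m < hi m" using m(2) rightmost_le by fastforce
  show "gap_inv S k lo hi W Y z H Lo (q(m := Suc (q m)))"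
    unfolding gap_inv_def
  proof (intro conjI allI impI)
    fix i assume "z \<noteq> []" "i < k"
    then show "(\<forall>p. Lo i \<le> p \<longrightarrow> p < (q(m := Suc (q m))) i \<longrightarrow> S ! p \<noteq> last z) \<or>
      (q(m := Suc (q m))) i \<le> H i \<and> first_min k (\<lambda>i. H i - Lo i) i"
    proof (cases "i = m")
      case True
      then show ?thesis using m by simp
    next
      case False
      then have "\<not> first_min k (\<lambda>i. H i - Lo i) i" using first_min_unique[OF m(1)] by blast
      then show ?thesis using gap_invD(9)[OF inv \<open>z \<noteq> []\<close> \<open>i < k\<close>] False by simp
    qed
  next
    fix i p assume "i < k" "Lo i \<le> p" "p < (q(m := Suc (q m))) i"
    then have "p < q i \<or> p = q m" by (auto split: if_splits)
    then show "\<exists>i'<k. \<not> emb S (Lo i') (hi i') (S ! p # rev z)"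
    proof
      assume "p < q i"
      then show ?thesis using inv \<open>i < k\<close> \<open>Lo i \<le> p\<close> unfolding gap_inv_def by blast
    qed (use fail in blast)
  next
    fix i assume "i < k"
    then show "Lo i \<le> (q(m := Suc (q m))) i" "(q(m := Suc (q m))) i \<le> hi i"
      using inv qm by (auto simp: gap_inv_def intro: le_SucI)
  qed (use inv in \<open>auto simp: gap_inv_def\<close>)
  have h: "Lo m + length z \<le> hi m" "Lo m \<le> q m" using gap_inv_height[OF inv mk] by auto
  have "(\<Sum>i<k. 4 * (hi i - Lo i) - ((q(m := Suc (q m))) i - Lo i) - length z)
      < (\<Sum>i<k. 4 * (hi i - Lo i) - (q i - Lo i) - length z)"
    using mk h qm by (intro sum_strict_mono_ex1) auto
  then show "potential k hi Lo (q(m := Suc (q m))) (length z) + 1 \<le> potential k hi Lo q (length z)"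
    by (simp add: potential_def)
qed

text \<open>Tests that failed fail again when the right part is longer. The new top \<open>c\<close>
  passed the test that every scanned character failed, hence it differs from all of them, and the
  first alternative of the last clause holds in every window.\<close>

lemma gap_inv_push:
  assumes inv: "gap_inv S k lo hi W Y z H Lo q" and k: "0 < k"
    and ok: "\<forall>i<k. emb S (Lo i) (hi i) (c # rev z)"
    and H': "\<forall>i<k. rightmost S (hi i) (c # rev z) (H' i)"
  shows "gap_inv S k lo hi W Y (z @ [c]) H' Lo q"
    and "potential k hi Lo q (Suc (length z)) + 1 \<le> potential k hi Lo q (length z)"
proof -
  show inv': "gap_inv S k lo hi W Y (z @ [c]) H' Lo q"
    unfolding gap_inv_def
  proof (intro conjI allI impI)
    fix i assume "i < k"
    then show "leftmost S (lo i) Y (Lo i)" "rightmost S (hi i) (rev (z @ [c])) (H' i)" "Lo i \<le> H' i"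
      "Lo i \<le> q i" "q i \<le> hi i"
      using gap_invD(1,6,7)[OF inv] H' ok unfolding rightmost_def by auto
  next
    have "subseq (Y @ rev z) (Y @ rev (z @ [c]))" by (intro list_emb_append_mono) auto
    then show "subseq W (Y @ rev (z @ [c]))"
      using inv unfolding gap_inv_def by (meson subseq_order.trans)
  next
    fix Y1 Y2 assume "Y = Y1 @ Y2" "Y2 \<noteq> []"
    then have "no_insertion S k lo hi Y1 (Y2 @ rev z)" using inv unfolding gap_inv_def by blast
    then show "no_insertion S k lo hi Y1 (Y2 @ rev (z @ [c]))"
      by (rule no_insertion_mono) (intro list_emb_append_mono, auto)
  next
    fix i p assume "i < k" "Lo i \<le> p" "p < q i"
    from gap_invD(8)[OF inv this]
    obtain i' where i': "i' < k" "\<not> emb S (Lo i') (hi i') (S ! p # rev z)" by blast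
    have "subseq (S ! p # rev z) (S ! p # c # rev z)" by auto
    then show "\<exists>i'<k. \<not> emb S (Lo i') (hi i') (S ! p # rev (z @ [c]))"
      using i' emb_subseq[of S "Lo i'" "hi i'" "S ! p # c # rev z" "S ! p # rev z"]
      by (auto simp del: emb.simps)
  next
    fix i assume "i < k"
    then have "S ! p \<noteq> last (z @ [c])" if "Lo i \<le> p" "p < q i" for p
      using gap_invD(8)[OF inv \<open>i < k\<close> that] ok by auto
    then show "(\<forall>p. Lo i \<le> p \<longrightarrow> p < q i \<longrightarrow> S ! p \<noteq> last (z @ [c])) \<or>
       q i \<le> H' i \<and> first_min k (\<lambda>i. H' i - Lo i) i" by blast
  qed
  have h: "Lo i + Suc (length z) \<le> hi i" "q i \<le> hi i" "Lo i \<le> q i" if "i < k" for i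
    using gap_inv_height[OF inv' that] by auto
  have "potential k hi Lo q (Suc (length z)) < potential k hi Lo q (length z)"
    unfolding potential_def
  proof (rule sum_strict_mono)
    fix i assume "i \<in> {..<k}"
    then have "i < k" by simp
    from h[OF this] show "4 * (hi i - Lo i) - (q i - Lo i) - Suc (length z)
        < 4 * (hi i - Lo i) - (q i - Lo i) - length z" by linarith
  qed (use k in auto)
  then show "potential k hi Lo q (Suc (length z)) + 1 \<le> potential k hi Lo q (length z)" by simp
qed

text \<open>A character that fits into the gap in all windows must occur between \<open>Lo m\<close>
  and \<open>H m\<close>, and everything there has been tested in vain. Exhausting a single window
  is enough.\<close>

lemma gap_inv_closed:
  assumes inv: "gap_inv S k lo hi W Y z H Lo q" and m: "first_min k (\<lambda>i. H i - Lo i) m" "H m \<le> q m"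
  shows "no_insertion S k lo hi Y (rev z)"
  unfolding no_insertion_def
proof (rule allI, rule ccontr)
  fix c assume "\<not> (\<exists>i<k. \<not> emb S (lo i) (hi i) (Y @ c # rev z))"
  then have all: "emb S (Lo i) (hi i) (c # rev z)" if "i < k" for i
    using that emb_append_leftmost[OF gap_invD(1)[OF inv that]] by blast
  have mk: "m < k" using m(1) by (simp add: first_min_def)
  then have "rightmost S (hi m) (rev z) (H m)" using inv by (simp add: gap_inv_def)
  then obtain p where "Lo m \<le> p" "p < H m" "S ! p = c"
    using all[OF mk] unfolding emb_Cons_rightmost[OF \<open>rightmost S (hi m) (rev z) (H m)\<close>] by blast
  then have "\<exists>i'<k. \<not> emb S (Lo i') (hi i') (c # rev z)"
    using inv mk m(2) unfolding gap_inv_def by (meson less_le_trans)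
  then show False using all by blast
qed

lemma gap_inv_pop:
  assumes inv: "gap_inv S k lo hi W Y (z @ [y]) H Lo q"
    and m: "first_min k (\<lambda>i. H i - Lo i) m" "H m \<le> q m"
    and nxt: "\<And>i. i < k \<Longrightarrow> Lo i \<le> nxt i \<and> nxt i < length S \<and> S ! nxt i = y"
      "\<And>i p. i < k \<Longrightarrow> Lo i \<le> p \<Longrightarrow> p < nxt i \<Longrightarrow> S ! p \<noteq> y"
    and Lo': "\<And>i. i < k \<Longrightarrow> Lo' i = Suc (nxt i) \<and> q' i = Suc (nxt i)"
    and H': "\<forall>i<k. rightmost S (hi i) (rev z) (H' i)"
  shows "gap_inv S k lo hi W (Y @ [y]) z H' Lo' q'"
    and "potential k hi Lo' q' (length z) + (\<Sum>i<k. Suc (nxt i) - Lo i)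
      \<le> potential k hi Lo q (Suc (length z))"
proof -
  have closed: "no_insertion S k lo hi Y (y # rev z)" using gap_inv_closed[OF inv m] by simp
  have mk: "m < k" using m(1) by (simp add: first_min_def)
  have l': "leftmost S (lo i) (Y @ [y]) (Lo' i)" if "i < k" for i
    using leftmost_snoc[of S "lo i" Y "Lo i" "nxt i" y] inv nxt that Lo'[OF that]
    by (auto simp: gap_inv_def)
  have emb': "emb S (Lo' i) (hi i) (rev z)" if "i < k" for i
    using emb_append_leftmost[OF l'[OF that], of "hi i" "rev z"] gap_inv_emb(2)[OF inv that] by simp
  have Lohi: "Lo' i \<le> H' i" "Lo' i \<le> hi i" if "i < k" for i
    using emb'[OF that] H' that emb_le[OF emb'[OF that]] unfolding rightmost_def by blast+
  show inv': "gap_inv S k lo hi W (Y @ [y]) z H' Lo' q'"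
    unfolding gap_inv_def
  proof (intro conjI allI impI)
    show "subseq W ((Y @ [y]) @ rev z)" using inv by (simp add: gap_inv_def)
  next
    fix Y1 Y2 assume *: "Y @ [y] = Y1 @ Y2" "Y2 \<noteq> []"
    then obtain Y2' where Y2': "Y2 = Y2' @ [y]" "Y = Y1 @ Y2'"
      by (metis append_is_Nil_conv butlast_append butlast_snoc append_butlast_last_id last_appendR last_snoc)
    show "no_insertion S k lo hi Y1 (Y2 @ rev z)"
    proof (cases "Y2' = []")
      case True
      then show ?thesis using closed Y2' by simp
    next
      case False
      then have "no_insertion S k lo hi Y1 (Y2' @ rev (z @ [y]))"
        using inv Y2'(2) unfolding gap_inv_def by blast
      then show ?thesis using Y2' by simp
    qed
  qed (use l' H' Lohi Lo' in auto)
  \<comment> \<open>The gap is closed against \<open>y\<close> itself too, so in some window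
    \<open>y\<close> does not occur between \<open>Lo\<close> and \<open>H\<close>. There the move
    to the next \<open>y\<close> skips a whole gap, which is at least as wide as that of window
    \<open>m\<close>.\<close>
  obtain i0 where i0: "i0 < k" "\<not> emb S (Lo i0) (hi i0) (y # rev (z @ [y]))"
  proof -
    have "no_insertion S k lo hi Y (rev (z @ [y]))" using gap_inv_closed[OF inv m] .
    then obtain i where "i < k" "\<not> emb S (lo i) (hi i) (Y @ y # rev (z @ [y]))"
      unfolding no_insertion_def by blast
    moreover have "leftmost S (lo i) Y (Lo i)" using inv \<open>i < k\<close> by (simp add: gap_inv_def)
    ultimately show ?thesis using that emb_append_leftmost by blast
  qed
  define \<delta> where "\<delta> i = Suc (nxt i) - Lo i" for i
  have "rightmost S (hi i0) (rev (z @ [y])) (H i0)" using inv i0 by (simp add: gap_inv_def)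
  then have "H i0 \<le> nxt i0" using i0 nxt(1)[OF i0(1)] emb_Cons_rightmost by (meson not_le)
  then have far: "H m - Lo m \<le> \<delta> i0" using m(1) i0(1) by (fastforce simp: first_min_def \<delta>_def)
  \<comment> \<open>Outside the exempt case no scanned character equals \<open>y\<close>, so the
    next \<open>y\<close> lies beyond the scanned part.\<close>
  have near: "q i - Lo i \<le> \<delta> i" if "i < k" "i \<noteq> m \<or> H m < q m" for i
  proof -
    have "\<not> (q i \<le> H i \<and> first_min k (\<lambda>i. H i - Lo i) i)"
      using that first_min_unique[OF m(1)] by auto
    then have "\<forall>p. Lo i \<le> p \<longrightarrow> p < q i \<longrightarrow> S ! p \<noteq> y"
      using inv that(1) unfolding gap_inv_def by auto
    then have "q i \<le> nxt i" using nxt(1)[OF that(1)] by (metis not_le)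
    then show ?thesis by (simp add: \<delta>_def)
  qed
  have scanned: "(\<Sum>i<k. q i - Lo i) \<le> 2 * (\<Sum>i<k. \<delta> i)"
  proof (cases "H m < q m")
    case True
    then have "(\<Sum>i<k. q i - Lo i) \<le> (\<Sum>i<k. \<delta> i)" using near by (intro sum_mono) auto
    then show ?thesis by simp
  next
    case False
    then have "q m - Lo m \<le> \<delta> i0" using m(2) far by simp
    also have "\<dots> \<le> (\<Sum>i<k. \<delta> i)" using i0(1) by (intro member_le_sum) auto
    finally have 1: "q m - Lo m \<le> (\<Sum>i<k. \<delta> i)" .
    have "(\<Sum>i<k. q i - Lo i) = (q m - Lo m) + (\<Sum>i\<in>{..<k} - {m}. q i - Lo i)"
      using mk by (intro sum.remove) auto
    also have "(\<Sum>i\<in>{..<k} - {m}. q i - Lo i) \<le> (\<Sum>i\<in>{..<k} - {m}. \<delta> i)"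
      using near by (intro sum_mono) auto
    also have "\<dots> \<le> (\<Sum>i<k. \<delta> i)" by (intro sum_mono2) auto
    finally show ?thesis using 1 by simp
  qed
  \<comment> \<open>One of the four shares of \<open>\<delta> i\<close> absorbs the drop in height,
    because \<open>\<delta> i\<close> is at least 1; three are left. Two of them are used up by
    \<open>scanned\<close>.\<close>
  have each: "(4 * (hi i - Lo' i) - (q' i - Lo' i) - length z) + 3 * \<delta> i
      \<le> (4 * (hi i - Lo i) - (q i - Lo i) - Suc (length z)) + (q i - Lo i)" if ik: "i < k" for i
  proof -
    have Lo'_q': "Lo' i = Suc (nxt i)" "q' i = Suc (nxt i)" using Lo'[OF ik] by auto
    obtain a where a: "nxt i = Lo i + a" using nxt(1)[OF ik] le_Suc_ex by blast
    obtain b where b: "hi i = Suc (nxt i) + length z + b"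
      using gap_inv_height(1)[OF inv' ik] le_Suc_ex unfolding Lo'_q' by blast
    obtain e where e: "q i = Lo i + e" using gap_inv_height(2)[OF inv ik] le_Suc_ex by blast
    have "e \<le> Suc a + length z + b" using gap_inv_height(3)[OF inv ik] a b e by simp
    then show ?thesis unfolding \<delta>_def Lo'_q' e b a by simp
  qed
  have "(\<Sum>i<k. (4 * (hi i - Lo' i) - (q' i - Lo' i) - length z) + 3 * \<delta> i)
      \<le> (\<Sum>i<k. (4 * (hi i - Lo i) - (q i - Lo i) - Suc (length z)) + (q i - Lo i))"
    using each by (intro sum_mono) auto
  then have "potential k hi Lo' q' (length z) + 3 * (\<Sum>i<k. \<delta> i)
      \<le> potential k hi Lo q (Suc (length z)) + (\<Sum>i<k. q i - Lo i)"
    by (simp add: potential_def sum.distrib sum_distrib_left)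
  then show "potential k hi Lo' q' (length z) + (\<Sum>i<k. Suc (nxt i) - Lo i)
      \<le> potential k hi Lo q (Suc (length z))"
    using scanned unfolding \<delta>_def by linarith
qed

lemma gap_inv_final:
  assumes inv: "gap_inv S k lo hi W Y [] H Lo q" and m: "first_min k (\<lambda>i. H i - Lo i) m" "H m \<le> q m"
    and Y: "Y = Y1 @ Y2"
  shows "no_insertion S k lo hi Y1 Y2"
proof (cases "Y2 = []")
  case True
  then show ?thesis using gap_inv_closed[OF inv m] Y by simp
next
  case False
  then show ?thesis using inv Y unfolding gap_inv_def by fastforce
qed

section \<open>Programs that extend one part of the string\<close>

text \<open>Characters are pushed from the right end, so the last one lies at the bottom of the
  stack. Row 0 of \<open>HI\<close> must already contain the right ends of the windows.\<close>

definition load :: "string \<Rightarrow> string \<Rightarrow> com" where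
  "load a l =
    ''d'' ::= Const 0;;
    ''ok'' ::= Const 1;;
    ''j'' ::= Reg l;;
    While (And (Equal (Reg ''ok'') (Const 1)) (Less (Const 0) (Reg ''j''))) (
      ''j'' ::= Sub (Reg ''j'') (Const 1);;
      ''c'' ::= Read a (Reg ''j'');;
      try_push)"

definition argmin :: com where
  "argmin =
    ''mm'' ::= Const 0;;
    ''i'' ::= Const 1;;
    While (Less (Reg ''i'') (Reg ''k'')) (
      If (Less (Sub (Read ''HI'' (Add (Mul (Reg ''d'') (Reg ''k'')) (Reg ''i''))) (Read ''Lo'' (Reg ''i'')))
               (Sub (Read ''HI'' (Add (Mul (Reg ''d'') (Reg ''k'')) (Reg ''mm''))) (Read ''Lo'' (Reg ''mm''))))
        (''mm'' ::= Reg ''i'')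
        (''mm'' ::= Reg ''mm'');;
      ''i'' ::= Add (Reg ''i'') (Const 1))"

definition advance :: com where
  "advance =
    ''i'' ::= Const 0;;
    While (Less (Reg ''i'') (Reg ''k'')) (
      While (Not (Equal (Read ''S'' (Read ''Lo'' (Reg ''i''))) (Reg ''c'')))
        (Store ''Lo'' (Reg ''i'') (Add (Read ''Lo'' (Reg ''i'')) (Const 1)));;
      Store ''Lo'' (Reg ''i'') (Add (Read ''Lo'' (Reg ''i'')) (Const 1));;
      Store ''q'' (Reg ''i'') (Read ''Lo'' (Reg ''i''));;
      ''i'' ::= Add (Reg ''i'') (Const 1))"

definition fill :: "string \<Rightarrow> aexp \<Rightarrow> com" where
  "fill a e =
    ''i'' ::= Const 0;;
    While (Less (Reg ''i'') (Reg ''k'')) (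
      Store a (Reg ''i'') e;;
      ''i'' ::= Add (Reg ''i'') (Const 1))"

text \<open>\<open>1 - ok\<close> moves the pointer only after a failed test; an inserted character
  is thus tried again in the same gap.\<close>

definition scan_step :: com where
  "scan_step =
    try_push;;
    Store ''q'' (Reg ''mm'') (Add (Read ''q'' (Reg ''mm'')) (Sub (Const 1) (Reg ''ok'')))"

definition pop_step :: "string \<Rightarrow> string \<Rightarrow> com" where
  "pop_step a l =
    ''d'' ::= Sub (Reg ''d'') (Const 1);;
    ''c'' ::= Read ''St'' (Reg ''d'');;
    Store a (Reg l) (Reg ''c'');;
    l ::= Add (Reg l) (Const 1);;
    advance"

definition run_step :: "string \<Rightarrow> string \<Rightarrow> com" where
  "run_step a l =
    argmin;;
    If (Less (Read ''q'' (Reg ''mm'')) (Read ''HI'' (Add (Mul (Reg ''d'') (Reg ''k'')) (Reg ''mm''))))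
      (''c'' ::= Read ''S'' (Read ''q'' (Reg ''mm''));; scan_step)
      (If (Equal (Reg ''d'') (Const 0)) (''fin'' ::= Const 1) (pop_step a l))"

definition run :: "string \<Rightarrow> string \<Rightarrow> com" where
  "run a l =
    l ::= Const 0;;
    ''fin'' ::= Const 0;;
    fill ''q'' (Read ''Lo'' (Reg ''i''));;
    While (Equal (Reg ''fin'') (Const 0)) (run_step a l)"

lemma load_mods [simp]:
  "rmods (load a l) = {''d'', ''ok'', ''j'', ''c'', ''i'', ''h'', ''a'', ''b'', ''m'', ''p''}"
  "amods (load a l) = {''HI'', ''St''}"
  by (auto simp: load_def)

lemma argmin_mods [simp]: "rmods argmin = {''mm'', ''i''}" "amods argmin = {}"
  by (auto simp: argmin_def)

lemma advance_mods [simp]: "rmods advance = {''i''}" "amods advance = {''Lo'', ''q''}"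
  by (auto simp: advance_def)

lemma fill_mods [simp]: "rmods (fill a e) = {''i''}" "amods (fill a e) = {a}"
  by (auto simp: fill_def)

lemma step_mods [simp]:
  "rmods scan_step = {''ok'', ''i'', ''h'', ''a'', ''b'', ''m'', ''p'', ''d''}"
  "amods scan_step = {''HI'', ''St'', ''q''}"
  "rmods (pop_step a l) = {l, ''c'', ''d'', ''i''}"
  "amods (pop_step a l) = {a, ''q'', ''Lo''}"
  by (auto simp: scan_step_def pop_step_def)

lemma run_mods [simp]:
  "rmods (run a l) =
    {l, ''fin'', ''mm'', ''c'', ''d'', ''ok'', ''i'', ''h'', ''a'', ''b'', ''m'', ''p''}"
  "amods (run a l) = {a, ''q'', ''HI'', ''St'', ''Lo''}"
  by (auto simp: run_def run_step_def)

definition holds :: "string \<Rightarrow> string \<Rightarrow> nat list \<Rightarrow> state \<Rightarrow> bool" where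
  "holds a l W s \<longleftrightarrow> reg s l = length W \<and> (\<forall>j<length W. arr s a j = W ! j)"

text \<open>The part of the string before the marked character is kept in the output array.\<close>

abbreviation "is_U \<equiv> holds ''Y'' ''lU''"
abbreviation "is_V \<equiv> holds ''V'' ''lV''"

lemma holds_frame:
  assumes "holds a l W s" "frame X A s s'" "l \<notin> X" "a \<notin> A"
  shows "holds a l W s'"
  using assms frame_reg[OF assms(2,3)] frame_arr[OF assms(2,4)] by (simp add: holds_def)

section \<open>Correctness of loading, searching the narrowest window, and moving the left
  bounds\<close>

context machine
begin

lemma k_lgn: "k \<le> k * lgn" "1 \<le> k * lgn"
  using k_pos by auto

lemma load:
  assumes s: "base s" and W: "holds a l W s" "set W \<subseteq> set S"
    and hi: "\<forall>i<k. arr s ''HI'' i = hi i \<and> arr s ''Lo'' i \<le> hi i \<and> hi i \<le> n"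
    and al: "a \<in> {''Y'', ''V''}" "l \<in> {''lU'', ''lV''}"
  shows "wp w (load a l) (\<lambda>t s'. t \<le> 150 * (k * lgn) * (length W + 1) \<and>
     (if \<forall>i<k. emb S (arr s ''Lo'' i) (hi i) W
      then reg s' ''ok'' = 1 \<and> stack hi (rev W) s'
      else reg s' ''ok'' = 0)) s"
proof -
  have al' [simp]: "l \<noteq> ''d''" "l \<noteq> ''ok''" "a \<noteq> ''HI''" "a \<noteq> ''St''" using al by auto
  define Lo where "Lo = arr s ''Lo''"
  let ?P = "\<lambda>j. \<forall>i<k. emb S (Lo i) (hi i) (drop j W)"
  let ?X = "{''d'', ''ok'', ''j'', ''c'', ''i'', ''h'', ''a'', ''b'', ''m'', ''p''}"
  note [simp] = baseD[OF s]
  show ?thesis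
    unfolding load_def wp_Seq wp_Assign
  apply (rule wp_While[where I = "\<lambda>s'. frame ?X {''HI'', ''St''} s s' \<and> reg s' ''j'' \<le> length W \<and>
      (if ?P (reg s' ''j'') then reg s' ''ok'' = 1 \<and> stack hi (rev (drop (reg s' ''j'') W)) s'
       else reg s' ''ok'' = 0)" and \<phi> = "\<lambda>s'. 120 * (k * lgn) * reg s' ''j''"])
  subgoal using W hi by (auto simp: frame_def holds_def stack_def Lo_def intro: rightmost_Nil)
  subgoal premises prems for s'
  proof -
    note fr = prems(1)[THEN conjunct1]
    have s': "base s'" using base_frame[OF s fr] by simp
    have W': "holds a l W s'" using holds_frame[OF W(1) fr] al by auto
    define j where "j = reg s' ''j'' - 1"
    have j: "reg s' ''j'' = Suc j" "j < length W" using prems by (auto simp: j_def)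
    have P: "?P (Suc j)" and st: "stack hi (rev (drop (Suc j) W)) s'"
      using prems by (auto simp: j split: if_splits)
    have drop: "drop j W = W ! j # drop (Suc j) W" using j(2) by (rule Cons_nth_drop_Suc[symmetric])
    have Wj: "W ! j \<in> set S" using W(2) j(2) by auto
    have read: "arr s' a j = W ! j" using W' j by (simp add: holds_def)
    show ?thesis
      unfolding wp_Seq wp_Assign
    apply (rule wp_frame[OF try_push[where c = "W ! j" and hi = hi and z = "rev (drop (Suc j) W)"]])
    subgoal using s' by simp
    subgoal using read by (simp add: j)
    subgoal using Wj by simp
    subgoal using st by (simp add: stack_def)
    subgoal premises prems' for t s''
    proof -
      note fr' = prems'(2)
      note [simp] = frameD[OF fr'] frame_arr[OF fr]
      have fr3: "frame ?X {''HI'', ''St''} s s''" using fr fr' by (auto simp: frame_def)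
      have J: "reg s'' ''j'' = j" by (simp add: j)
      have t: "t \<le> 80 * k * lgn + 20" using prems'(1) by blast
      have "(\<forall>i<k. emb S (Lo i) (hi i) (W ! j # drop (Suc j) W)) = ?P j" by (simp only: drop)
      then show ?thesis using prems'(1) fr3 j(2) t k_lgn(2)
        by (auto simp: J Lo_def[symmetric] drop j(1) algebra_simps simp del: emb.simps split: if_splits)
    qed
    done
  qed
  subgoal premises prems for t s'
  proof -
    have "?P (reg s' ''j'') \<Longrightarrow> reg s' ''j'' = 0" using prems by (auto split: if_splits)
    \<comment> \<open>A suffix that does not fit rules out every longer one, so it is safe to stop
      early.\<close>
    moreover have "?P 0 \<Longrightarrow> ?P (reg s' ''j'')" using emb_subseq
      by (metis drop0 suffix_drop suffix_imp_subseq)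
    moreover have "t \<le> 120 * (k * lgn) * length W + 10" using prems(3) W(1) by (simp add: holds_def)
    ultimately show ?thesis using prems(1) k_lgn(2) unfolding Lo_def[symmetric]
      by (auto simp: algebra_simps split: if_splits)
  qed
  done
qed

lemma argmin:
  assumes s: "base s" and st: "stack hi z s"
  shows "wp w argmin (\<lambda>t s'. t \<le> 60 * k + 10 \<and>
     first_min k (\<lambda>i. arr s ''HI'' (length z * k + i) - arr s ''Lo'' i) (reg s' ''mm'')) s"
proof -
  define d where "d = length z"
  define g where "g i = arr s ''HI'' (d * k + i) - arr s ''Lo'' i" for i
  have d: "reg s ''d'' = d" using st by (simp add: stack_def d_def)
  have dn: "d \<le> n" using stack_length[OF st] by (simp add: d_def)
  note [simp] = baseD[OF s]
  have words: "d * k < 2 ^ w" "i < k \<Longrightarrow> d * k + i < 2 ^ w" for i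
    using row_word[OF dn, of 0] row_word[OF dn, of i] k_le by auto
  show ?thesis
    unfolding argmin_def wp_Seq wp_Assign
  apply (rule wp_While[where I = "\<lambda>s'. frame {''mm'', ''i''} {} s s' \<and> reg s' ''i'' \<le> k \<and>
      0 < reg s' ''i'' \<and> first_min (reg s' ''i'') g (reg s' ''mm'')" and
      \<phi> = "\<lambda>s'. 50 * (k - reg s' ''i'')"])
  subgoal using k_pos by (simp add: frame_def first_min_def)
  subgoal premises prems for s'
  proof -
    note fr = prems(1)[THEN conjunct1]
    note [simp] = frameD[OF fr]
    define i m where "i = reg s' ''i''" and "m = reg s' ''mm''"
    have i: "i < k" "Suc i mod 2 ^ w = Suc i" using prems k_le word_lin by (auto simp: i_def)
    have m: "first_min i g m" "m < k" using prems i by (auto simp: i_def m_def first_min_def)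
    have "first_min (Suc i) g i" if "g i < g m"
      using m that unfolding first_min_def by (auto simp: less_Suc_eq dest: le_less_trans[rotated])
    moreover have "first_min (Suc i) g m" if "\<not> g i < g m"
      using m that unfolding first_min_def by (auto simp: less_Suc_eq)
    moreover have "k - i = Suc (k - Suc i)" using i by simp
    ultimately show ?thesis using prems(1) i m(2)
      by (simp add: words d frame_def flip: i_def m_def g_def)
  qed
  subgoal premises prems for t s'
  proof -
    have "reg s' ''i'' = k" using prems frame_reg[OF prems(1)[THEN conjunct1], of "''k''"] by simp
    then have "first_min k g (reg s' ''mm'')" "t \<le> 50 * k + 4" using prems by auto
    moreover have "(\<lambda>i. arr s ''HI'' (length z * k + i) - arr s ''Lo'' i) = g"
      by (simp add: g_def d_def fun_eq_iff)
    ultimately show ?thesis by simp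
  qed
  done
qed

text \<open>The expression may read the array that is being overwritten, as long as it looks only at
  cells from the current index on. This covers copying row \<open>d\<close> of \<open>HI\<close>
  onto row 0, where the source index \<open>d * k + i\<close> is at least \<open>i\<close>.\<close>

lemma fill:
  assumes s: "base s"
    and e: "\<And>s'. frame {''i''} {a} s s' \<Longrightarrow> reg s' ''i'' < k \<Longrightarrow>
      (\<forall>j\<ge>reg s' ''i''. arr s' a j = arr s a j) \<Longrightarrow> aval w e s' = g (reg s' ''i'')"
  shows "wp w (fill a e) (\<lambda>t s'. t \<le> (acost e + 20) * k + 10 \<and>
    (\<forall>j. arr s' a j = (if j < k then g j else arr s a j))) s"
proof -
  note [simp] = baseD[OF s]
  show ?thesis
    unfolding fill_def wp_Seq wp_Assign
  apply (rule wp_While[where I = "\<lambda>s'. frame {''i''} {a} s s' \<and> reg s' ''i'' \<le> k \<and>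
      (\<forall>j. arr s' a j = (if j < reg s' ''i'' then g j else arr s a j))" and
      \<phi> = "\<lambda>s'. (acost e + 20) * (k - reg s' ''i'')"])
  subgoal by (simp add: frame_def)
  subgoal premises prems for s'
  proof -
    note fr = prems(1)[THEN conjunct1]
    note [simp] = frameD[OF fr]
    define i where "i = reg s' ''i''"
    have i: "i < k" "Suc i mod 2 ^ w = Suc i" using prems k_le word_lin by (auto simp: i_def)
    have "aval w e s' = g i" using e[OF fr] prems(1) i by (simp add: i_def)
    moreover have "k - i = Suc (k - Suc i)" using i by simp
    ultimately show ?thesis using prems(1) i
      by (auto simp: frame_def less_Suc_eq simp flip: i_def)
  qed
  subgoal premises prems for t s'
  proof -
    have "reg s' ''i'' = k" using prems frame_reg[OF prems(1)[THEN conjunct1], of "''k''"] by simp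
    then show ?thesis using prems by simp
  qed
  done
qed

lemma advance:
  assumes s: "base s" and c: "reg s ''c'' = c"
    and nxt: "\<And>i. i < k \<Longrightarrow> arr s ''Lo'' i \<le> nxt i \<and> nxt i < n \<and> S ! nxt i = c"
      "\<And>i p. i < k \<Longrightarrow> arr s ''Lo'' i \<le> p \<Longrightarrow> p < nxt i \<Longrightarrow> S ! p \<noteq> c"
  shows "wp w advance (\<lambda>t s'. t \<le> 60 * (\<Sum>i<k. Suc (nxt i) - arr s ''Lo'' i) + 10 \<and>
      (\<forall>i<k. arr s' ''Lo'' i = Suc (nxt i) \<and> arr s' ''q'' i = Suc (nxt i))) s"
proof -
  define \<delta> where "\<delta> i = Suc (nxt i) - arr s ''Lo'' i" for i
  note [simp] = baseD[OF s]
  show ?thesis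
    unfolding advance_def wp_Seq wp_Assign
  apply (rule wp_While[where I = "\<lambda>s'. frame {''i''} {''Lo'', ''q''} s s' \<and> reg s' ''i'' \<le> k \<and>
      (\<forall>i<reg s' ''i''. arr s' ''Lo'' i = Suc (nxt i) \<and> arr s' ''q'' i = Suc (nxt i)) \<and>
      (\<forall>i<k. reg s' ''i'' \<le> i \<longrightarrow> arr s' ''Lo'' i = arr s ''Lo'' i)" and
      \<phi> = "\<lambda>s'. \<Sum>i\<in>{reg s' ''i''..<k}. 60 * \<delta> i"])
  subgoal by (simp add: frame_def)
  subgoal premises prems for s'
  proof -
    note fr = prems(1)[THEN conjunct1]
    note [simp] = frameD[OF fr]
    define i where "i = reg s' ''i''"
    have i: "i < k" "Suc i mod 2 ^ w = Suc i" using prems k_le word_lin by (auto simp: i_def)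
    have Lo: "arr s' ''Lo'' i = arr s ''Lo'' i" using prems i by (simp add: i_def)
    note nx = nxt(1)[OF i(1)]
    have sum: "(\<Sum>i\<in>{i..<k}. 60 * \<delta> i) = 60 * \<delta> i + (\<Sum>i\<in>{Suc i..<k}. 60 * \<delta> i)"
      using i(1) by (simp add: sum.atLeast_Suc_lessThan)
    show ?thesis
      unfolding wp_Seq
    apply (rule wp_While[where I = "\<lambda>s''. (\<exists>v. s'' = s'\<lparr>arr := (arr s')(''Lo'' := (arr s' ''Lo'')(i := v))\<rparr> \<and>
        arr s ''Lo'' i \<le> v \<and> v \<le> nxt i)" and \<phi> = "\<lambda>s''. 20 * (nxt i - arr s'' ''Lo'' i)"])
    subgoal
      using nx by (intro exI[of _ "arr s ''Lo'' i"]) (simp flip: Lo)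
    subgoal premises prems' for s''
    proof -
      from prems'(1) obtain v where v: "s'' = s'\<lparr>arr := (arr s')(''Lo'' := (arr s' ''Lo'')(i := v))\<rparr>"
        "arr s ''Lo'' i \<le> v" "v \<le> nxt i" by blast
      have "v < n" using v(3) nx by simp
      then have "v \<noteq> nxt i" using prems'(2) v nx by (auto simp: i_def[symmetric] c)
      moreover have "Suc v mod 2 ^ w = Suc v" using \<open>v < n\<close> word_lin by simp
      ultimately show ?thesis using v
        by (auto simp: i_def[symmetric] intro!: exI[of _ "Suc v"])
    qed
    subgoal premises prems' for t s''
    proof -
      from prems'(1) obtain v where v: "s'' = s'\<lparr>arr := (arr s')(''Lo'' := (arr s' ''Lo'')(i := v))\<rparr>"
        "arr s ''Lo'' i \<le> v" "v \<le> nxt i" by blast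
      have vn: "v < n" using v(3) nx by simp
      then have "S ! v = c" using prems'(2) v by (auto simp: i_def[symmetric] c)
      then have "v = nxt i" using v nxt(2)[OF i(1), of v] by (metis le_neq_implies_less)
      moreover have "Suc v mod 2 ^ w = Suc v" using vn word_lin by simp
      moreover have "t \<le> 20 * \<delta> i" using prems'(3) Lo nx by (simp add: \<delta>_def Suc_diff_le)
      moreover have "1 \<le> \<delta> i" using nx by (simp add: \<delta>_def Suc_diff_le)
      ultimately show ?thesis using prems(1) i v(1)
        by (auto simp: i_def[symmetric] frame_def sum less_Suc_eq)
    qed
    done
  qed
  subgoal premises prems for t s'
  proof -
    have "reg s' ''i'' = k" using prems frame_reg[OF prems(1)[THEN conjunct1], of "''k''"] by simp
    then show ?thesis using prems
      by (simp add: \<delta>_def sum_distrib_left atLeast0LessThan)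
  qed
  done
qed


lemma stack_row: "stack hi z s \<Longrightarrow> i < k \<Longrightarrow> rightmost S (hi i) (rev z) (arr s ''HI'' (length z * k + i))"
  by (auto simp: stack_def)

lemma stack_cong:
  "stack hi z s \<Longrightarrow> reg s' ''d'' = reg s ''d'' \<Longrightarrow> arr s' ''St'' = arr s ''St'' \<Longrightarrow>
   arr s' ''HI'' = arr s ''HI'' \<Longrightarrow> stack hi z s'"
  by (simp add: stack_def)

lemma stack_pop:
  assumes "stack hi (z @ [y]) s" "reg s' ''d'' = length z" "arr s' ''St'' = arr s ''St''"
    "arr s' ''HI'' = arr s ''HI''"
  shows "stack hi z s'"
  unfolding stack_def
proof (intro conjI allI impI)
  fix j assume "j < length z"
  then show "arr s' ''St'' j = z ! j" using assms by (auto simp: stack_def nth_append)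
next
  fix j i assume "j \<le> length z" "i < k"
  then show "rightmost S (hi i) (rev (take j z)) (arr s' ''HI'' (j * k + i))"
    using assms stack_def[of hi "z @ [y]" s] by (metis butlast_snoc le_SucI length_append_singleton
      take_append diff_is_0_eq take_0 append_Nil2)
qed (use assms in simp)

section \<open>The extension loop and its amortized running time\<close>

definition run_inv ::
    "string \<Rightarrow> string \<Rightarrow> (nat \<Rightarrow> nat) \<Rightarrow> (nat \<Rightarrow> nat) \<Rightarrow> nat list \<Rightarrow> nat list \<Rightarrow> nat list \<Rightarrow> state \<Rightarrow> bool" where
  "run_inv a l lo hi W Y z s \<longleftrightarrow> base s \<and> stack hi z s \<and> holds a l Y s \<and>
     gap_inv S k lo hi W Y z (\<lambda>i. arr s ''HI'' (length z * k + i)) (arr s ''Lo'') (arr s ''q'')"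

definition closed :: "(nat \<Rightarrow> nat) \<Rightarrow> (nat \<Rightarrow> nat) \<Rightarrow> nat list \<Rightarrow> bool" where
  "closed lo hi Y \<longleftrightarrow> (\<forall>Y1 Y2. Y = Y1 @ Y2 \<longrightarrow> no_insertion S k lo hi Y1 Y2)"

abbreviation pot_of :: "(nat \<Rightarrow> nat) \<Rightarrow> state \<Rightarrow> nat" where
  "pot_of hi s \<equiv> potential k hi (arr s ''Lo'') (arr s ''q'') (reg s ''d'')"

lemma run_scan:
  assumes inv: "run_inv a l lo hi W Y z s" and al: "a \<in> {''Y'', ''V''}" "l \<in> {''lU'', ''lV''}"
    and m: "first_min k (\<lambda>i. arr s ''HI'' (length z * k + i) - arr s ''Lo'' i) (reg s ''mm'')"
    and q: "arr s ''q'' (reg s ''mm'') < arr s ''HI'' (length z * k + reg s ''mm'')"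
    and c: "reg s ''c'' = S ! arr s ''q'' (reg s ''mm'')"
  shows "wp w scan_step
     (\<lambda>t s'. t \<le> 80 * (k * lgn) + 40 \<and> pot_of hi s' + 1 \<le> pot_of hi s \<and>
        (\<exists>z. run_inv a l lo hi W Y z s')) s"
proof -
  have [simp]: "l \<noteq> ''d''" "l \<noteq> ''ok''" "l \<noteq> ''c''" "a \<noteq> ''HI''" "a \<noteq> ''St''" "a \<noteq> ''q''"
    "''q'' \<noteq> a" using al by auto
  define m where "m = reg s ''mm''"
  define c where "c = S ! arr s ''q'' m"
  have b: "base s" and st: "stack hi z s" and h: "holds a l Y s" and
    gi: "gap_inv S k lo hi W Y z (\<lambda>i. arr s ''HI'' (length z * k + i)) (arr s ''Lo'') (arr s ''q'')"
    using inv by (auto simp: run_inv_def)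
  have mk: "m < k" using m by (simp add: first_min_def m_def)
  have qn: "arr s ''q'' m < n" using q stack_row[OF st mk] rightmost_le by (fastforce simp: m_def)
  then have words: "arr s ''q'' m mod 2 ^ w = arr s ''q'' m"
    "Suc (arr s ''q'' m) mod 2 ^ w = Suc (arr s ''q'' m)" using word_lin by simp_all
  have d: "reg s ''d'' = length z" using st by (simp add: stack_def)
  show ?thesis
    unfolding scan_step_def wp_Seq wp_Assign
  apply (rule wp_frame[OF try_push[where c = c and hi = hi and z = z]])
  subgoal using b by simp
  subgoal using c by (simp add: c_def m_def)
  subgoal using qn by (simp add: c_def)
  subgoal using st by (simp add: stack_def)
  subgoal premises prems for t s'
  proof -
    note fr = prems(2)
    note [simp] = frameD[OF fr]
    have b': "base s'" using base_frame[OF b fr] by simp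
    have h': "holds a l Y s'" using holds_frame[OF h fr] al by auto
    have t: "t \<le> 80 * (k * lgn) + 20" using prems(1) by (simp add: mult.assoc)
    have mm: "reg s' ''mm'' = m" by (simp add: m_def)
    show ?thesis
    proof (cases "\<forall>i<k. emb S (arr s ''Lo'' i) (hi i) (c # rev z)")
      case True
      then have ok: "reg s' ''ok'' = 1" and st': "stack hi (z @ [c]) s'" using prems(1) by auto
      have d': "reg s' ''d'' = Suc (length z)" using st' by (simp add: stack_def)
      have row: "\<forall>i<k. rightmost S (hi i) (c # rev z) (arr s' ''HI'' (length (z @ [c]) * k + i))"
        using stack_row[OF st'] by simp
      note push = gap_inv_push[OF gi k_pos True row]
      let ?s = "s'\<lparr>arr := (arr s')(''q'' := (arr s ''q'')(m := arr s ''q'' m))\<rparr>"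
      have "stack hi (z @ [c]) ?s" using st' by (rule stack_cong) simp_all
      moreover have "holds a l Y ?s" using h' by (simp add: holds_def)
      ultimately have "run_inv a l lo hi W Y (z @ [c]) ?s"
        using push(1) b' unfolding run_inv_def by simp
      moreover have "pot_of hi ?s + 1 \<le> pot_of hi s"
        using push(2) by (simp add: d d')
      ultimately show ?thesis using t by (auto simp: mm ok words)
    next
      case False
      then have ok: "reg s' ''ok'' = 0" and st': "stack hi z s'" using prems(1) by auto
      have d': "reg s' ''d'' = length z" using st' by (simp add: stack_def)
      \<comment> \<open>A failed push may leave debris in the row above; that the current row is
        unchanged follows from the uniqueness of \<open>rightmost\<close> thresholds.\<close>
      have row: "i < k \<Longrightarrow> arr s' ''HI'' (length z * k + i) = arr s ''HI'' (length z * k + i)" for i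
        using stack_row[OF st'] stack_row[OF st] unfolding rightmost_def by (metis le_antisym order_refl)
      note fail = gap_inv_fail[OF gi m q False[unfolded c_def m_def], folded m_def]
      let ?s = "s'\<lparr>arr := (arr s')(''q'' := (arr s ''q'')(m := Suc (arr s ''q'' m)))\<rparr>"
      have "stack hi z ?s" using st' by (rule stack_cong) simp_all
      moreover have "holds a l Y ?s" using h' by (simp add: holds_def)
      moreover have "gap_inv S k lo hi W Y z (\<lambda>i. arr s' ''HI'' (length z * k + i)) (arr s ''Lo'')
          ((arr s ''q'')(m := Suc (arr s ''q'' m)))"
        using fail(1) row unfolding gap_inv_def first_min_def
        by (simp cong: conj_cong)
      ultimately have "run_inv a l lo hi W Y z ?s"
        using b' unfolding run_inv_def by simp
      moreover have "pot_of hi ?s + 1 \<le> pot_of hi s"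
        using fail(2) by (simp add: d d')
      ultimately show ?thesis using t by (auto simp: mm ok words)
    qed
  qed
  done
qed

text \<open>A single pop can take long, since the left bounds move by arbitrary distances. Its cost
  is therefore stated relative to the potential, which falls by at least the total distance.\<close>

lemma run_pop:
  assumes inv: "run_inv a l lo hi W Y (z @ [y]) s" and al: "a \<in> {''Y'', ''V''}" "l \<in> {''lU'', ''lV''}"
    and m: "first_min k (\<lambda>i. arr s ''HI'' (length (z @ [y]) * k + i) - arr s ''Lo'' i) (reg s ''mm'')"
    and q: "\<not> arr s ''q'' (reg s ''mm'') < arr s ''HI'' (length (z @ [y]) * k + reg s ''mm'')"
  shows "wp w (pop_step a l)
     (\<lambda>t s'. t + pot_of hi s' * (80 * (k * lgn)) \<le> pot_of hi s * (80 * (k * lgn)) + 40 \<and>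
        pot_of hi s' + 1 \<le> pot_of hi s \<and>
        run_inv a l lo hi W (Y @ [y]) z s') s"
proof -
  have al' [simp]: "l \<noteq> ''d''" "l \<noteq> ''ok''" "l \<noteq> ''c''" "a \<noteq> ''HI''" "a \<noteq> ''St''" "a \<noteq> ''q''" "a \<noteq> ''Lo''"
    "''q'' \<noteq> a" "''c'' \<noteq> l" "''Lo'' \<noteq> a" "''HI'' \<noteq> a" "''St'' \<noteq> a" "a \<noteq> ''S''" "''S'' \<noteq> a" "''d'' \<noteq> l"
    "l \<noteq> ''len_S''" "l \<noteq> ''k''" "l \<noteq> ''i''" "a \<notin> {''S'', ''cnt'', ''f'', ''occ''}"
    "a \<noteq> ''cnt''" "a \<noteq> ''f''" "a \<noteq> ''occ''"
    using al by auto
  let ?H = "\<lambda>i. arr s ''HI'' (length (z @ [y]) * k + i)" and ?Lo = "arr s ''Lo''"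
  have b: "base s" and st: "stack hi (z @ [y]) s" and h: "holds a l Y s" and
    gi: "gap_inv S k lo hi W Y (z @ [y]) ?H ?Lo (arr s ''q'')"
    using inv by (auto simp: run_inv_def)
  have d: "reg s ''d'' = Suc (length z)" "arr s ''St'' (length z) = y" using st by (auto simp: stack_def)
  have "length Y \<le> n" using gap_inv_emb(2)[OF gi k_pos] emb_length emb_le
    by (metis add_leD1 diff_le_self length_append le_trans)
  then have words: "Suc (length Y) mod 2 ^ w = Suc (length Y)" using word_lin by simp
  define nxt where "nxt i = (LEAST p. ?Lo i \<le> p \<and> S ! p = y)" for i
  have nxt: "?Lo i \<le> nxt i \<and> nxt i < n \<and> S ! nxt i = y"
    "\<And>p. ?Lo i \<le> p \<Longrightarrow> p < nxt i \<Longrightarrow> S ! p \<noteq> y" if "i < k" for i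
  proof -
    from gap_inv_emb(1)[OF gi that] obtain p where p: "?Lo i \<le> p" "p < hi i" "S ! p = y" by auto
    have "hi i \<le> n" using gap_inv_height[OF gi that] by simp
    moreover have "nxt i \<le> p" unfolding nxt_def using p by (intro Least_le) simp
    ultimately show "?Lo i \<le> nxt i \<and> nxt i < n \<and> S ! nxt i = y"
      using LeastI[of "\<lambda>p. ?Lo i \<le> p \<and> S ! p = y" p] p unfolding nxt_def by auto
    fix p' assume "?Lo i \<le> p'" "p' < nxt i"
    then show "S ! p' \<noteq> y" using not_less_Least[of p' "\<lambda>p. ?Lo i \<le> p \<and> S ! p = y"]
      unfolding nxt_def by blast
  qed
  let ?s = "s\<lparr>arr := (arr s)(a := (arr s a)(length Y := y)),
      reg := (reg s)(''d'' := length z, ''c'' := y, l := Suc (length Y))\<rparr>"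
  define K where "K = 80 * (k * lgn)"
  have K: "60 \<le> K" using k_lgn(2) unfolding K_def by linarith
  have l: "reg s l = length Y" using h by (simp add: holds_def)
  have adv: "wp w advance (\<lambda>t s'. t \<le> 60 * (\<Sum>i<k. Suc (nxt i) - ?Lo i) + 10 \<and>
      (\<forall>i<k. arr s' ''Lo'' i = Suc (nxt i) \<and> arr s' ''q'' i = Suc (nxt i))) ?s"
    using advance[of ?s y nxt] b nxt by simp
  show ?thesis
    unfolding pop_step_def wp_Seq wp_Assign wp_Store K_def[symmetric]
  apply (simp add: d l words)
  apply (rule wp_frame[OF adv])
  subgoal premises prems for t s'
  proof -
    note fr = prems(2)
    note [simp] = frameD[OF fr]
    have b': "base s'" using base_frame[OF _ fr] b by simp
    have st': "stack hi z s'" using st by (rule stack_pop) simp_all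
    have h': "holds a l (Y @ [y]) s'" using h by (auto simp: holds_def nth_append less_Suc_eq)
    have Lo': "arr s' ''Lo'' i = Suc (nxt i) \<and> arr s' ''q'' i = Suc (nxt i)" if "i < k" for i
      using prems(1) that by blast
    have H': "\<forall>i<k. rightmost S (hi i) (rev z) (arr s' ''HI'' (length z * k + i))"
      using stack_row[OF st'] by blast
    note pop = gap_inv_pop[OF gi m leI[OF q] nxt Lo' H']
    define \<delta> where "\<delta> = (\<Sum>i<k. Suc (nxt i) - ?Lo i)"
    have "Suc (nxt 0) - ?Lo 0 \<le> \<delta>" unfolding \<delta>_def using k_pos by (intro member_le_sum) auto
    then have "1 \<le> \<delta>" using nxt(1)[OF k_pos] by linarith
    moreover have d': "reg s' ''d'' = length z" by simp
    have pot: "pot_of hi s' + \<delta> \<le> pot_of hi s"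
      using pop(2) unfolding \<delta>_def d d' by simp
    moreover have "60 * \<delta> + pot_of hi s' * K \<le> pot_of hi s * K"
    proof -
      have "60 * \<delta> \<le> \<delta> * K" using K by simp
      then have "60 * \<delta> + pot_of hi s' * K \<le>
          (pot_of hi s' + \<delta>) * K" by (simp only: add_mult_distrib)
      also have "\<dots> \<le> pot_of hi s * K" using pot by (rule mult_le_mono1)
      finally show ?thesis .
    qed
    moreover have "run_inv a l lo hi W (Y @ [y]) z s'"
      unfolding run_inv_def using b' st' h' pop(1) by simp
    moreover have "t \<le> 60 * \<delta> + 10" using prems(1) by (simp add: \<delta>_def)
    ultimately show ?thesis by (simp add: d)
  qed
  done
qed


lemma run_inv_cong:
  assumes "run_inv a l lo hi W Y z s" "frame X A s s'"
    "X \<inter> {''len_S'', ''k'', ''d'', l} = {}"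
    "A \<inter> {''S'', ''cnt'', ''f'', ''occ'', ''St'', ''HI'', ''Lo'', ''q'', a} = {}"
  shows "run_inv a l lo hi W Y z s'"
proof -
  have "base s'" using assms base_frame[OF _ assms(2)] by (auto simp: run_inv_def)
  moreover have "holds a l Y s'" using assms holds_frame[OF _ assms(2)] by (auto simp: run_inv_def)
  moreover have "stack hi z s'"
    by (rule stack_cong[of hi z s])
      (use assms(1,3,4) frameD[OF assms(2)] in \<open>auto simp: run_inv_def\<close>)
  moreover have "arr s' ''HI'' = arr s ''HI''" "arr s' ''Lo'' = arr s ''Lo''" "arr s' ''q'' = arr s ''q''"
    using assms(4) frame_arr[OF assms(2)] by auto
  ultimately show ?thesis using assms(1) unfolding run_inv_def by simp
qed

text \<open>The additional 1 pays for the last round, which only sets \<open>fin\<close>. The factor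
  300 covers \<open>argmin\<close>, the tests in the program, and one call of
  \<open>try_push\<close>.\<close>

definition run_potential :: "(nat \<Rightarrow> nat) \<Rightarrow> state \<Rightarrow> nat" where
  "run_potential hi s =
    (if reg s ''fin'' = 0 then 300 * (k * lgn) * (pot_of hi s + 1) else 0)"

definition run_loop_inv ::
    "string \<Rightarrow> string \<Rightarrow> (nat \<Rightarrow> nat) \<Rightarrow> (nat \<Rightarrow> nat) \<Rightarrow> nat list \<Rightarrow> state \<Rightarrow> bool" where
  "run_loop_inv a l lo hi W s \<longleftrightarrow> (\<exists>Y z. run_inv a l lo hi W Y z s \<and>
     (reg s ''fin'' \<noteq> 0 \<longrightarrow> z = [] \<and> closed lo hi Y))"

lemma run_step:
  assumes inv: "run_inv a l lo hi W Y z s" and fin: "reg s ''fin'' = 0"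
    and al: "a \<in> {''Y'', ''V''}" "l \<in> {''lU'', ''lV''}"
  shows "wp w (run_step a l)
    (\<lambda>t s'. run_loop_inv a l lo hi W s' \<and> t + 10 + run_potential hi s' \<le> run_potential hi s) s"
proof -
  have al' [simp]: "l \<noteq> ''d''" "l \<noteq> ''c''" "l \<noteq> ''mm''" "l \<noteq> ''i''" "l \<noteq> ''fin''" "''fin'' \<noteq> l"
    "''d'' \<noteq> l" "l \<noteq> ''k''" "l \<noteq> ''len_S''" "''i'' \<noteq> l" using al by auto
  define x where "x = k * lgn"
  have x: "k \<le> x" "1 \<le> x" using k_lgn by (auto simp: x_def)
  have pot_x: "run_potential hi s =
    (if reg s ''fin'' = 0 then 300 * x * (pot_of hi s + 1) else 0)" for s
    by (simp add: run_potential_def x_def)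
  have b: "base s" and st: "stack hi z s" and gi:
    "gap_inv S k lo hi W Y z (\<lambda>i. arr s ''HI'' (length z * k + i)) (arr s ''Lo'') (arr s ''q'')"
    using inv by (auto simp: run_inv_def)
  have d: "reg s ''d'' = length z" using st by (simp add: stack_def)
  note [simp] = baseD[OF b]
  show ?thesis
    unfolding run_step_def wp_Seq
  apply (rule wp_frame[OF argmin[OF b st]])
  subgoal premises prems for t1 s1
  proof -
    note fr = prems(2)
    note [simp] = frameD[OF fr]
    have t1: "t1 \<le> 60 * x + 10" using prems(1) x by auto
    define m where "m = reg s1 ''mm''"
    have m: "first_min k (\<lambda>i. arr s ''HI'' (length z * k + i) - arr s ''Lo'' i) m"
      using prems(1) by (simp add: m_def)
    have mk: "m < k" using m by (simp add: first_min_def)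
    have inv1: "run_inv a l lo hi W Y z s1" using run_inv_cong[OF inv fr] al by auto
    have words: "length z * k mod 2 ^ w = length z * k"
      "(length z * k + m) mod 2 ^ w = length z * k + m"
      using row_word[OF stack_length[OF st], of 0] row_word[OF stack_length[OF st], of m]
        mk k_le by auto
    have pot1: "pot_of hi s1 = pot_of hi s" by simp
    show ?thesis
    proof (cases "arr s ''q'' m < arr s ''HI'' (length z * k + m)")
      case True
      have hn: "arr s ''HI'' (length z * k + m) \<le> n"
        using rightmost_le[OF stack_row[OF st mk]] by simp
      let ?s = "s1\<lparr>reg := (reg s1)(''c'' := S ! arr s ''q'' m)\<rparr>"
      have fr2: "frame {''c''} {} s1 ?s" by (simp add: frame_def)
      have inv2: "run_inv a l lo hi W Y z ?s" using run_inv_cong[OF inv1 fr2] al by auto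
      have scan: "wp w scan_step
        (\<lambda>t s'. t \<le> 80 * x + 40 \<and> pot_of hi s' + 1 \<le> pot_of hi ?s \<and>
          (\<exists>z. run_inv a l lo hi W Y z s')) ?s"
        unfolding x_def by (rule run_scan[OF inv2 al]) (use m True in \<open>simp_all add: m_def\<close>)
      have step: "wp w scan_step (\<lambda>t s'. run_loop_inv a l lo hi W s' \<and>
        t1 + t + 40 + run_potential hi s' \<le> run_potential hi s) ?s"
      proof (rule wp_frame[OF scan])
        fix t s' assume *: "t \<le> 80 * x + 40 \<and> pot_of hi s' + 1 \<le> pot_of hi ?s \<and>
          (\<exists>z. run_inv a l lo hi W Y z s')" and fr3: "frame (rmods scan_step) (amods scan_step) ?s s'"
        have fin2: "reg s' ''fin'' = 0" using frame_reg[OF fr3, of "''fin''"] fin by simp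
        have "pot_of hi s' + 1 \<le> pot_of hi s" using * by simp
        then have "300 * x * (pot_of hi s' + 1 + 1) \<le> 300 * x * (pot_of hi s + 1)"
          by (intro mult_le_mono2) simp
        then have "300 * x * (pot_of hi s' + 1) + 300 * x \<le> 300 * x * (pot_of hi s + 1)"
          by (simp only: add_mult_distrib2 mult_1_right)
        then have "t1 + t + 40 + run_potential hi s' \<le> run_potential hi s"
          using * t1 x fin fin2 by (simp add: pot_x)
        then show "run_loop_inv a l lo hi W s' \<and> t1 + t + 40 + run_potential hi s' \<le> run_potential hi s"
          using * fin2 by (auto simp: run_loop_inv_def)
      qed
      show ?thesis
        using True hn by (simp add: d words flip: m_def) (rule wp_mono[OF step], auto)
    next
      case False
      show ?thesis
      proof (cases "z = []")
        case True
        let ?s = "s1\<lparr>reg := (reg s1)(''fin'' := Suc 0)\<rparr>"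
        have fr2: "frame {''fin''} {} s1 ?s" by (simp add: frame_def)
        have inv2: "run_inv a l lo hi W Y [] ?s" using run_inv_cong[OF inv1 fr2] al True by auto
        have "closed lo hi Y" unfolding closed_def
          using gap_inv_final[OF gi[unfolded True], of m] m False True by simp
        then have "run_loop_inv a l lo hi W ?s" using inv2 by (auto simp: run_loop_inv_def)
        moreover have "t1 + 40 + run_potential hi ?s \<le> run_potential hi s"
        proof -
          have "300 * x * 1 \<le> 300 * x * (pot_of hi s + 1)" by (intro mult_le_mono2) simp
          then show ?thesis using t1 x fin by (simp add: pot_x)
        qed
        ultimately show ?thesis using False True words by (simp add: d flip: m_def)
      next
        case ne: False
        then obtain z' y where z: "z = z' @ [y]" by (cases z rule: rev_cases) auto
        have pop: "wp w (pop_step a l)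
          (\<lambda>t s'. t + pot_of hi s' * (80 * x) \<le> pot_of hi s1 * (80 * x) + 40 \<and>
           pot_of hi s' + 1 \<le> pot_of hi s1 \<and> run_inv a l lo hi W (Y @ [y]) z' s') s1"
          unfolding x_def by (rule run_pop[OF inv1[unfolded z] al])
            (use m False in \<open>simp_all add: z m_def\<close>)
        have step: "wp w (pop_step a l) (\<lambda>t s'. run_loop_inv a l lo hi W s' \<and>
          t1 + t + 40 + run_potential hi s' \<le> run_potential hi s) s1"
        proof (rule wp_frame[OF pop])
          fix t s' assume *: "t + pot_of hi s' * (80 * x) \<le> pot_of hi s1 * (80 * x) + 40 \<and>
            pot_of hi s' + 1 \<le> pot_of hi s1 \<and> run_inv a l lo hi W (Y @ [y]) z' s'"
            and fr3: "frame (rmods (pop_step a l)) (amods (pop_step a l)) s1 s'"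
          have fin2: "reg s' ''fin'' = 0" using frame_reg[OF fr3, of "''fin''"] fin by simp
          obtain e where e: "pot_of hi s = pot_of hi s' + 1 + e"
            using * pot1 le_Suc_ex by metis
          have "t \<le> 80 * x + e * (80 * x) + 40"
            using * unfolding pot1 e by (simp add: add_mult_distrib)
          then have "t1 + t + 40 + 300 * x * (pot_of hi s' + 1) \<le>
            300 * x * (pot_of hi s + 1)"
            using t1 x unfolding e by (simp add: add_mult_distrib add_mult_distrib2 mult.commute)
          then have "t1 + t + 40 + run_potential hi s' \<le> run_potential hi s"
            using fin fin2 by (simp only: pot_x if_P)
          then show "run_loop_inv a l lo hi W s' \<and> t1 + t + 40 + run_potential hi s' \<le> run_potential hi s"
            using * fin2 by (auto simp: run_loop_inv_def)
        qed
        show ?thesis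
          using False ne by (simp add: d words flip: m_def) (rule wp_mono[OF step], auto)
      qed
    qed
  qed
  done
qed

text \<open>Besides the extended string, the loop leaves in \<open>Lo\<close> the ends of its
  leftmost embeddings. After \<open>V\<close> has been extended, these are the left ends of the
  windows for \<open>U\<close>.\<close>

lemma run:
  assumes s: "base s" and st: "stack hi (rev W) s" and emb: "\<forall>i<k. emb S (arr s ''Lo'' i) (hi i) W"
    and al: "a \<in> {''Y'', ''V''}" "l \<in> {''lU'', ''lV''}"
  shows "wp w (run a l) (\<lambda>t s'. t \<le> 300 * (k * lgn) * (4 * (\<Sum>i<k. hi i - arr s ''Lo'' i) + 2) \<and>
     (\<exists>Y. holds a l Y s' \<and> subseq W Y \<and> closed (arr s ''Lo'') hi Y \<and>
        (\<forall>i<k. leftmost S (arr s ''Lo'' i) Y (arr s' ''Lo'' i)) \<and>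
        (\<forall>i<k. emb S (arr s ''Lo'' i) (hi i) Y))) s"
proof -
  have al' [simp]: "l \<noteq> ''d''" "l \<noteq> ''fin''" "''fin'' \<noteq> l" "l \<noteq> ''k''" "l \<noteq> ''len_S''" "l \<noteq> ''i''"
    "''d'' \<noteq> l" using al by auto
  define lo where "lo = arr s ''Lo''"
  define x where "x = k * lgn"
  have x: "k \<le> x" "1 \<le> x" using k_lgn by (auto simp: x_def)
  have pot_x: "run_potential hi s =
    (if reg s ''fin'' = 0 then 300 * x * (pot_of hi s + 1) else 0)" for s
    by (simp add: run_potential_def x_def)
  have "base (s\<lparr>reg := (reg s)(l := 0, ''fin'' := 0)\<rparr>)" using s by simp
  then have reset: "wp w (fill ''q'' (Read ''Lo'' (Reg ''i''))) (\<lambda>t s'. t \<le> 22 * k + 10 \<and>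
      (\<forall>i<k. arr s' ''q'' i = lo i)) (s\<lparr>reg := (reg s)(l := 0, ''fin'' := 0)\<rparr>)"
    by (rule wp_mono[OF fill[where g = lo]]) (auto simp: frame_arr lo_def)
  show ?thesis
    unfolding run_def wp_Seq wp_Assign x_def[symmetric]
  apply simp
  apply (rule wp_frame[OF reset])
  subgoal premises prems for t0 s0
  proof -
    note fr0 = prems(2)
    note [simp] = frameD[OF fr0]
    have b0: "base s0" using base_frame[OF _ fr0] s by simp
    have st0: "stack hi (rev W) s0" using st by (rule stack_cong) simp_all
    have row: "\<forall>i<k. rightmost S (hi i) (rev (rev W)) (arr s0 ''HI'' (length (rev W) * k + i))"
      using stack_row[OF st0] by simp
    have inv0: "run_inv a l lo hi W [] (rev W) s0"
      unfolding run_inv_def using b0 st0 gap_inv_init[OF row, of lo "arr s0 ''q''"] emb prems(1)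
      by (simp add: holds_def lo_def)
    have pot0: "pot_of hi s0 \<le> 4 * (\<Sum>i<k. hi i - arr s ''Lo'' i)"
      unfolding potential_def sum_distrib_left by (intro sum_mono) simp
    show ?thesis
    apply (rule wp_While[where I = "run_loop_inv a l lo hi W" and \<phi> = "run_potential hi"])
    subgoal using inv0 by (auto simp: run_loop_inv_def)
    subgoal premises prems' for s'
    proof -
      from prems' obtain Y z where "run_inv a l lo hi W Y z s'" "reg s' ''fin'' = 0"
        by (auto simp: run_loop_inv_def)
      from run_step[OF this al] show ?thesis by (rule wp_mono) simp
    qed
    subgoal premises prems' for t s'
    proof -
      from prems'(1,2) obtain Y where inv: "run_inv a l lo hi W Y [] s'" and cl: "closed lo hi Y"
        by (auto simp: run_loop_inv_def)
      have gi: "gap_inv S k lo hi W Y [] (\<lambda>i. arr s' ''HI'' (length ([] :: nat list) * k + i))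
        (arr s' ''Lo'') (arr s' ''q'')" and h: "holds a l Y s'" using inv by (auto simp: run_inv_def)
      have "t \<le> 300 * x * (pot_of hi s0 + 1) + 4"
        using prems' by (simp add: pot_x)
      also have "\<dots> \<le> 300 * x * (4 * (\<Sum>i<k. hi i - arr s ''Lo'' i) + 1) + 4"
        using pot0 by (intro add_mono mult_le_mono2) auto
      finally have "t + t0 + 20 \<le> 300 * x * (4 * (\<Sum>i<k. hi i - arr s ''Lo'' i) + 2)"
        using prems(1) x by (simp add: add_mult_distrib2)
      moreover have "\<forall>i<k. leftmost S (arr s ''Lo'' i) Y (arr s' ''Lo'' i)"
        using gap_invD(1)[OF gi] by (simp add: lo_def)
      moreover have "\<forall>i<k. emb S (arr s ''Lo'' i) (hi i) Y"
        using gap_inv_emb(2)[OF gi] by (simp add: lo_def)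
      moreover have "subseq W Y" using gap_invD(4)[OF gi] by simp
      ultimately show ?thesis using h cl by (auto simp: lo_def)
    qed
    done
  qed
  done
qed

end

section \<open>Treating one choice of pins\<close>

text \<open>
  Window \<open>i < k - 1\<close> lies between the pins \<open>i\<close> and \<open>i + 1\<close>. The last window is the part of \<open>S\<close> before
  the first pin when \<open>U\<close> is extended, and the part after the last pin when \<open>V\<close> is extended.
\<close>

definition win_end :: "nat \<Rightarrow> (nat \<Rightarrow> nat) \<Rightarrow> nat \<Rightarrow> nat" where
  "win_end k p i = (if i = k - 1 then p 0 else p (Suc i))"

definition zero_last :: "nat \<Rightarrow> (nat \<Rightarrow> nat) \<Rightarrow> nat \<Rightarrow> nat" where
  "zero_last k l i = (if i = k - 1 then 0 else l i)"

definition len_last :: "'a list \<Rightarrow> nat \<Rightarrow> (nat \<Rightarrow> nat) \<Rightarrow> nat \<Rightarrow> nat" where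
  "len_last S k h i = (if i = k - 1 then length S else h i)"

lemma fits_windows_U:
  assumes "0 < k" "fits S k p U V" "i < k"
  shows "emb S (zero_last k (\<lambda>i. Suc (p i)) i) (win_end k p i) U"
proof (cases "i = k - 1")
  case True
  then show ?thesis using assms by (simp add: fits_def zero_last_def win_end_def)
next
  case False
  then have "emb S (Suc (p i)) (p (Suc i)) (V @ U)" using assms by (simp add: fits_def)
  then show ?thesis using False by (auto simp: zero_last_def win_end_def emb_append emb_le
    intro: emb_antimono dest: emb_le)
qed

text \<open>Packing \<open>U\<close> as far to the right as possible leaves the most room for
  \<open>V\<close>, so the joint conditions on \<open>V @ U\<close> become separate conditions on
  \<open>V\<close> in windows ending at \<open>h i\<close>.\<close>

lemma fits_iff_V:
  assumes "0 < k"
    and U: "\<And>i. i < k \<Longrightarrow> emb S (zero_last k (\<lambda>i. Suc (p i)) i) (win_end k p i) U"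
    and h: "\<And>i. i < k \<Longrightarrow> rightmost S (win_end k p i) U (h i)"
  shows "fits S k p U V \<longleftrightarrow> (\<forall>i<k. emb S (Suc (p i)) (len_last S k h i) V)"
proof -
  have U0: "emb S 0 (p 0) U" using U[of "k - 1"] assms(1) by (simp add: zero_last_def win_end_def)
  have eq: "emb S (Suc (p i)) (p (Suc i)) (V @ U) \<longleftrightarrow> emb S (Suc (p i)) (h i) V" if "Suc i < k" for i
  proof -
    have "i \<noteq> k - 1" "i < k" using that by auto
    then show ?thesis using emb_append_rightmost[OF h[of i]] by (simp add: win_end_def)
  qed
  show ?thesis
  proof
    assume "fits S k p U V"
    then show "\<forall>i<k. emb S (Suc (p i)) (len_last S k h i) V"
      using eq unfolding fits_def len_last_def
      by (metis Suc_lessI Suc_pred' assms(1) diff_Suc_1)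
  next
    assume *: "\<forall>i<k. emb S (Suc (p i)) (len_last S k h i) V"
    have "emb S (Suc (p (k - 1))) (length S) V" using * assms(1) by (auto simp: len_last_def dest!: spec[of _ "k - 1"])
    moreover have "emb S (Suc (p i)) (h i) V" if "Suc i < k" for i
    proof -
      have "i \<noteq> k - 1" "i < k" using that by auto
      then show ?thesis using * by (auto simp: len_last_def dest!: spec[of _ i])
    qed
    ultimately show "fits S k p U V" using U0 eq by (auto simp: fits_def)
  qed
qed

lemma fits_iff_U:
  assumes "0 < k"
    and l: "\<And>i. i < k \<Longrightarrow> leftmost S (Suc (p i)) V (l i)"
    and V: "emb S (Suc (p (k - 1))) (length S) V"
  shows "fits S k p U V \<longleftrightarrow> (\<forall>i<k. emb S (zero_last k l i) (win_end k p i) U)"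
proof -
  have eq: "emb S (Suc (p i)) (p (Suc i)) (V @ U) \<longleftrightarrow> emb S (l i) (p (Suc i)) U" if "i < k" for i
    using emb_append_leftmost[OF l[OF that]] .
  show ?thesis
  proof
    assume f: "fits S k p U V"
    show "\<forall>i<k. emb S (zero_last k l i) (win_end k p i) U"
    proof (intro allI impI)
      fix i assume "i < k"
      then show "emb S (zero_last k l i) (win_end k p i) U"
        using f eq[of i] by (cases "i = k - 1") (auto simp: fits_def zero_last_def win_end_def)
    qed
  next
    assume *: "\<forall>i<k. emb S (zero_last k l i) (win_end k p i) U"
    have "emb S 0 (p 0) U" using *[rule_format, of "k - 1"] assms(1)
      by (simp add: zero_last_def win_end_def)
    moreover have "emb S (l i) (p (Suc i)) U" if "Suc i < k" for i
    proof -
      have "i \<noteq> k - 1" "i < k" using that by auto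
      then show ?thesis using *[rule_format, of i] by (simp add: zero_last_def win_end_def)
    qed
    ultimately show "fits S k p U V" using V eq by (auto simp: fits_def)
  qed
qed

lemma telescope:
  fixes p :: "nat \<Rightarrow> nat"
  assumes "\<And>i. i < j \<Longrightarrow> p i \<le> p (Suc i)"
  shows "(\<Sum>i<j. p (Suc i) - p i) + p 0 = p j"
  using assms by (induction j) fastforce+

text \<open>The windows are disjoint, and their lengths telescope along the pins. Since the
  potential is a sum over the windows, this keeps the number of tests linear in \<open>n\<close> for
  every \<open>k\<close>.\<close>

lemma sum_win_end:
  assumes "0 < k" "\<And>i. Suc i < k \<Longrightarrow> p i < p (Suc i)" "p (k - 1) < N"
    and "\<And>i. Suc i < k \<Longrightarrow> p i < l i"
  shows "(\<Sum>i<k. win_end k p i - zero_last k l i) \<le> N"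
proof -
  obtain k' where k: "k = Suc k'" using assms(1) by (cases k) auto
  have "(\<Sum>i<k. win_end k p i - zero_last k l i) = (\<Sum>i<k'. p (Suc i) - l i) + p 0"
    unfolding k by (simp add: win_end_def zero_last_def)
  also have "\<dots> \<le> (\<Sum>i<k'. p (Suc i) - p i) + p 0"
    using assms(4) k by (intro add_mono sum_mono diff_le_mono2) (auto intro: less_imp_le)
  also have "\<dots> = p k'" using assms(2) k by (intro telescope) (auto intro: less_imp_le)
  finally show ?thesis using assms(3) k by simp
qed

lemma sum_len_last:
  assumes "0 < k" "\<And>i. Suc i < k \<Longrightarrow> p i < p (Suc i)" "p (k - 1) < length S"
    and "\<And>i. Suc i < k \<Longrightarrow> h i \<le> p (Suc i)"
  shows "(\<Sum>i<k. len_last S k h i - Suc (p i)) \<le> length S"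
proof -
  obtain k' where k: "k = Suc k'" using assms(1) by (cases k) auto
  have "(\<Sum>i<k. len_last S k h i - Suc (p i)) = (\<Sum>i<k'. h i - Suc (p i)) + (length S - Suc (p k'))"
    unfolding k by (simp add: len_last_def)
  also have "(\<Sum>i<k'. h i - Suc (p i)) \<le> (\<Sum>i<k'. p (Suc i) - p i)"
  proof (rule sum_mono)
    fix i assume "i \<in> {..<k'}"
    then have "h i \<le> p (Suc i)" using assms(4)[of i] k by simp
    then show "h i - Suc (p i) \<le> p (Suc i) - p i" by linarith
  qed
  also have "(\<Sum>i<k'. p (Suc i) - p i) + p 0 = p k'"
    using assms(2) k by (intro telescope) (auto intro: less_imp_le)
  then have "(\<Sum>i<k'. p (Suc i) - p i) \<le> p k'" by linarith
  finally show ?thesis using assms(3) k by simp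
qed

lemma pins_mono:
  assumes "pins S x m k r p" "nondecr k R r" "0 < m" "Suc i < k"
  shows "p i < p (Suc i)"
proof -
  have "count_list (take (p i) S) x = i * m + r i"
    "count_list (take (p (Suc i)) S) x = Suc i * m + r (Suc i)" "p i < length S" "S ! p i = x"
    using assms(1,4) by (auto simp: pins_def)
  moreover have "r i \<le> r (Suc i)" using assms(2,4) by (simp add: nondecr_def)
  ultimately have "count_list (take (p i) S) x < count_list (take (p (Suc i)) S) x"
    using assms(3) by simp
  then show ?thesis unfolding count_take_less_iff[OF \<open>p i < length S\<close> \<open>S ! p i = x\<close>] .
qed

text \<open>Maximality relative to fixed pins; it holds vacuously if the pins do not admit
  \<open>U\<close> and \<open>V\<close>. It survives further extension, which is why one visit to
  each choice suffices.\<close>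

definition blocked :: "'a list \<Rightarrow> nat \<Rightarrow> (nat \<Rightarrow> nat) \<Rightarrow> 'a list \<Rightarrow> 'a list \<Rightarrow> bool" where
  "blocked S k p U V \<longleftrightarrow> (\<forall>U' V'. subseq U U' \<longrightarrow> subseq V V' \<longrightarrow> fits S k p U' V' \<longrightarrow> U' = U \<and> V' = V)"

lemma not_fits_blocked: "\<not> fits S k p U V \<Longrightarrow> blocked S k p U V"
  unfolding blocked_def using fits_subseq by blast

lemma blocked_mono:
  "blocked S k p U V \<Longrightarrow> subseq U U' \<Longrightarrow> subseq V V' \<Longrightarrow> blocked S k p U' V'"
  unfolding blocked_def
proof (intro allI impI)
  fix U2 V2
  assume b: "\<forall>U' V'. subseq U U' \<longrightarrow> subseq V V' \<longrightarrow> fits S k p U' V' \<longrightarrow> U' = U \<and> V' = V"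
    and "subseq U U'" "subseq V V'" "subseq U' U2" "subseq V' V2" "fits S k p U2 V2"
  moreover from this have "U2 = U \<and> V2 = V" by (meson subseq_order.trans)
  ultimately show "U2 = U' \<and> V2 = V'" by (meson subseq_order.antisym)
qed

section \<open>Programs for one choice of pins\<close>

definition pin_loop :: com where
  "pin_loop = fill ''P'' (Read ''occ'' (Add (Mul (Read ''f'' (Reg ''sigma'')) (Reg ''len_S''))
     (Add (Mul (Reg ''i'') (Reg ''mu'')) (Read ''r'' (Reg ''i'')))))"

text \<open>The sweep reads the meaningless cell \<open>P[k]\<close> for the last window, which the
  next store corrects. Apart from its last cell \<open>Lo\<close> is taken as it stands, so the same
  code serves for \<open>Lo i = Suc (p i)\<close> and for the ends of the leftmost embeddings of
  \<open>V\<close>.\<close>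

definition set_windows_U :: com where
  "set_windows_U =
    fill ''HI'' (Read ''P'' (Add (Reg ''i'') (Const 1)));;
    Store ''HI'' (Sub (Reg ''k'') (Const 1)) (Read ''P'' (Const 0));;
    Store ''Lo'' (Sub (Reg ''k'') (Const 1)) (Const 0)"

text \<open>After \<open>U\<close> has been loaded, row \<open>d\<close> of \<open>HI\<close>
  describes its rightmost embeddings; copied to row 0, it supplies the right ends of the windows for
  \<open>V\<close>.\<close>

definition set_windows_V :: com where
  "set_windows_V =
    fill ''HI'' (Read ''HI'' (Add (Mul (Reg ''d'') (Reg ''k'')) (Reg ''i'')));;
    fill ''Lo'' (Add (Read ''P'' (Reg ''i'')) (Const 1));;
    Store ''HI'' (Sub (Reg ''k'') (Const 1)) (Reg ''len_S'')"

definition extend :: com where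
  "extend =
    run ''V'' ''lV'';;
    set_windows_U;;
    load ''Y'' ''lU'';;
    run ''Y'' ''lU''"

definition process :: com where
  "process =
    pin_loop;;
    fill ''Lo'' (Add (Read ''P'' (Reg ''i'')) (Const 1));;
    set_windows_U;;
    load ''Y'' ''lU'';;
    If (Equal (Reg ''ok'') (Const 1))
      (set_windows_V;;
       load ''V'' ''lV'';;
       If (Equal (Reg ''ok'') (Const 1)) extend (''ok'' ::= Const 0))
      (''ok'' ::= Const 0)"

lemma pin_loop_mods [simp]: "rmods pin_loop = {''i''}" "amods pin_loop = {''P''}"
  by (auto simp: pin_loop_def)

lemma set_windows_mods [simp]:
  "rmods set_windows_U = {''i''}" "amods set_windows_U = {''HI'', ''Lo''}"
  "rmods set_windows_V = {''i''}" "amods set_windows_V = {''HI'', ''Lo''}"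
  by (auto simp: set_windows_U_def set_windows_V_def)

lemma extend_mods [simp]:
  "rmods extend = {''lU'', ''lV'', ''fin'', ''mm'', ''j'', ''c'', ''d'', ''ok'', ''i'', ''h'', ''a'', ''b'', ''m'', ''p''}"
  "amods extend = {''Y'', ''V'', ''q'', ''HI'', ''St'', ''Lo''}"
  by (auto simp: extend_def)

lemma process_mods [simp]:
  "rmods process = {''lU'', ''lV'', ''fin'', ''mm'', ''j'', ''c'', ''d'', ''ok'', ''i'', ''h'', ''a'', ''b'', ''m'', ''p''}"
  "amods process = {''Y'', ''V'', ''q'', ''HI'', ''St'', ''Lo'', ''P''}"
  by (auto simp: process_def)

context machine
begin

lemma pin_loop:
  assumes s: "base s" and \<sigma>: "reg s ''sigma'' = x" "x \<in> set S" and m: "reg s ''mu'' = m"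
    and p: "pins S x m k (arr s ''r'') p"
  shows "wp w pin_loop (\<lambda>t s'. t \<le> 40 * k + 10 \<and> (\<forall>i<k. arr s' ''P'' i = p i)) s"
proof -
  note [simp] = baseD[OF s]
  have val: "arr s ''occ'' ((arr s ''f'' x * n mod 2 ^ w + (i * m mod 2 ^ w + arr s ''r'' i) mod 2 ^ w) mod 2 ^ w) = p i"
    if i: "i < k" for i
  proof -
    have pi: "p i < n" "S ! p i = x" "count_list (take (p i) S) x = i * m + arr s ''r'' i"
      using p i by (auto simp: pins_def)
    have "i * m + arr s ''r'' i \<le> n" using pi(3) count_le_length[of "take (p i) S" x] pi(1) by simp
    then have "(i * m mod 2 ^ w + arr s ''r'' i) mod 2 ^ w = i * m + arr s ''r'' i"
      "(arr s ''f'' x * n mod 2 ^ w + (i * m + arr s ''r'' i)) mod 2 ^ w = arr s ''f'' x * n + (i * m + arr s ''r'' i)"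
      using word_lin occ_index[OF s \<sigma>(2), of "i * m + arr s ''r'' i"] by simp_all
    moreover have "arr s ''occ'' (arr s ''f'' (S ! p i) * n + count_list (take (p i) S) (S ! p i)) = p i"
      using s pi(1) by (simp add: base_def)
    ultimately show ?thesis using pi by simp
  qed
  show ?thesis
    unfolding pin_loop_def
    by (rule wp_mono[OF fill[OF s, where g = p]]) (auto simp: frame_reg frame_arr val \<sigma> m)
qed

lemma set_windows_U:
  assumes s: "base s" and p: "\<forall>i<k. arr s ''P'' i = p i"
  shows "wp w set_windows_U (\<lambda>t s'. t \<le> 30 * k + 30 \<and> (\<forall>i<k. arr s' ''HI'' i = win_end k p i \<and>
      arr s' ''Lo'' i = zero_last k (arr s ''Lo'') i)) s"
proof -
  note [simp] = baseD[OF s]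
  have Suc_i: "Suc i mod 2 ^ w = Suc i" if "i < k" for i using that k_le word_lin by simp
  show ?thesis
    unfolding set_windows_U_def wp_Seq
  apply (rule wp_frame[OF fill[OF s, where g = "\<lambda>i. arr s ''P'' (Suc i)"]])
  subgoal by (simp add: frame_arr Suc_i)
  subgoal premises prems for t s'
  proof -
    note [simp] = frameD[OF prems(2)]
    have "t \<le> 24 * k + 10" "\<forall>i<k. arr s' ''HI'' i = arr s ''P'' (Suc i)" using prems(1) by auto
    then show ?thesis using p k_pos by (auto simp: win_end_def zero_last_def)
  qed
  done
qed

lemma set_windows_V:
  assumes s: "base s" and p: "\<forall>i<k. arr s ''P'' i = p i \<and> p i < n" and d: "reg s ''d'' = d" "d \<le> n"
  shows "wp w set_windows_V (\<lambda>t s'. t \<le> 60 * k + 50 \<and>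
      (\<forall>i<k. arr s' ''HI'' i = len_last S k (\<lambda>i. arr s ''HI'' (d * k + i)) i \<and>
      arr s' ''Lo'' i = Suc (p i))) s"
proof -
  note [simp] = baseD[OF s]
  have words: "(d * k mod 2 ^ w + i) mod 2 ^ w = d * k + i" "Suc (p i) mod 2 ^ w = Suc (p i)" if "i < k" for i
    using row_word[OF d(2), of i] that k_le p word_lin by auto
  show ?thesis
    unfolding set_windows_V_def wp_Seq
  apply (rule wp_frame[OF fill[OF s, where g = "\<lambda>i. arr s ''HI'' (d * k + i)"]])
  subgoal by (simp add: frame_reg frame_arr words d)
  subgoal premises prems for t s'
  proof -
    note fr = prems(2)
    note [simp] = frameD[OF fr]
    have s': "base s'" using base_frame[OF s fr] by simp
    show ?thesis
    apply (rule wp_frame[OF fill[OF s', where g = "\<lambda>i. Suc (p i)"]])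
    subgoal using p by (simp add: frame_reg frame_arr words)
    subgoal premises prems' for t' s''
    proof -
      note [simp] = frameD[OF prems'(2)]
      have "t \<le> 26 * k + 10" "\<forall>i<k. arr s' ''HI'' i = arr s ''HI'' (d * k + i)"
        "t' \<le> 24 * k + 10" "\<forall>i<k. arr s'' ''Lo'' i = Suc (p i)"
        using prems(1) prems'(1) by auto
      then show ?thesis using k_pos by (auto simp: len_last_def)
    qed
    done
  qed
  done
qed


lemma closed_maximal:
  "closed lo hi Y \<Longrightarrow> subseq Y Z \<Longrightarrow> (\<And>i. i < k \<Longrightarrow> emb S (lo i) (hi i) Z) \<Longrightarrow> Z = Y"
  using no_insertion_maximal[of Y S k lo hi Z] unfolding closed_def by blast

lemma extend:
  assumes s: "base s" and U: "is_U U s" "set U \<subseteq> set S" "length U \<le> n"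
    and P: "\<forall>i<k. arr s ''P'' i = p i" and Lo: "\<forall>i<k. arr s ''Lo'' i = Suc (p i)"
    and st: "stack (len_last S k h) (rev V) s"
    and embU: "\<And>i. i < k \<Longrightarrow> emb S (zero_last k (\<lambda>i. Suc (p i)) i) (win_end k p i) U"
    and h: "\<And>i. i < k \<Longrightarrow> rightmost S (win_end k p i) U (h i)"
    and embV: "\<forall>i<k. emb S (Suc (p i)) (len_last S k h i) V"
    and p: "\<And>i. Suc i < k \<Longrightarrow> p i < p (Suc i)" "p (k - 1) < n"
  shows "wp w extend (\<lambda>t s'. t \<le> 5000 * (k * lgn) * n \<and> (\<exists>U' V'. is_U U' s' \<and>
     is_V V' s' \<and> subseq U U' \<and> subseq V V' \<and> fits S k p U' V' \<and> blocked S k p U' V')) s"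
proof -
  define x where "x = k * lgn"
  have x: "k \<le> x" "1 \<le> x" using k_lgn by (auto simp: x_def)
  have n: "1 \<le> n" using k_pos k_le by linarith
  have xn: "x \<le> x * n" using n by simp
  have embV': "\<forall>i<k. emb S (arr s ''Lo'' i) (len_last S k h i) V" using embV Lo by simp
  have hp: "h i \<le> p (Suc i)" if "Suc i < k" for i
  proof -
    have "i \<noteq> k - 1" "i < k" using that by auto
    then show ?thesis using rightmost_le[OF h[of i]] by (simp add: win_end_def)
  qed
  have sumV: "(\<Sum>i<k. len_last S k h i - arr s ''Lo'' i) \<le> n"
    using sum_len_last[of k p S h] k_pos p hp Lo by simp
  show ?thesis
    unfolding extend_def wp_Seq x_def[symmetric]
  apply (rule wp_frame[OF run[OF s st embV', of "''V''" "''lV''"]])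
  subgoal by simp
  subgoal by simp
  subgoal premises prems for t1 s1
  proof -
    note fr1 = prems(2)
    define l where "l = arr s1 ''Lo''"
    from prems(1) Lo obtain V' where V': "is_V V' s1" "subseq V V'"
      "closed (arr s ''Lo'') (len_last S k h) V'" "\<And>i. i < k \<Longrightarrow> leftmost S (Suc (p i)) V' (l i)"
      "\<And>i. i < k \<Longrightarrow> emb S (Suc (p i)) (len_last S k h i) V'" unfolding l_def by auto
    have t1: "t1 \<le> 300 * x * (4 * n + 2)"
      using prems(1) sumV unfolding x_def by (meson add_le_mono1 le_trans mult_le_mono2)
    have s1: "base s1" using base_frame[OF s fr1] by simp
    have P1: "\<forall>i<k. arr s1 ''P'' i = p i" using P frame_arr[OF fr1] by simp
    have U1: "is_U U s1" using holds_frame[OF U(1) fr1] by simp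
    have fitsUV': "fits S k p U V'" using fits_iff_V[OF k_pos embU h, of V'] V'(5) by blast
    have V'_last: "emb S (Suc (p (k - 1))) n V'" using fitsUV' by (simp add: fits_def)
    note iffU = fits_iff_U[where S = S and p = p and l = l, OF k_pos V'(4) V'_last]
    have embU1: "\<forall>i<k. emb S (zero_last k l i) (win_end k p i) U" using iffU fitsUV' by blast
    show ?thesis
    apply (rule wp_frame[OF set_windows_U[OF s1 P1]])
    subgoal premises prems2 for t2 s2
    proof -
      note fr2 = prems2(2)
      have t2: "t2 \<le> 60 * x" using prems2(1) x by linarith
      have s2: "base s2" using base_frame[OF s1 fr2] by simp
      have U2: "is_U U s2" using holds_frame[OF U1 fr2] by simp
      have Lo2: "\<forall>i<k. arr s2 ''Lo'' i = zero_last k l i" using prems2(1) by (simp add: l_def)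
      have win2: "\<forall>i<k. arr s2 ''HI'' i = win_end k p i \<and> arr s2 ''Lo'' i \<le> win_end k p i \<and> win_end k p i \<le> n"
      proof (intro allI impI)
        fix i assume i: "i < k"
        then have "zero_last k l i \<le> win_end k p i \<and> win_end k p i \<le> n"
          using emb_le[OF embU1[rule_format, OF i]] by simp
        then show "arr s2 ''HI'' i = win_end k p i \<and> arr s2 ''Lo'' i \<le> win_end k p i \<and> win_end k p i \<le> n"
          using prems2(1) Lo2 i by simp
      qed
      have embU2: "\<forall>i<k. emb S (arr s2 ''Lo'' i) (win_end k p i) U" using embU1 Lo2 by simp
      have lLo: "p i < l i" if "Suc i < k" for i
      proof -
        have "emb S (Suc (p i)) (len_last S k h i) V'" using V'(5) that by simp
        then have "l i \<le> n" using V'(4)[of i] that unfolding leftmost_def by auto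
        then have "emb S (Suc (p i)) (l i) V'" using V'(4)[of i] that unfolding leftmost_def by simp
        from emb_le[OF this] show ?thesis by simp
      qed
      have sumU: "(\<Sum>i<k. win_end k p i - arr s2 ''Lo'' i) \<le> n"
        using sum_win_end[of k p n l] k_pos p lLo Lo2 by simp
      show ?thesis
      apply (rule wp_frame[OF load[OF s2 U2 U(2) win2]])
      subgoal by simp
      subgoal by simp
      subgoal premises prems3 for t3 s3
      proof -
        note fr3 = prems3(2)
        have t3: "t3 \<le> 150 * x * (length U + 1)" and st3: "stack (win_end k p) (rev U) s3"
          using prems3(1) embU2 by (auto simp: x_def)
        have s3: "base s3" using base_frame[OF s2 fr3] by simp
        have Lo3: "arr s3 ''Lo'' = arr s2 ''Lo''" using frame_arr[OF fr3] by simp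
        have V3: "is_V V' s3"
          by (rule holds_frame[OF holds_frame[OF V'(1) fr2] fr3]) simp_all
        have emb3: "\<forall>i<k. emb S (arr s3 ''Lo'' i) (win_end k p i) U" using embU2 Lo3 by simp
        show ?thesis
        apply (rule wp_frame[OF run[OF s3 st3 emb3, of "''Y''" "''lU''"]])
        subgoal by simp
        subgoal by simp
        subgoal premises prems4 for t4 s4
        proof -
          note fr4 = prems4(2)
          from prems4(1) obtain U' where U': "is_U U' s4" "subseq U U'"
            "closed (arr s3 ''Lo'') (win_end k p) U'"
            "\<And>i. i < k \<Longrightarrow> emb S (zero_last k l i) (win_end k p i) U'"
            using Lo2 Lo3 by auto
          have "t4 \<le> 300 * x * (4 * (\<Sum>i<k. win_end k p i - arr s2 ''Lo'' i) + 2)"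
            using prems4(1) unfolding x_def Lo3 by blast
          also have "\<dots> \<le> 300 * x * (4 * n + 2)" using sumU by (intro mult_le_mono2) simp
          finally have t4: "t4 \<le> 300 * x * (4 * n + 2)" .
          have "150 * x * (length U + 1) \<le> 150 * x * (n + 1)"
            using U(3) by (intro mult_le_mono2) simp
          then have t: "t1 + t2 + t3 + t4 + 10 \<le> 5000 * x * n"
          proof -
            have "300 * x * (4 * n + 2) = 1200 * (x * n) + 600 * x"
              "150 * x * (n + 1) = 150 * (x * n) + 150 * x" by (simp_all add: algebra_simps)
            then have "t1 \<le> 1200 * (x * n) + 600 * x" "t4 \<le> 1200 * (x * n) + 600 * x"
              "t3 \<le> 150 * (x * n) + 150 * x"
              using t1 t4 le_trans[OF t3 \<open>150 * x * (length U + 1) \<le> 150 * x * (n + 1)\<close>]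
              by simp_all
            then have "t1 + t2 + t3 + t4 + 10 \<le> 5000 * (x * n)"
              using t2 xn x(2) by linarith
            then show ?thesis by (simp only: mult.assoc)
          qed
          have V4: "is_V V' s4" using holds_frame[OF V3 fr4] by simp
          have fits: "fits S k p U' V'" using iffU U'(4) by blast
          have "blocked S k p U' V'"
            unfolding blocked_def
          proof (intro allI impI)
            fix U2 V2 assume *: "subseq U' U2" "subseq V' V2" "fits S k p U2 V2"
            \<comment> \<open>\<open>V'\<close> was closed in windows cut by the old
              \<open>U\<close>. Shrinking \<open>U2\<close> back to \<open>U\<close> places
              \<open>V2\<close> in exactly these windows and yields \<open>V2 = V'\<close>; only
              then do the windows left by \<open>V'\<close> apply to \<open>U2\<close>.\<close>
            have "subseq U U2" using U'(2) *(1) by (rule subseq_order.trans)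
            then have "fits S k p U V2" using fits_subseq[OF *(3)] by simp
            then have V2: "\<forall>i<k. emb S (Suc (p i)) (len_last S k h i) V2"
              using fits_iff_V[OF k_pos embU h] by blast
            have "V2 = V'" by (rule closed_maximal[OF V'(3) *(2)]) (use V2 Lo in simp)
            moreover have "fits S k p U2 V'" using fits_subseq[OF *(3) _ *(2)] by simp
            then have U2: "\<forall>i<k. emb S (zero_last k l i) (win_end k p i) U2" using iffU by blast
            have "U2 = U'" by (rule closed_maximal[OF U'(3) *(1)]) (use U2 Lo2 Lo3 in simp)
            ultimately show "U2 = U' \<and> V2 = V'" by simp
          qed
          then show ?thesis using U' V4 V'(2) fits t
            by (intro conjI exI[of _ U'] exI[of _ V']) simp_all
        qed
        done
      qed
      done
    qed
    done
  qed
  done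
qed

lemma data_frame:
  assumes "base s" "is_U U s" "is_V V s" "\<forall>i<k. arr s ''P'' i = p i" "frame X A s s'"
    "X \<inter> {''len_S'', ''k'', ''lU'', ''lV''} = {}"
    "A \<inter> {''S'', ''cnt'', ''f'', ''occ'', ''Y'', ''V'', ''P''} = {}"
  shows "base s'" "is_U U s'" "is_V V s'" "\<forall>i<k. arr s' ''P'' i = p i"
  using assms(6,7) base_frame[OF assms(1,5)] holds_frame[OF assms(2,5)] holds_frame[OF assms(3,5)]
    frame_arr[OF assms(5), of "''P''"] assms(4) by auto

text \<open>A choice that does not admit \<open>U\<close> and \<open>V\<close> changes neither of
  them and is blocked vacuously; in that case \<open>fits\<close> need not hold, hence the
  disjunction.\<close>

lemma process:
  assumes s: "base s" and U: "is_U U s" and V: "is_V V s"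
    and UV: "set U \<subseteq> set S" "set V \<subseteq> set S" "length U \<le> n" "length V \<le> n"
    and \<sigma>: "reg s ''sigma'' = x" "x \<in> set S" and m: "reg s ''mu'' = m" "0 < m"
    and p: "pins S x m k (arr s ''r'') p" "nondecr k R (arr s ''r'')"
  shows "wp w process (\<lambda>t s'. t \<le> 6000 * (k * lgn) * n \<and> (\<exists>U' V'. is_U U' s' \<and>
     is_V V' s' \<and> subseq U U' \<and> subseq V V' \<and>
     (U' = U \<and> V' = V \<or> fits S k p U' V') \<and> blocked S k p U' V')) s"
proof -
  define y where "y = k * lgn"
  have y: "k \<le> y" "1 \<le> y" using k_lgn by (auto simp: y_def)
  have n: "1 \<le> n" using k_pos k_le by linarith
  have yn: "y \<le> y * n" using n by simp
  have load_time: "150 * y * (j + 1) \<le> 300 * y * n" if "j \<le> n" for j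
  proof -
    have "150 * y * (j + 1) \<le> 150 * y * (2 * n)" using that n by (intro mult_le_mono2) simp
    then show ?thesis by simp
  qed
  have pn: "p i < n" if "i < k" for i using p(1) that by (simp add: pins_def)
  note pmono = pins_mono[OF p(1,2) m(2)]
  let ?Q = "\<lambda>s'. (\<exists>U' V'. is_U U' s' \<and>
     is_V V' s' \<and> subseq U U' \<and> subseq V V' \<and>
     (U' = U \<and> V' = V \<or> fits S k p U' V') \<and> blocked S k p U' V')"
  have Suc_p: "Suc (p i) mod 2 ^ w = Suc (p i)" if "i < k" for i using pn[OF that] word_lin by simp
  show ?thesis
    unfolding process_def wp_Seq y_def[symmetric]
  apply (rule wp_frame[OF pin_loop[OF s \<sigma> m(1) p(1)]])
  subgoal premises prems1 for t1 s1
  proof -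
    note fr1 = prems1(2)
    have P1: "\<forall>i<k. arr s1 ''P'' i = p i" using prems1(1) by simp
    note D1 = base_frame[OF s fr1, simplified] holds_frame[OF U fr1, simplified]
      holds_frame[OF V fr1, simplified] P1
    show ?thesis
    apply (rule wp_frame[OF fill[OF D1(1), where g = "\<lambda>i. Suc (p i)"]])
    subgoal using P1 by (simp add: frame_arr frame_reg Suc_p)
    subgoal premises prems2 for t2 s2
    proof -
      note fr2 = prems2(2)
      note D2 = data_frame[OF D1 fr2, simplified]
      show ?thesis
      apply (rule wp_frame[OF set_windows_U[OF D2(1) D2(4)]])
      subgoal premises prems3 for t3 s3
      proof -
        note fr3 = prems3(2)
        note D3 = data_frame[OF D2 fr3, simplified]
        have Lo3: "\<forall>i<k. arr s3 ''Lo'' i = zero_last k (\<lambda>i. Suc (p i)) i"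
          using prems3(1) prems2(1) by (simp add: zero_last_def)
        have win: "zero_last k (\<lambda>i. Suc (p i)) i \<le> win_end k p i \<and> win_end k p i \<le> n" if "i < k" for i
        proof (cases "i = k - 1")
          case True
          then show ?thesis using pn[of 0] k_pos by (simp add: zero_last_def win_end_def)
        next
          case False
          then have "Suc i < k" using that by linarith
          then show ?thesis using False pmono[of i] pn[of "Suc i"]
            by (simp add: zero_last_def win_end_def)
        qed
        have win3: "\<forall>i<k. arr s3 ''HI'' i = win_end k p i \<and> arr s3 ''Lo'' i \<le> win_end k p i \<and> win_end k p i \<le> n"
          using prems3(1) Lo3 win by simp
        have t123: "t1 + t2 + t3 \<le> 200 * y * n"
        proof -
          have "t1 + t2 + t3 \<le> 100 * k + 60" using prems1(1) prems2(1) prems3(1) by simp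
          also have "\<dots> \<le> 160 * y" using y by linarith
          finally show ?thesis using yn by linarith
        qed
        show ?thesis
        apply (rule wp_frame[OF load[OF D3(1) D3(2) UV(1) win3]])
        subgoal by simp
        subgoal by simp
        subgoal premises prems4 for t4 s4
        proof -
          note fr4 = prems4(2)
          have t4: "t4 \<le> 300 * y * n"
            using prems4(1) load_time[OF UV(3)] unfolding y_def by linarith
          note D4 = data_frame[OF D3 fr4, simplified]
          let ?embU = "\<forall>i<k. emb S (zero_last k (\<lambda>i. Suc (p i)) i) (win_end k p i) U"
          have iff4: "(\<forall>i<k. emb S (arr s3 ''Lo'' i) (win_end k p i) U) \<longleftrightarrow> ?embU"
            using Lo3 by simp
          show ?thesis
          proof (cases ?embU)
            case False
            then have "\<not> fits S k p U V" using fits_windows_U[OF k_pos] by blast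
            then have "blocked S k p U V" by (rule not_fits_blocked)
            moreover have "reg s4 ''ok'' = 0" using False prems4(1) iff4 by auto
            moreover have "t1 + t2 + t3 + t4 + 20 \<le> 6000 * y * n" using t123 t4 yn y by linarith
            moreover have "is_U U (s4\<lparr>reg := (reg s4)(''ok'' := 0)\<rparr>)"
              "is_V V (s4\<lparr>reg := (reg s4)(''ok'' := 0)\<rparr>)"
              using D4(2) D4(3) by (simp_all add: holds_def)
            ultimately show ?thesis by auto
          next
            case True
            then have ok4: "reg s4 ''ok'' = 1" and st4: "stack (win_end k p) (rev U) s4"
              using prems4(1) iff4 by auto
            have d4: "reg s4 ''d'' = length U" using st4 by (simp add: stack_def)
            define h where "h i = arr s4 ''HI'' (length U * k + i)" for i
            have h: "rightmost S (win_end k p i) U (h i)" if "i < k" for i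
              using stack_row[OF st4 that] by (simp add: h_def)
            note iffV = fits_iff_V[OF k_pos True[rule_format] h, of V]
            have step: "wp w (set_windows_V;; load ''V'' ''lV'';;
               If (Equal (Reg ''ok'') (Const 1)) extend (''ok'' ::= Const 0))
               (\<lambda>t s'. t \<le> 5450 * y * n \<and> ?Q s') s4"
              unfolding wp_Seq
              apply (rule wp_frame[OF set_windows_V[where p = p, OF D4(1) _ d4 UV(3)]])
              subgoal using D4(4) pn by (intro allI impI conjI) simp_all
              subgoal premises prems5 for t5 s5
              proof -
                note fr5 = prems5(2)
                have t5: "t5 \<le> 60 * k + 50" using prems5(1) by simp
                note D5 = data_frame[OF D4 fr5, simplified]
                have Lo5: "\<forall>i<k. arr s5 ''Lo'' i = Suc (p i)" using prems5(1) by simp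
                have winV: "Suc (p i) \<le> len_last S k h i \<and> len_last S k h i \<le> n" if "i < k" for i
                proof (cases "i = k - 1")
                  case True
                  then show ?thesis using pn[OF that] by (simp add: len_last_def)
                next
                  case False
                  then have "emb S (Suc (p i)) (win_end k p i) U" using True that
                    \<open>?embU\<close> by (auto simp: zero_last_def)
                  then have "Suc (p i) \<le> h i" using h[OF that] by (simp add: rightmost_def)
                  then show ?thesis using rightmost_le[OF h[OF that]] False by (simp add: len_last_def)
                qed
                have win5: "\<forall>i<k. arr s5 ''HI'' i = len_last S k h i \<and>
                  arr s5 ''Lo'' i \<le> len_last S k h i \<and> len_last S k h i \<le> n"
                  using prems5(1) winV Lo5 by (simp add: h_def[abs_def])
                show ?thesis
                apply (rule wp_frame[OF load[OF D5(1) D5(3) UV(2) win5]])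
                subgoal by simp
                subgoal by simp
                subgoal premises prems6 for t6 s6
                proof -
                  note fr6 = prems6(2)
                  have t6: "t6 \<le> 300 * y * n"
                    using prems6(1) load_time[OF UV(4)] unfolding y_def by linarith
                  note D6 = data_frame[OF D5 fr6, simplified]
                  have Lo6: "\<forall>i<k. arr s6 ''Lo'' i = Suc (p i)" using Lo5 frame_arr[OF fr6] by simp
                  have iff6: "(\<forall>i<k. emb S (arr s5 ''Lo'' i) (len_last S k h i) V) \<longleftrightarrow> fits S k p U V"
                    using Lo5 iffV by simp
                  have t56: "t5 + t6 + 20 \<le> 450 * y * n"
                    using t5 t6 y yn by linarith
                  show ?thesis
                  proof (cases "fits S k p U V")
                    case False
                    then have "blocked S k p U V" by (rule not_fits_blocked)
                    moreover have "reg s6 ''ok'' = 0" using False prems6(1) iff6 by auto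
                    moreover have "t5 + t6 + 20 \<le> 5450 * y * n" using t56 by linarith
                    moreover have "is_U U (s6\<lparr>reg := (reg s6)(''ok'' := 0)\<rparr>)"
                      "is_V V (s6\<lparr>reg := (reg s6)(''ok'' := 0)\<rparr>)"
                      using D6(2) D6(3) by (simp_all add: holds_def)
                    ultimately show ?thesis by auto
                  next
                    case fits: True
                    then have ok6: "reg s6 ''ok'' = 1" and st6: "stack (len_last S k h) (rev V) s6"
                      using prems6(1) iff6 by auto
                    have embV: "\<forall>i<k. emb S (Suc (p i)) (len_last S k h i) V" using fits iffV by blast
                    have pk: "p (k - 1) < n" using pn k_pos by simp
                    note ext = extend[OF D6(1) D6(2) UV(1,3) D6(4) Lo6 st6 True[rule_format] h embV pmono pk, folded y_def]
                    have "wp w extend (\<lambda>t s'. t5 + t6 + t + 10 \<le> 5450 * y * n \<and> ?Q s') s6"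
                      by (rule wp_mono[OF ext]) (use t56 in auto)
                    then show ?thesis using ok6
                      by (auto elim!: wp_mono)
                  qed
                qed
                done
              qed
              done
            have b: "bval w (Equal (Reg ''ok'') (Const 1)) s4" using ok4 by simp
            have total: "t1 + t2 + t3 + t4 + t + 15 \<le> 6000 * y * n" if "t \<le> 5450 * y * n" for t
              using that t123 t4 yn y by linarith
            show ?thesis unfolding wp_If if_P[OF b]
              by (rule wp_mono[OF step]) (auto dest: total)
          qed
        qed
        done
      qed
      done
    qed
    done
  qed
  done
qed

end

section \<open>Set-up and enumeration of the pins\<close>

definition build :: com where
  "build =
    ''j'' ::= Const 0;;
    While (Less (Reg ''j'') (Reg ''len_S'')) (
      ''c'' ::= Read ''S'' (Reg ''j'');;
      If (Equal (Read ''cnt'' (Reg ''c'')) (Const 0)) (Store ''f'' (Reg ''c'') (Reg ''j'')) (''ok'' ::= Const 0);;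
      Store ''occ'' (Add (Mul (Read ''f'' (Reg ''c'')) (Reg ''len_S'')) (Read ''cnt'' (Reg ''c''))) (Reg ''j'');;
      Store ''cnt'' (Reg ''c'') (Add (Read ''cnt'' (Reg ''c'')) (Const 1));;
      ''j'' ::= Add (Reg ''j'') (Const 1))"

definition split_U :: com where
  "split_U =
    ''j'' ::= Const 0;;
    While (Not (Equal (Read ''X'' (Reg ''j'')) (Reg ''sigma''))) (
      Store ''Y'' (Reg ''j'') (Read ''X'' (Reg ''j''));;
      ''j'' ::= Add (Reg ''j'') (Const 1));;
    ''lU'' ::= Reg ''j''"

text \<open>\<open>mu\<close> starts at 1 for the marked character. That is the first sigma of
  \<open>X\<close>, so \<open>U\<close> contributes none and \<open>mu\<close> becomes the number of
  sigmas in \<open>X\<close>.\<close>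

definition split_V :: com where
  "split_V =
    ''j'' ::= Add (Reg ''j'') (Const 1);;
    ''mu'' ::= Const 1;;
    ''lV'' ::= Const 0;;
    While (Less (Reg ''j'') (Reg ''len_X'')) (
      ''c'' ::= Read ''X'' (Reg ''j'');;
      If (Equal (Reg ''c'') (Reg ''sigma'')) (''mu'' ::= Add (Reg ''mu'') (Const 1)) (''mu'' ::= Reg ''mu'');;
      Store ''V'' (Reg ''lV'') (Reg ''c'');;
      ''lV'' ::= Add (Reg ''lV'') (Const 1);;
      ''j'' ::= Add (Reg ''j'') (Const 1))"

definition next_pins :: com where
  "next_pins =
    ''i'' ::= Reg ''k'';;
    While (And (Less (Const 0) (Reg ''i'')) (Equal (Read ''r'' (Sub (Reg ''i'') (Const 1))) (Reg ''R'')))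
      (''i'' ::= Sub (Reg ''i'') (Const 1));;
    If (Equal (Reg ''i'') (Const 0)) (''done'' ::= Const 1)
      (''i'' ::= Sub (Reg ''i'') (Const 1);;
       ''x'' ::= Add (Read ''r'' (Reg ''i'')) (Const 1);;
       While (Less (Reg ''i'') (Reg ''k'')) (
         Store ''r'' (Reg ''i'') (Reg ''x'');;
         ''i'' ::= Add (Reg ''i'') (Const 1)))"

definition write_sigma :: com where
  "write_sigma =
    Store ''Y'' (Reg ''lU'') (Reg ''sigma'');;
    ''len_Y'' ::= Add (Reg ''lU'') (Const 1)"

definition write_V :: com where
  "write_V =
    ''j'' ::= Const 0;;
    While (Less (Reg ''j'') (Reg ''lV'')) (
      Store ''Y'' (Reg ''len_Y'') (Read ''V'' (Reg ''j''));;
      ''len_Y'' ::= Add (Reg ''len_Y'') (Const 1);;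
      ''j'' ::= Add (Reg ''j'') (Const 1))"

definition program :: com where
  "program =
    build;;
    split_U;;
    split_V;;
    ''R'' ::= Sub (Read ''cnt'' (Reg ''sigma'')) (Mul (Reg ''k'') (Reg ''mu''));;
    ''done'' ::= Const 0;;
    While (Equal (Reg ''done'') (Const 0)) (process;; next_pins);;
    write_sigma;;
    write_V"

lemma setup_mods [simp]:
  "rmods build = {''j'', ''c'', ''ok''}" "amods build = {''f'', ''occ'', ''cnt''}"
  "rmods split_U = {''j'', ''lU''}" "amods split_U = {''Y''}"
  "rmods split_V = {''j'', ''mu'', ''lV'', ''c''}" "amods split_V = {''V''}"
  "rmods next_pins = {''i'', ''done'', ''x''}" "amods next_pins = {''r''}"
  "rmods write_sigma = {''len_Y''}" "amods write_sigma = {''Y''}"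
  "rmods write_V = {''j'', ''len_Y''}" "amods write_V = {''Y''}"
  by (auto simp: build_def split_U_def split_V_def next_pins_def write_sigma_def write_V_def)

text \<open>Uniqueness of base-\<open>n\<close> representations: as ranks are below
  \<open>n\<close>, different rows of \<open>occ\<close> do not overlap.\<close>

lemma digits_inj:
  fixes a b c d n :: nat
  assumes "a * n + b = c * n + d" "b < n" "d < n"
  shows "a = c \<and> b = d"
proof -
  have "(a * n + b) div n = a" "(c * n + d) div n = c" using assms(2,3) by simp_all
  then have "a = c" using assms(1) by simp
  then show ?thesis using assms(1) by simp
qed

context machine
begin

lemma build:
  assumes s: "reg s ''len_S'' = n" "reg s ''k'' = k" "arr s ''S'' = cells S"
    "arr s ''cnt'' = (\<lambda>_. 0)"
  shows "wp w build (\<lambda>t s'. t \<le> 50 * n + 10 \<and> base s') s"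
proof -
  define tab :: "nat \<Rightarrow> (nat \<Rightarrow> nat) \<Rightarrow> (nat \<Rightarrow> nat) \<Rightarrow> (nat \<Rightarrow> nat) \<Rightarrow> bool" where
    "tab j f occ cnt \<longleftrightarrow> (\<forall>c. cnt c = count_list (take j S) c) \<and>
      (\<forall>c\<in>set (take j S). f c < j \<and> S ! f c = c) \<and>
      (\<forall>q<j. occ (f (S ! q) * n + count_list (take q S) (S ! q)) = q)" for j f occ cnt
  have step: "tab (Suc j) f' (occ(f' c * n + cnt c := j)) (cnt(c := Suc (cnt c)))" and
    bound: "f' c \<le> j" "cnt c \<le> j"
    if t: "tab j f occ cnt" and j: "j < n" and c: "c = S ! j" and
      f': "f' = (if cnt c = 0 then f(c := j) else f)" for j f f' occ cnt c
  proof -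
    have cnt: "cnt c = count_list (take j S) c" for c using t by (simp add: tab_def)
    have take: "set (take (Suc j) S) = insert c (set (take j S))"
      using j c by (simp add: take_Suc_conv_app_nth)
    have f'_eq: "f' d = f d" if "d \<in> set (take j S)" for d
      using that f' by (auto simp: cnt count_list_0_iff)
    have f'_c: "f' c \<le> j" "S ! f' c = c"
    proof -
      have "c \<in> set (take j S)" if "cnt c \<noteq> 0" using that by (auto simp: cnt count_list_0_iff)
      then have "f c < j \<and> S ! f c = c" if "cnt c \<noteq> 0" using that t by (auto simp: tab_def)
      then show "f' c \<le> j" "S ! f' c = c" using f' c by (auto simp: less_imp_le)
    qed
    show "f' c \<le> j" by (fact f'_c)
    show cj: "cnt c \<le> j" using count_le_length[of "take j S" c] by (simp add: cnt)
    have "(occ(f' c * n + cnt c := j)) (f' (S ! q) * n + count_list (take q S) (S ! q)) = q" if "q < Suc j" for q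
    proof (cases "q = j")
      case True
      then show ?thesis by (simp add: cnt c)
    next
      case False
      then have q: "q < j" using that by simp
      have mem: "S ! q \<in> set (take j S)" using q j by (auto simp: in_set_conv_nth intro!: exI[of _ q])
      have "count_list (take q S) (S ! q) \<le> q" using count_le_length[of "take q S" "S ! q"] q j by simp
      then have lt: "count_list (take q S) (S ! q) < n" "cnt c < n" using q j cj by auto
      \<comment> \<open>The new entry destroys no old one: equal row numbers mean equal characters,
        because \<open>f'\<close> yields a position of the character, and in one row the ranks of
        two positions differ.\<close>
      have "f' (S ! q) * n + count_list (take q S) (S ! q) \<noteq> f' c * n + cnt c"
      proof
        assume "f' (S ! q) * n + count_list (take q S) (S ! q) = f' c * n + cnt c"
        then have *: "f' (S ! q) = f' c" "count_list (take q S) (S ! q) = cnt c"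
          using digits_inj[OF _ lt] by blast+
        have "S ! f' (S ! q) = S ! q" using f'_eq[OF mem] mem t by (simp add: tab_def)
        then have "S ! q = c" using *(1) f'_c by simp
        moreover have "count_list (take q S) (S ! q) < count_list (take j S) (S ! q)"
          using count_take_less_iff[of q S "S ! q" j] q j by simp
        ultimately show False using *(2) cnt by simp
      qed
      then show ?thesis using t q f'_eq[OF mem] by (simp add: tab_def)
    qed
    moreover have "\<forall>d\<in>set (take (Suc j) S). f' d < Suc j \<and> S ! f' d = d"
      unfolding take using f'_c f'_eq t by (auto simp: tab_def less_Suc_eq_le less_imp_le)
    ultimately show "tab (Suc j) f' (occ(f' c * n + cnt c := j)) (cnt(c := Suc (cnt c)))"
      using cnt j c unfolding tab_def by (auto simp: count_take_Suc)
  qed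
  show ?thesis
    unfolding build_def wp_Seq wp_Assign
  apply (rule wp_While[where I = "\<lambda>s'. frame {''j'', ''c'', ''ok''} {''f'', ''occ'', ''cnt''} s s' \<and>
      reg s' ''j'' \<le> n \<and> tab (reg s' ''j'') (arr s' ''f'') (arr s' ''occ'') (arr s' ''cnt'')" and
      \<phi> = "\<lambda>s'. 50 * (n - reg s' ''j'')"])
  subgoal using s by (simp add: frame_def tab_def)
  subgoal premises prems for s'
  proof -
    note fr = prems(1)[THEN conjunct1]
    note [simp] = frameD[OF fr]
    define j where "j = reg s' ''j''"
    have j: "j < n" using prems s by (simp add: j_def)
    define c where "c = S ! j"
    define f' where "f' = (if arr s' ''cnt'' c = 0 then (arr s' ''f'')(c := j) else arr s' ''f'')"
    have t: "tab j (arr s' ''f'') (arr s' ''occ'') (arr s' ''cnt'')" using prems by (simp add: j_def)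
    note st = step[OF t j c_def f'_def] and bd = bound[OF t j c_def f'_def]
    have "f' c * n + arr s' ''cnt'' c \<le> n * n + n"
      using bd j by (intro add_mono mult_le_mono) auto
    then have ix: "(f' c * n mod 2 ^ w + arr s' ''cnt'' c) mod 2 ^ w = f' c * n + arr s' ''cnt'' c"
      using word by simp
    have words: "Suc j mod 2 ^ w = Suc j" "Suc (arr s' ''cnt'' c) mod 2 ^ w = Suc (arr s' ''cnt'' c)"
      using bd j word_lin by simp_all
    have cell: "cells S j = c" using j by (simp add: cells_def c_def)
    have nj: "n - j = Suc (n - Suc j)" using j by simp
    have Sj: "S ! j = c" by (simp add: c_def)
    show ?thesis
    proof (cases "arr s' ''cnt'' c = 0")
      case True
      then have f'c: "f' = (arr s' ''f'')(c := j)" by (simp add: f'_def)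
      show ?thesis using st[unfolded f'c fun_upd_same] ix[unfolded f'c fun_upd_same] fr j True
        by (simp add: s cell nj words Sj frame_def flip: j_def) (simp add: fun_upd_def)
    next
      case False
      then have f'c: "f' = arr s' ''f''" by (simp add: f'_def)
      show ?thesis using st ix fr j False unfolding f'c
        by (simp add: s cell nj words Sj frame_def flip: j_def)
    qed
  qed
  subgoal premises prems for t s'
  proof -
    note fr = prems(1)[THEN conjunct1]
    note [simp] = frameD[OF fr]
    have "reg s' ''j'' = n" using prems s by simp
    then show ?thesis using prems s by (auto simp: base_def tab_def)
  qed
  done
qed

lemma split_U:
  assumes X: "holds ''X'' ''len_X'' (U @ x # V) s" "length (U @ x # V) \<le> n" "x \<notin> set U"
    and \<sigma>: "reg s ''sigma'' = x"
  shows "wp w split_U (\<lambda>t s'. t \<le> 20 * n + 20 \<and> is_U U s' \<and> reg s' ''j'' = length U) s"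
proof -
  have X': "arr s ''X'' j = (U @ x # V) ! j" if "j \<le> length U" for j
    using X(1) that by (simp add: holds_def)
  show ?thesis
    unfolding split_U_def wp_Seq wp_Assign
  apply (rule wp_While[where I = "\<lambda>s'. frame {''j''} {''Y''} s s' \<and>
      reg s' ''j'' \<le> length U \<and> (\<forall>i<reg s' ''j''. arr s' ''Y'' i = U ! i)" and
      \<phi> = "\<lambda>s'. 20 * (length U - reg s' ''j'')"])
  subgoal by (simp add: frame_def)
  subgoal premises prems for s'
  proof -
    note fr = prems(1)[THEN conjunct1]
    note [simp] = frameD[OF fr]
    define j where "j = reg s' ''j''"
    have "j \<noteq> length U" using prems X'[of j] \<sigma> by (auto simp: j_def)
    then have j: "j < length U" using prems by (simp add: j_def)
    then have "Suc j mod 2 ^ w = Suc j" using X(2) word_lin by simp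
    moreover have "length U - j = Suc (length U - Suc j)" using j by simp
    ultimately show ?thesis using prems(1) j X'[of j]
      by (auto simp: frame_def less_Suc_eq nth_append simp flip: j_def)
  qed
  subgoal premises prems for t s'
  proof -
    note fr = prems(1)[THEN conjunct1]
    note [simp] = frameD[OF fr]
    have "\<not> reg s' ''j'' < length U"
    proof
      assume j: "reg s' ''j'' < length U"
      then have "U ! reg s' ''j'' = x" using prems(2) X'[of "reg s' ''j''"] \<sigma> by (simp add: nth_append)
      then show False using X(3) nth_mem[OF j] by simp
    qed
    then have "reg s' ''j'' = length U" using prems by simp
    moreover have "20 * length U \<le> 20 * n" using X(2) by simp
    ultimately show ?thesis using prems by (simp add: holds_def)
  qed
  done
qed

lemma split_V:
  assumes X: "holds ''X'' ''len_X'' (U @ x # V) s" "length (U @ x # V) \<le> n"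
    and \<sigma>: "reg s ''sigma'' = x" and j: "reg s ''j'' = length U"
  shows "wp w split_V (\<lambda>t s'. t \<le> 40 * n + 20 \<and> is_V V s' \<and>
     reg s' ''mu'' = Suc (count_list V x)) s"
proof -
  have X': "arr s ''X'' (Suc (length U + i)) = V ! i" if "i < length V" for i
    using X(1) that by (simp add: holds_def nth_append)
  have lX: "reg s ''len_X'' = Suc (length U + length V)" using X(1) by (simp add: holds_def)
  have len: "Suc (length U + length V) \<le> n" using X(2) by simp
  have w1: "Suc i mod 2 ^ w = Suc i" if "i \<le> n" for i using that word_lin by simp
  show ?thesis
    unfolding split_V_def wp_Seq wp_Assign
  apply (rule wp_While[where I = "\<lambda>s'. frame {''j'', ''mu'', ''lV'', ''c''} {''V''} s s' \<and>
      reg s' ''lV'' \<le> length V \<and> reg s' ''j'' = Suc (length U + reg s' ''lV'') \<and>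
      reg s' ''mu'' = Suc (count_list (take (reg s' ''lV'') V) x) \<and>
      (\<forall>i<reg s' ''lV''. arr s' ''V'' i = V ! i)" and
      \<phi> = "\<lambda>s'. 40 * (length V - reg s' ''lV'')"])
  subgoal using j len by (simp add: frame_def w1)
  subgoal premises prems for s'
  proof -
    note fr = prems(1)[THEN conjunct1]
    note [simp] = frameD[OF fr]
    define i where "i = reg s' ''lV''"
    have i: "i < length V" using prems lX by (simp add: i_def)
    have "count_list (take i V) x \<le> length V" using count_le_length[of "take i V" x] i by simp
    then have words: "Suc i mod 2 ^ w = Suc i"
      "Suc (Suc (length U + i)) mod 2 ^ w = Suc (Suc (length U + i))"
      "Suc (Suc (count_list (take i V) x)) mod 2 ^ w = Suc (Suc (count_list (take i V) x))"
      using i len word_lin by simp_all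
    have vi: "length V - i = Suc (length V - Suc i)" using i by simp
    have J: "reg s' ''j'' = Suc (length U + i)" "reg s' ''mu'' = Suc (count_list (take i V) x)"
      using prems by (auto simp: i_def)
    have rest: "\<forall>j<i. arr s' ''V'' j = V ! j" using prems(1) by (simp add: i_def)
    show ?thesis using fr rest i X'[OF i]
      by (simp add: J words vi \<sigma> count_take_Suc frame_def less_Suc_eq flip: i_def)
  qed
  subgoal premises prems for t s'
  proof -
    note fr = prems(1)[THEN conjunct1]
    note [simp] = frameD[OF fr]
    have "reg s' ''lV'' = length V" using prems lX by simp
    moreover have "40 * length V \<le> 40 * n" using X(2) by simp
    ultimately show ?thesis using prems by (simp add: holds_def)
  qed
  done
qed

lemma next_pins:
  assumes s: "base s" and R: "reg s ''R'' = R" "R \<le> n" and d: "reg s ''done'' = 0"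
    and r: "nondecr k R (arr s ''r'')"
  shows "wp w next_pins (\<lambda>t s'. t \<le> 60 * k + 60 \<and>
     (if reg s' ''done'' = 0 then nondecr k R (arr s' ''r'') \<and> lex_less k (arr s ''r'') (arr s' ''r'') \<and>
        (\<forall>f. nondecr k R f \<longrightarrow> lex_less k f (arr s' ''r'') \<longrightarrow>
          lex_less k f (arr s ''r'') \<or> (\<forall>i<k. f i = arr s ''r'' i))
      else \<forall>f. nondecr k R f \<longrightarrow> lex_less k f (arr s ''r'') \<or> (\<forall>i<k. f i = arr s ''r'' i))) s"
proof -
  note [simp] = baseD[OF s]
  show ?thesis
    unfolding next_pins_def wp_Seq wp_Assign
  apply (rule wp_While[where I = "\<lambda>s'. frame {''i''} {} s s' \<and> reg s' ''i'' \<le> k \<and>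
      (\<forall>i<k. reg s' ''i'' \<le> i \<longrightarrow> arr s ''r'' i = R)" and \<phi> = "\<lambda>s'. 20 * reg s' ''i''"])
  subgoal by (simp add: frame_def)
  subgoal premises prems for s'
  proof -
    note fr = prems(1)[THEN conjunct1]
    note [simp] = frameD[OF fr]
    obtain i where i: "reg s' ''i'' = Suc i" using prems(2) by (cases "reg s' ''i''") auto
    have "arr s ''r'' i = R" using prems(2) R by (simp add: i)
    then have "arr s ''r'' j = R" if "i \<le> j" "j < k" for j
      using prems(1) that by (cases "j = i") (auto simp: i)
    then show ?thesis using prems(1) by (simp add: i frame_def)
  qed
  subgoal premises prems for t s'
  proof -
    note fr = prems(1)[THEN conjunct1]
    note [simp] = frameD[OF fr]
    have t: "t \<le> 20 * k + 15" using prems(3) by simp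
    show ?thesis
    proof (cases "reg s' ''i''")
      case 0
      then have "\<forall>f. nondecr k R f \<longrightarrow> lex_less k f (arr s ''r'') \<or> (\<forall>i<k. f i = arr s ''r'' i)"
        using prems(1) nondecr_last[of k "arr s ''r''" R] by simp
      then show ?thesis using 0 t by simp
    next
      case (Suc i)
      have i: "i < k" "arr s ''r'' i \<noteq> R" using prems Suc R by auto
      have top: "arr s ''r'' j = R" if "i < j" "j < k" for j using prems(1) Suc that by simp
      have ri: "arr s ''r'' i < R" using r i by (auto simp: nondecr_def le_neq_implies_less)
      then have word_r: "Suc (arr s ''r'' i) mod 2 ^ w = Suc (arr s ''r'' i)" using R(2) word_lin by simp
      let ?r = "\<lambda>s'. \<lambda>j. if j < i then arr s ''r'' j else Suc (arr s ''r'' i)"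
      have loop: "wp w (While (Less (Reg ''i'') (Reg ''k'')) (
           Store ''r'' (Reg ''i'') (Reg ''x'');;
           ''i'' ::= Add (Reg ''i'') (Const 1)))
        (\<lambda>t s2. t \<le> 20 * k + 10 \<and> reg s2 ''done'' = 0 \<and>
           (\<forall>j<k. arr s2 ''r'' j = (if j < i then arr s ''r'' j else Suc (arr s ''r'' i))))
        (s'\<lparr>reg := (reg s')(''i'' := i, ''x'' := Suc (arr s ''r'' i))\<rparr>)"
        apply (rule wp_While[where I = "\<lambda>s2. frame {''i'', ''x''} {''r''} s' s2 \<and> i \<le> reg s2 ''i'' \<and>
           reg s2 ''i'' \<le> k \<and> reg s2 ''x'' = Suc (arr s ''r'' i) \<and>
           (\<forall>j<reg s2 ''i''. arr s2 ''r'' j = (if j < i then arr s ''r'' j else Suc (arr s ''r'' i)))" and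
           \<phi> = "\<lambda>s2. 20 * (k - reg s2 ''i'')"])
        subgoal using i by (simp add: frame_def)
        subgoal premises prems' for s2
        proof -
          note fr2 = prems'(1)[THEN conjunct1]
          note [simp] = frameD[OF fr2]
          define j where "j = reg s2 ''i''"
          have j: "j < k" "Suc j mod 2 ^ w = Suc j" using prems' k_le word_lin by (auto simp: j_def)
          have "k - j = Suc (k - Suc j)" using j by simp
          then show ?thesis using prems'(1) j
            by (auto simp: frame_def less_Suc_eq simp flip: j_def)
        qed
        subgoal premises prems' for t2 s2
        proof -
          note fr2 = prems'(1)[THEN conjunct1]
          note [simp] = frameD[OF fr2]
          have "reg s2 ''i'' = k" using prems' by simp
          then show ?thesis using prems' d by auto
        qed
        done
      show ?thesis using Suc word_r
        apply simp
        apply (rule wp_mono[OF loop[unfolded One_nat_def]])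
        subgoal premises prems' for t2 s2
          using prems' t nondecr_next[OF r i(1) ri top, of "arr s2 ''r''"] by simp
        done
    qed
  qed
  done
qed

lemma write_sigma:
  assumes s: "is_U U s" "length U \<le> n"
  shows "wp w write_sigma (\<lambda>t s'. t \<le> 10 \<and> holds ''Y'' ''len_Y'' (U @ [reg s ''sigma'']) s') s"
proof -
  have "Suc (length U) mod 2 ^ w = Suc (length U)" using s(2) word_lin by simp
  then show ?thesis using s(1) by (simp add: write_sigma_def holds_def nth_append less_Suc_eq)
qed

lemma write_V:
  assumes s: "is_V V s" "holds ''Y'' ''len_Y'' Y s" "length (Y @ V) \<le> n"
  shows "wp w write_V (\<lambda>t s'. t \<le> 40 * n + 20 \<and> holds ''Y'' ''len_Y'' (Y @ V) s') s"
  unfolding write_V_def wp_Seq wp_Assign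
  apply (rule wp_While[where I = "\<lambda>s'. frame {''j'', ''len_Y''} {''Y''} s s' \<and>
      reg s' ''j'' \<le> length V \<and> holds ''Y'' ''len_Y'' (Y @ take (reg s' ''j'') V) s'" and
      \<phi> = "\<lambda>s'. 40 * (length V - reg s' ''j'')"])
  subgoal using s(2) by (simp add: frame_def holds_def)
  subgoal premises prems for s'
  proof -
    note fr = prems(1)[THEN conjunct1]
    note [simp] = frameD[OF fr]
    define j where "j = reg s' ''j''"
    have j: "j < length V" using prems s by (simp add: j_def holds_def)
    have h: "holds ''Y'' ''len_Y'' (Y @ take j V) s'" using prems(1) by (simp add: j_def)
    then have lY: "reg s' ''len_Y'' = length Y + j" using j by (simp add: holds_def)
    have words: "Suc j mod 2 ^ w = Suc j" "Suc (length Y + j) mod 2 ^ w = Suc (length Y + j)"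
      using j s(3) word_lin by simp_all
    have vj: "length V - j = Suc (length V - Suc j)" using j by simp
    have Vj: "arr s ''V'' j = V ! j" using s(1) j by (simp add: holds_def)
    have tk: "Y @ take (Suc j) V = (Y @ take j V) @ [V ! j]" using j by (simp add: take_Suc_conv_app_nth)
    let ?s = "s'\<lparr>arr := (arr s')(''Y'' := (arr s' ''Y'')(length Y + j := V ! j)),
       reg := (reg s')(''len_Y'' := Suc (length Y + j), ''j'' := Suc j)\<rparr>"
    have "holds ''Y'' ''len_Y'' (Y @ take (Suc j) V) ?s"
      unfolding tk using h j by (auto simp: holds_def nth_append less_Suc_eq)
    then show ?thesis using fr j by (simp add: words lY vj Vj frame_def flip: j_def)
  qed
  subgoal premises prems for t s'
  proof -
    note fr = prems(1)[THEN conjunct1]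
    note [simp] = frameD[OF fr]
    have "reg s' ''j'' = length V" using prems s by (simp add: holds_def)
    moreover have "t \<le> 40 * n + 10" using prems(3) s(3) by simp
    ultimately show ?thesis using prems(1) by simp
  qed
  done

end

section \<open>From blocked choices to maximality\<close>

lemma k_repeating_subseq: "k_repeating k X S \<Longrightarrow> 0 < k \<Longrightarrow> subseq X S"
  unfolding k_repeating_def by (cases k) (auto dest: list_emb_appendD intro: subseq_order.trans list_emb_append_mono[of "(=)" X X "[]", simplified])

lemma subseq_set: "subseq V W \<Longrightarrow> set V \<subseteq> set W"
  by (induction rule: list_emb.induct) auto

text \<open>The cut is made where the marked character is embedded, which need not be the first
  \<open>x\<close> of \<open>Z\<close>.\<close>

lemma subseq_split:
  assumes "subseq (U @ x # V) Z"
  obtains U' V' where "Z = U' @ x # V'" "subseq U U'" "subseq V V'"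
proof -
  from list_emb_appendD[OF assms] obtain Z1 Z2 where Z: "Z = Z1 @ Z2" "subseq U Z1" "subseq (x # V) Z2"
    by blast
  from list_emb_ConsD[OF Z(3)] obtain Z3 V' where "Z2 = Z3 @ x # V'" "subseq V V'" by auto
  moreover have "subseq U (Z1 @ Z3)" using Z(2) by (rule list_emb_prefix)
  ultimately show ?thesis using that[of "Z1 @ Z3" V'] Z(1) by simp
qed

text \<open>The bound on \<open>m\<close> passes from \<open>V\<close> to the larger
  \<open>V'\<close> of any competitor \<open>Z\<close>, so the pins of \<open>Z\<close> are among
  the enumerated ones, and being blocked there forces \<open>Z\<close> to be the old string.\<close>

lemma maximal_if_blocked:
  assumes "0 < k" "k_repeating k (U @ x # V) S" "0 < m" "m \<le> Suc (count_list V x)"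
    and blocked: "\<And>r p. nondecr k (count_list S x - k * m) r \<Longrightarrow> pins S x m k r p \<Longrightarrow> blocked S k p U V"
  shows "maximal_k_repeating k (U @ x # V) S"
  unfolding maximal_k_repeating_def
proof (intro conjI notI)
  assume "\<exists>Z. strict_subseq (U @ x # V) Z \<and> k_repeating k Z S"
  then obtain Z where Z: "strict_subseq (U @ x # V) Z" "k_repeating k Z S" by blast
  then obtain U' V' where Z': "Z = U' @ x # V'" "subseq U U'" "subseq V V'"
    using subseq_split unfolding strict_subseq_def by metis
  have "m \<le> Suc (count_list V' x)" using assms(4) count_list_mono[OF Z'(3), of x] by simp
  from ex_pins[OF assms(1) Z(2)[unfolded Z'(1)] this assms(3)] obtain r p where
    "nondecr k (count_list S x - k * m) r" "pins S x m k r p" "fits S k p U' V'" by blast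
  then have "U' = U \<and> V' = V" using blocked Z' unfolding blocked_def by blast
  then show False using Z(1) Z'(1) by (simp add: strict_subseq_def)
qed (use assms in simp)

lemma output_string_eq: "holds ''Y'' ''len_Y'' W s \<Longrightarrow> output_string s = W"
  by (auto simp: output_string_def holds_def intro: nth_equalityI)

section \<open>The loop over all choices and the complete program\<close>

context machine
begin

lemma main_loop:
  assumes s: "base s" and regs: "reg s ''sigma'' = x" "reg s ''mu'' = m" "reg s ''R'' = R" "reg s ''done'' = 0"
    and r0: "\<forall>i. arr s ''r'' i = 0"
    and UV0: "is_U U0 s" "is_V V0 s" "k_repeating k (U0 @ x # V0) S"
    and m: "0 < m" "k * m \<le> count_list S x" and R: "R = count_list S x - k * m"
  shows "wp w (While (Equal (Reg ''done'') (Const 0)) (process;; next_pins))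
    (\<lambda>t s'. t \<le> 7000 * (k * lgn) * n * ((R + k) choose k) + 10 \<and>
      (\<exists>U V. is_U U s' \<and> is_V V s' \<and> subseq U0 U \<and> subseq V0 V \<and>
        k_repeating k (U @ x # V) S \<and>
        (\<forall>r p. nondecr k R r \<longrightarrow> pins S x m k r p \<longrightarrow> blocked S k p U V))) s"
proof -
  define K where "K = 7000 * (k * lgn) * n"
  have n: "1 \<le> n" using k_pos k_le by linarith
  have Rn: "R \<le> n" using count_le_length[of S x] R by simp
  have xS: "x \<in> set S" using subseq_set[OF k_repeating_subseq[OF UV0(3) k_pos]] by simp
  define done_below where "done_below r U V \<longleftrightarrow>
    (\<forall>f p. nondecr k R f \<longrightarrow> lex_less k f r \<longrightarrow> pins S x m k f p \<longrightarrow> blocked S k p U V)" for r U V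
  define all_done where "all_done U V \<longleftrightarrow>
    (\<forall>f p. nondecr k R f \<longrightarrow> pins S x m k f p \<longrightarrow> blocked S k p U V)" for U V
  \<comment> \<open>A choice matters only at the indices below \<open>k\<close>, so being blocked
    has to be carried over between functions that agree there.\<close>
  have blocked_cong: "blocked S k p' U V"
    if "pins S x m k r p" "blocked S k p U V" "pins S x m k f p'" "\<forall>i<k. f i = r i" for r p f p' U V
  proof -
    have "pins S x m k r p'" using that(3,4) by (simp add: pins_def)
    then have "p' i = p i" if "i < k" for i using pins_unique[OF \<open>pins S x m k r p\<close> _ that] by blast
    then have "fits S k p' U' V' \<longleftrightarrow> fits S k p U' V'" for U' V' using fits_cong[OF _ k_pos] by blast
    then show ?thesis using that(2) by (simp add: blocked_def)
  qed
  show ?thesis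
    unfolding K_def[symmetric] all_done_def[symmetric]
  apply (rule wp_While[where I = "\<lambda>s'. base s' \<and> reg s' ''sigma'' = x \<and> reg s' ''mu'' = m \<and>
      reg s' ''R'' = R \<and> (\<exists>U V. is_U U s' \<and> is_V V s' \<and>
      subseq U0 U \<and> subseq V0 V \<and> k_repeating k (U @ x # V) S \<and>
      (if reg s' ''done'' = 0 then nondecr k R (arr s' ''r'') \<and> done_below (arr s' ''r'') U V
       else all_done U V))" and
      \<phi> = "\<lambda>s'. if reg s' ''done'' = 0 then K * lex_rest k R (arr s' ''r'') else 0"])
  subgoal
  proof -
    \<comment> \<open>Vacuous, because no sequence is lexicographically below the zero
      sequence.\<close>
    have "done_below (arr s ''r'') U0 V0" using r0 by (simp add: done_below_def lex_less_def)
    moreover have "nondecr k R (arr s ''r'')" using r0 by (simp add: nondecr_def)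
    ultimately show ?thesis using s regs UV0 by auto
  qed
  subgoal premises prems for s'
  proof -
    from prems obtain U V where UV: "is_U U s'" "is_V V s'"
      "subseq U0 U" "subseq V0 V" "k_repeating k (U @ x # V) S" "nondecr k R (arr s' ''r'')"
      "done_below (arr s' ''r'') U V" and s': "base s'" "reg s' ''sigma'' = x" "reg s' ''mu'' = m"
      "reg s' ''R'' = R" "reg s' ''done'' = 0" by auto
    define r where "r = arr s' ''r''"
    note r = UV(6)[folded r_def]
    obtain p where p: "pins S x m k r p" using pins_ex[OF r[unfolded R] m(2,1)] by blast
    have sub: "subseq (U @ x # V) S" using k_repeating_subseq[OF UV(5) k_pos] .
    have sets: "set U \<subseteq> set S" "set V \<subseteq> set S" using subseq_set[OF sub] by auto
    have lens: "length U \<le> n" "length V \<le> n" using list_emb_length[OF sub] by auto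
    show ?thesis
      unfolding wp_Seq
    apply (rule wp_frame[OF process[OF s'(1) UV(1,2) sets lens s'(2) xS s'(3) m(1) p[unfolded r_def] UV(6)]])
    subgoal premises prems1 for t1 s1
    proof -
      note fr1 = prems1(2)
      note [simp] = frameD[OF fr1]
      from prems1(1) obtain U' V' where U'V': "is_U U' s1" "is_V V' s1"
        "subseq U U'" "subseq V V'" "U' = U \<and> V' = V \<or> fits S k p U' V'" "blocked S k p U' V'" by blast
      have t1: "t1 \<le> 6000 * (k * lgn) * n" using prems1(1) by blast
      have s1: "base s1" using base_frame[OF s'(1) fr1] by simp
      have rep: "k_repeating k (U' @ x # V') S"
      proof (cases "U' = U \<and> V' = V")
        case False
        then have "fits S k p U' V'" using U'V'(5) by blast
        moreover have "\<forall>i<k. p i < n \<and> S ! p i = x" using p by (simp add: pins_def)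
        ultimately show ?thesis unfolding k_repeating_iff_fits[OF k_pos] by blast
      qed (use UV(5) in simp)
      have below: "blocked S k p' U' V'"
        if "nondecr k R f" "lex_less k f r \<or> (\<forall>i<k. f i = r i)" "pins S x m k f p'" for f p'
        using that(2)
      proof
        assume "lex_less k f r"
        then have "blocked S k p' U V" using UV(7) that unfolding done_below_def r_def by blast
        then show ?thesis using U'V'(3,4) by (rule blocked_mono)
      qed (rule blocked_cong[OF p U'V'(6) that(3)])
      have r1: "arr s1 ''r'' = r" by (simp add: r_def)
      have subs: "subseq U0 U'" "subseq V0 V'" using UV(3,4) U'V'(3,4) by (auto intro: subseq_order.trans)
      have next1: "wp w next_pins (\<lambda>t s'. t \<le> 60 * k + 60 \<and>
        (if reg s' ''done'' = 0 then nondecr k R (arr s' ''r'') \<and> lex_less k r (arr s' ''r'') \<and>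
          (\<forall>f. nondecr k R f \<longrightarrow> lex_less k f (arr s' ''r'') \<longrightarrow> lex_less k f r \<or> (\<forall>i<k. f i = r i))
        else \<forall>f. nondecr k R f \<longrightarrow> lex_less k f r \<or> (\<forall>i<k. f i = r i))) s1"
        by (rule next_pins[OF s1 _ Rn, unfolded r1]) (use s'(4,5) r in simp_all)
      show ?thesis
      apply (rule wp_frame[OF next1])
      subgoal premises prems2 for t2 s2
      proof -
        note fr2 = prems2(2)
        note [simp] = frameD[OF fr2]
        have s2: "base s2" using base_frame[OF s1 fr2] by simp
        have h2: "is_U U' s2" "is_V V' s2"
          using holds_frame[OF U'V'(1) fr2] holds_frame[OF U'V'(2) fr2] by simp_all
        have time: "t1 + t2 + 10 \<le> K"
        proof -
          define y where "y = k * lgn"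
          have y: "k \<le> y" "1 \<le> y" using k_lgn by (auto simp: y_def)
          have yn: "y \<le> y * n" using n by simp
          have "t2 + 10 \<le> 130 * y" using prems2(1) y by linarith
          also have "\<dots> \<le> 130 * y * n" using n by simp
          finally have "t1 + t2 + 10 \<le> 6000 * y * n + 130 * y * n" using t1 unfolding y_def by linarith
          also have "\<dots> \<le> 7000 * y * n" by simp
          finally show ?thesis unfolding K_def y_def .
        qed
        show ?thesis
        proof (cases "reg s2 ''done'' = 0")
          case True
          then have n2: "nondecr k R (arr s2 ''r'')" "lex_less k r (arr s2 ''r'')"
            "\<And>f. nondecr k R f \<Longrightarrow> lex_less k f (arr s2 ''r'') \<Longrightarrow> lex_less k f r \<or> (\<forall>i<k. f i = r i)"
            using prems2(1) by auto
          have "done_below (arr s2 ''r'') U' V'" unfolding done_below_def using below n2(3) by blast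
          moreover have "Suc (lex_rest k R (arr s2 ''r'')) \<le> lex_rest k R r"
            using lex_rest_less[OF r n2(2)] by simp
          then have "K * Suc (lex_rest k R (arr s2 ''r'')) \<le> K * lex_rest k R r"
            by (rule mult_le_mono2)
          ultimately show ?thesis using True s2 h2 subs rep n2(1) s' time
            by (auto simp flip: r_def)
        next
          case False
          then have "all_done U' V'" unfolding all_done_def using prems2(1) below by simp
          moreover have "K \<le> K * lex_rest k R r"
            using lex_rest_pos[OF r] by simp
          then have "t1 + t2 + 10 \<le> K * lex_rest k R r" using time by linarith
          ultimately show ?thesis using False s2 h2 subs rep s' time
            by (auto simp flip: r_def)
        qed
      qed
      done
    qed
    done
  qed
  subgoal premises prems for t s'
  proof -
    have "K * lex_rest k R (arr s ''r'') \<le> K * ((R + k) choose k)"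
      using lex_rest_le by (rule mult_le_mono2)
    moreover have "t \<le> K * lex_rest k R (arr s ''r'') + 4" using prems regs by auto
    ultimately have "t \<le> K * ((R + k) choose k) + 10" by linarith
    then show ?thesis using prems regs by auto
  qed
  done
qed

lemma program:
  assumes X: "X = U @ x # V" "x \<notin> set U" "k_repeating k X S"
    and R: "R = count_list S x - k * count_list X x"
  shows "wp w program (\<lambda>t s'. t \<le> 8000 * (k * lgn) * n * ((R + k) choose k) \<and>
      maximal_k_repeating k (output_string s') S \<and> subseq X (output_string s')) (input_state S k X x)"
proof -
  define s where "s = input_state S k X x"
  define m where "m = Suc (count_list V x)"
  have m: "count_list X x = m" "0 < m" using X(1,2) by (simp_all add: m_def count_list_0_iff)
  have km: "k * m \<le> count_list S x" using k_repeating_count[OF X(3), of x] m by simp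
  have cn: "count_list S x \<le> n" by (rule count_le_length)
  have Xn: "length X \<le> n" using list_emb_length[OF k_repeating_subseq[OF X(3) k_pos]] .
  have init: "reg s ''len_S'' = n" "reg s ''k'' = k" "arr s ''S'' = cells S" "arr s ''cnt'' = (\<lambda>_. 0)"
    "reg s ''sigma'' = x" "arr s ''r'' = (\<lambda>_. 0)"
    by (auto simp: s_def input_state_def)
  have holdsX: "holds ''X'' ''len_X'' (U @ x # V) s"
    using X(1) by (simp add: s_def input_state_def holds_def cells_def)
  define y where "y = k * lgn"
  define B where "B = (R + k) choose k"
  have y: "1 \<le> y" using k_lgn by (simp add: y_def)
  have n: "1 \<le> n" using k_pos k_le by linarith
  have B: "1 \<le> B" unfolding B_def using zero_less_binomial[of k "R + k"] by linarith
  show ?thesis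
    unfolding s_def[symmetric] program_def wp_Seq y_def[symmetric] B_def[symmetric]
  apply (rule wp_frame[OF build[OF init(1-4)]])
  subgoal premises prems1 for t1 s1
  proof -
    note fr1 = prems1(2)
    have s1: "base s1" using prems1(1) by simp
    have X1: "holds ''X'' ''len_X'' (U @ x # V) s1" using holds_frame[OF holdsX fr1] by simp
    have \<sigma>1: "reg s1 ''sigma'' = x" using frame_reg[OF fr1] init by simp
    show ?thesis
    apply (rule wp_frame[OF split_U[OF X1 Xn[unfolded X(1)] X(2) \<sigma>1]])
    subgoal premises prems2 for t2 s2
    proof -
      note fr2 = prems2(2)
      have s2: "base s2" using base_frame[OF s1 fr2] by simp
      have X2: "holds ''X'' ''len_X'' (U @ x # V) s2" using holds_frame[OF X1 fr2] by simp
      have \<sigma>2: "reg s2 ''sigma'' = x" using frame_reg[OF fr2] \<sigma>1 by simp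
      have j2: "reg s2 ''j'' = length U" using prems2(1) by simp
      show ?thesis
      apply (rule wp_frame[OF split_V[OF X2 Xn[unfolded X(1)] \<sigma>2 j2]])
      subgoal premises prems3 for t3 s3
      proof -
        note fr3 = prems3(2)
        have s3: "base s3" using base_frame[OF s2 fr3] by simp
        have \<sigma>3: "reg s3 ''sigma'' = x" using frame_reg[OF fr3] \<sigma>2 by simp
        have U3: "is_U U s3" using holds_frame[OF _ fr3] prems2(1) by simp
        have V3: "is_V V s3" and mu3: "reg s3 ''mu'' = m" using prems3(1) by (simp_all add: m_def)
        have r3: "arr s3 ''r'' = (\<lambda>_. 0)"
          using frame_arr[OF fr3] frame_arr[OF fr2] frame_arr[OF fr1] init by simp
        let ?s = "s3\<lparr>reg := (reg s3)(''R'' := R, ''done'' := 0)\<rparr>"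
        have Rs: "(count_list S x - k * m mod 2 ^ w) = R" using km cn word_lin R m(1) by simp
        have t123: "t1 + t2 + t3 \<le> 110 * n + 50" using prems1(1) prems2(1) prems3(1) by simp
        have loop: "wp w (While (Equal (Reg ''done'') (Const 0)) (process;; next_pins))
          (\<lambda>t s'. t \<le> 7000 * y * n * B + 10 \<and>
          (\<exists>U' V'. is_U U' s' \<and> is_V V' s' \<and> subseq U U' \<and> subseq V V' \<and>
            k_repeating k (U' @ x # V') S \<and>
            (\<forall>r p. nondecr k R r \<longrightarrow> pins S x m k r p \<longrightarrow> blocked S k p U' V'))) ?s"
          unfolding y_def B_def
          by (rule main_loop[where m = m])
            (use s3 \<sigma>3 mu3 r3 U3 V3 m km R X in \<open>simp_all add: holds_def\<close>)
        show ?thesis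
        apply (simp add: baseD[OF s3] \<sigma>3 mu3 Rs del: bval.simps)
        apply (rule wp_frame[OF loop[unfolded wp_Seq]])
        subgoal premises prems4 for t4 s4
        proof -
          note fr4 = prems4(2)
          from prems4(1) obtain U' V' where UV: "is_U U' s4" "is_V V' s4"
            "subseq U U'" "subseq V V'" "k_repeating k (U' @ x # V') S"
            "\<And>r p. nondecr k R r \<Longrightarrow> pins S x m k r p \<Longrightarrow> blocked S k p U' V'" by blast
          have lenY: "length (U' @ x # V') \<le> n"
            using list_emb_length[OF k_repeating_subseq[OF UV(5) k_pos]] .
          have \<sigma>4: "reg s4 ''sigma'' = x" using frame_reg[OF fr4] \<sigma>3 by simp
          have max: "maximal_k_repeating k (U' @ x # V') S"
            by (rule maximal_if_blocked[OF k_pos UV(5) m(2)])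
              (use UV(6) R m(1) count_list_mono[OF UV(4), of x] in \<open>simp_all add: m_def\<close>)
          have sub: "subseq X (U' @ x # V')" unfolding X(1) using UV(3,4)
            by (intro list_emb_append_mono) auto
          show ?thesis
          apply (rule wp_frame[OF write_sigma[OF UV(1)]])
          subgoal using lenY by simp
          subgoal premises prems5 for t5 s5
          proof -
            note fr5 = prems5(2)
            have V5: "is_V V' s5" using holds_frame[OF UV(2) fr5] by simp
            have Y5: "holds ''Y'' ''len_Y'' (U' @ [x]) s5" using prems5(1) \<sigma>4 by simp
            show ?thesis
            apply (rule wp_mono[OF write_V[OF V5 Y5]])
            subgoal using lenY by simp
            subgoal premises prems6 for t6 s6
            proof -
              have "holds ''Y'' ''len_Y'' (U' @ x # V') s6" using prems6 by simp
              then have out: "output_string s6 = U' @ x # V'" by (rule output_string_eq)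
              \<comment> \<open>Set-up and output take linear time, which the product absorbs
                because \<open>y\<close> and \<open>B\<close> are at least 1.\<close>
              have "t1 + t2 + t3 + t4 + t5 + t6 + 40 \<le> 170 * n + 160 + 7000 * y * n * B"
                using t123 prems4(1) prems5(1) prems6 by linarith
              also have "\<dots> \<le> 1000 * n + 7000 * y * n * B" using n by simp
              also have "1000 * n \<le> 1000 * n * (y * B)" using y B by simp
              finally have "t1 + t2 + t3 + t4 + t5 + t6 + 40 \<le> 8000 * y * n * B"
                by (simp add: mult_ac)
              then show ?thesis using max sub out by simp
            qed
            done
          qed
          done
        qed
        done
      qed
      done
    qed
    done
  qed
  done
qed

end

theorem theorem2:
  shows "\<exists>(P :: com) (c :: nat) (C :: real). \<forall>(S :: nat list) (k :: nat) (X :: nat list) (\<sigma> :: nat) (w :: nat).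
    0 < k \<and> k_repeating k X S \<and> \<sigma> \<in> set X \<and>
    (\<forall>a \<in> set S. a < 2 ^ w) \<and> (length S + 2) ^ c \<le> 2 ^ w \<longrightarrow>
    (\<exists>(t :: nat) s.
      exec w P (input_state S k X \<sigma>) t s \<and>
      maximal_k_repeating k (output_string s) S \<and>
      subseq X (output_string s) \<and>
      (let n = length S; R = count_list S \<sigma> - k * count_list X \<sigma> in
        real t \<le> C * (real ((R + k) choose k) * real k * real n * max 1 (log 2 (real n)))))"
proof (rule exI[of _ program], rule exI[of _ 4], rule exI[of _ 24000], intro allI impI)
  fix S :: "nat list" and k :: nat and X :: "nat list" and \<sigma> w :: nat
  assume *: "0 < k \<and> k_repeating k X S \<and> \<sigma> \<in> set X \<and>
    (\<forall>a \<in> set S. a < 2 ^ w) \<and> (length S + 2) ^ 4 \<le> 2 ^ w"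
  have "k \<le> k * length X" using * by (cases X) auto
  also have "\<dots> \<le> length S" using k_repeating_length[of k X S] * by simp
  finally have "k \<le> length S" .
  then interpret machine S k w by unfold_locales (use * in auto)
  obtain U V where X: "X = U @ \<sigma> # V" "\<sigma> \<notin> set U" using * split_list_first by metis
  let ?R = "count_list S \<sigma> - k * count_list X \<sigma>"
  obtain t s where ts: "exec w program (input_state S k X \<sigma>) t s"
    "t \<le> 8000 * (k * Suc (lg (length S))) * length S * ((?R + k) choose k)"
    "maximal_k_repeating k (output_string s) S" "subseq X (output_string s)"
    using program[OF X _ refl] * unfolding wp_def by blast
  have n: "0 < length S" using \<open>k \<le> length S\<close> * by linarith
  \<comment> \<open>The maximum with 1 takes care of \<open>n = 1\<close>, where the logarithm
    vanishes. \<open>lg n + 1\<close> is at most \<open>log 2 n + 2\<close> and hence at most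
    \<open>3 * L\<close>, which turns 8000 into 24000.\<close>
  define L where "L = max 1 (log 2 (real (length S)))"
  have "real (Suc (lg (length S))) \<le> 3 * L" using lg_log[OF n] by (simp add: L_def)
  then have kL: "real k * real (Suc (lg (length S))) \<le> real k * (3 * L)" by (rule mult_left_mono) simp
  have "8000 * (real k * real (Suc (lg (length S)))) * (real (length S) * real ((?R + k) choose k))
      \<le> 8000 * (real k * (3 * L)) * (real (length S) * real ((?R + k) choose k))"
    by (intro mult_right_mono[OF mult_left_mono[OF kL]]) simp_all
  moreover have "real t \<le> 8000 * (real k * real (Suc (lg (length S)))) * (real (length S) * real ((?R + k) choose k))"
    using of_nat_mono[OF ts(2), where 'a = real] by (simp only: of_nat_mult of_nat_numeral mult.assoc)
  ultimately have "real t \<le> 8000 * (real k * (3 * L)) * (real (length S) * real ((?R + k) choose k))"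
    by linarith
  then have "real t \<le> 24000 * (real ((?R + k) choose k) * real k * real (length S) * L)"
    by (simp add: mult_ac)
  then show "\<exists>t s. exec w program (input_state S k X \<sigma>) t s \<and>
      maximal_k_repeating k (output_string s) S \<and> subseq X (output_string s) \<and>
      (let n = length S; R = count_list S \<sigma> - k * count_list X \<sigma> in
        real t \<le> 24000 * (real ((R + k) choose k) * real k * real n * max 1 (log 2 (real n))))"
    using ts(1,3,4) unfolding L_def Let_def by blast
qed

end
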